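(* Let $p/q$ be a rational number in lowest terms ($q\geq 1$), with continued fraction expansion $\frac{p}{q}=[a_0;a_1,\ldots,a_{2k}]$ for some integer $k\geq 0$ (with $a_0\in\mathbb{Z}$ and $a_1,\ldots,a_{2k}$ positive integers), and let $q_n$ be the denominators of its convergents, defined by $q_{-1}=0$, $q_0=1$, $q_n=a_nq_{n-1}+q_{n-2}$. Let $(z_n)_{n\geq1}$ be any sequence of positive integers, and define $(x_n)_{n\geq 1}$, $(y_n)_{n\geq0}$ by $$x_1=q,\qquad y_0=q_{2k-1}+1,\qquad x_{n+1}=x_n\,y_{n-1}\,(x_nz_n+1)\ \ (n\geq 1),\qquad y_n=\frac{x_{n+1}}{x_n}\ \ (n\geq 1).$$ Then the sum $$S=\frac{p}{q}+\sum_{j=2}^\infty\frac{1}{x_j}=[a_0;a_1,\ldots,a_{2k},y_0z_1,x_1,y_1z_2,x_2,\ldots,y_{j-1}z_j,x_j,\ldots]$$ is a transcendental number.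
   Context: Notation: $[a_0;a_1,a_2,\ldots]$ denotes the (finite or infinite) simple continued fraction $a_0+1/(a_1+1/(a_2+\cdots))$; the infinite one is the limit of its finite truncations. *)

theory Defs
  imports Complex_Main "HOL-Computational_Algebra.Polynomial"
begin

text \<open>\<open>cfrac_trunc n c\<close> is the finite continued fraction \<open>[c 0; c 1, \<dots>, c n]\<close>.
  The terms are reals only to avoid coercions; integrality is required where needed.\<close>

primrec cfrac_trunc :: "nat \<Rightarrow> (nat \<Rightarrow> real) \<Rightarrow> real" where
  "cfrac_trunc 0 c = c 0"
| "cfrac_trunc (Suc n) c = c 0 + 1 / cfrac_trunc n (\<lambda>i. c (Suc i))"

definition simple_cfrac_expansion :: "(nat \<Rightarrow> real) \<Rightarrow> real \<Rightarrow> bool" where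
  "simple_cfrac_expansion c s \<longleftrightarrow>
     (\<forall>i. c i \<in> \<int>) \<and> (\<forall>i\<ge>1. c i > 0) \<and> (\<lambda>n. cfrac_trunc n c) \<longlonglongrightarrow> s"

text \<open>Denominators of the convergents of \<open>[a 0; a 1, \<dots>]\<close>, with the index shifted by one to
  accommodate \<open>q\<^bsub>-1\<^esub> = 0\<close>: the denominator \<open>q\<^sub>n\<close> is \<open>cfrac_denom a (n + 1)\<close>.\<close>

fun cfrac_denom :: "(nat \<Rightarrow> int) \<Rightarrow> nat \<Rightarrow> int" where
  "cfrac_denom a 0 = 0"
| "cfrac_denom a (Suc 0) = 1"
| "cfrac_denom a (Suc (Suc n)) = a (Suc n) * cfrac_denom a (Suc n) + cfrac_denom a n"

end

theory Submission
  imports Defs "HOL-Library.FuncSet" "HOL-Library.Poly_Mapping" "Jordan_Normal_Form.Determinant"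
    "Jordan_Normal_Form.Char_Poly"
begin

text \<open>The even convergents of the continued fraction are the partial sums of the series, with
  denominators \<open>x n\<close>, and \<open>x (n + 1) \<ge> (x n)\<^sup>2 y (n - 1)\<close> with \<open>y (n - 1) \<ge> sqrt (x n)\<close> for \<open>n \<ge> 2\<close>. So the sum is
  approximated to within \<open>2 (x n) powr (- 5 / 2)\<close> by fractions with denominator \<open>x n\<close>, and Roth's
  theorem excludes that it is algebraic.

  Roth's theorem is proved in the classical way: Siegel's lemma provides an integer polynomial in
  many variables that vanishes to high index at \<open>(\<alpha>, \<dots>, \<alpha>)\<close>; by Roth's lemma its index at a point
  formed by very good approximations with rapidly growing denominators is small; and comparing an
  upper and a lower bound for a nonvanishing derivative at that point gives a contradiction. Roth's
  lemma goes by induction on the number of variables: a generalized Wronskian of the polynomial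
  factors into a polynomial in the last variable and one in the remaining variables.\<close>

section \<open>Polynomials in several variables\<close>

text \<open>Liouville's theorem would not suffice: for bounded \<open>z\<close> the recurrence makes
  \<open>x (n + 1)\<close> of the order of \<open>(x n)^3 / x (n - 1)\<close>, so the approximations
  have exponent about (3 + sqrt 5) / 2, while a hypothetical algebraic sum may have any degree. An
  exponent 2 + \<delta> that is independent of the degree is needed. This forces many variables: the
  share of exponents whose normalized weight is below m (1/2 - \<epsilon>) is at most 1 / (4
  \<epsilon>^2 m), so for m large in terms of the degree d there are few enough conditions for
  Siegel's lemma, even though each of them amounts to d integral equations. The price is that
  nonvanishing near the rational point becomes hard. In one variable Gauss's lemma settles it. In
  several, a Wronskian separates off the last variable, and the derivatives spent on it are harmless
  only because the degrees decrease rapidly. Derivatives at a point are read off as coefficients of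
  the translated polynomial, so that a lower bound for the index merely says which monomials occur;
  such statements pass easily through products and determinants.\<close>

type_synonym expo = "nat \<Rightarrow>\<^sub>0 nat"
type_synonym mpol = "expo \<Rightarrow>\<^sub>0 real"

abbreviation lookup :: "('a \<Rightarrow>\<^sub>0 'b::zero) \<Rightarrow> 'a \<Rightarrow> 'b" where "lookup \<equiv> Poly_Mapping.lookup"
abbreviation keys :: "('a \<Rightarrow>\<^sub>0 'b::zero) \<Rightarrow> 'a set" where "keys \<equiv> Poly_Mapping.keys"
abbreviation single :: "'a \<Rightarrow> 'b::zero \<Rightarrow> 'a \<Rightarrow>\<^sub>0 'b" where "single \<equiv> Poly_Mapping.single"

definition expo_unit :: "nat \<Rightarrow> expo" where "expo_unit k = single k 1"
definition mvar :: "nat \<Rightarrow> mpol" where "mvar k = single (expo_unit k) 1"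

lemma lookup_expo_unit: "lookup (expo_unit k) l = (if l = k then 1 else 0)"
  by (auto simp: expo_unit_def lookup_single when_def)
lemma keys_expo_unit [simp]: "keys (expo_unit k) = {k}" by (simp add: expo_unit_def)

declare Poly_Mapping.single_of_nat [simp del]

lemma poly_mapping_sum_single:
  fixes P :: "'a \<Rightarrow>\<^sub>0 'b::comm_monoid_add"
  assumes "finite S" "keys P \<subseteq> S"
  shows "P = (\<Sum>i\<in>S. single i (lookup P i))"
proof (rule poly_mapping_eqI)
  fix k
  have "lookup (\<Sum>i\<in>S. single i (lookup P i)) k = (\<Sum>i\<in>S. if i = k then lookup P k else 0)"
    by (auto simp: lookup_sum lookup_single when_def intro!: sum.cong)
  also have "\<dots> = lookup P k"
    using assms by (auto simp: sum.delta in_keys_iff)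
  finally show "lookup P k = lookup (\<Sum>i\<in>S. single i (lookup P i)) k" by simp
qed

text \<open>Most operators below are additive, so their identities only have to be checked on
  monomials.\<close>

lemma poly_mapping_additive_induct [case_names zero single add]:
  fixes P :: "'a \<Rightarrow>\<^sub>0 'b::comm_monoid_add"
  assumes "Q 0" "\<And>i c. Q (single i c)" "\<And>P R. Q P \<Longrightarrow> Q R \<Longrightarrow> Q (P + R)"
  shows "Q P"
proof -
  have "Q (\<Sum>i\<in>S. single i (lookup P i))" if "finite S" for S
    using that by (induction S) (use assms in auto)
  from this[of "keys P"] show ?thesis
    using poly_mapping_sum_single[of "keys P" P] by simp
qed

lemma poly_mapping_times_expand:
  "P * R = (\<Sum>i\<in>keys P. \<Sum>j\<in>keys R. single (i + j) (lookup P i * lookup R j))"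
  for P R :: "'a::comm_monoid_add \<Rightarrow>\<^sub>0 'b::comm_ring_1"
proof -
  have "P * R = (\<Sum>i\<in>keys P. single i (lookup P i)) * (\<Sum>j\<in>keys R. single j (lookup R j))"
    using poly_mapping_sum_single[of "keys P" P] poly_mapping_sum_single[of "keys R" R] by simp
  then show ?thesis by (simp add: sum_product mult_single)
qed

lemma lookup_times_expand:
  "lookup (P * R) n = (\<Sum>i\<in>keys P. \<Sum>j\<in>keys R. if i + j = n then lookup P i * lookup R j else 0)"
  for P R :: "'a::comm_monoid_add \<Rightarrow>\<^sub>0 'b::comm_ring_1"
  by (subst poly_mapping_times_expand) (auto simp: lookup_sum lookup_single when_def intro!: sum.cong)

lemma lookup_single_zero_times [simp]:
  "lookup (single 0 c * P) n = c * lookup P n" for P :: mpol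
proof (induction P rule: poly_mapping_additive_induct)
  case (single i d) then show ?case by (simp add: mult_single lookup_single when_def)
next
  case (add P R) then show ?case by (simp add: lookup_add algebra_simps)
qed simp

section \<open>Coefficient norm, integrality and weights\<close>

definition norm1 :: "mpol \<Rightarrow> real" where
  "norm1 P = (\<Sum>i\<in>keys P. \<bar>lookup P i\<bar>)"

lemma norm1_superset:
  assumes "finite S" "keys P \<subseteq> S"
  shows "norm1 P = (\<Sum>i\<in>S. \<bar>lookup P i\<bar>)"
  unfolding norm1_def by (rule sum.mono_neutral_left) (use assms in \<open>auto simp: in_keys_iff\<close>)

lemma norm1_nonneg: "norm1 P \<ge> 0" by (simp add: norm1_def sum_nonneg)
lemma norm1_zero [simp]: "norm1 0 = 0" by (simp add: norm1_def)
lemma norm1_single [simp]: "norm1 (single i c) = \<bar>c\<bar>" by (simp add: norm1_def)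

lemma norm1_add: "norm1 (P + R) \<le> norm1 P + norm1 R"
proof -
  let ?S = "keys P \<union> keys R"
  have "norm1 (P + R) = (\<Sum>i\<in>?S. \<bar>lookup P i + lookup R i\<bar>)"
    using norm1_superset[of ?S "P + R"] keys_add[of P R] by (simp add: lookup_add)
  also have "\<dots> \<le> (\<Sum>i\<in>?S. \<bar>lookup P i\<bar> + \<bar>lookup R i\<bar>)" by (intro sum_mono) simp
  also have "\<dots> = norm1 P + norm1 R"
    using norm1_superset[of ?S P] norm1_superset[of ?S R] by (simp add: sum.distrib)
  finally show ?thesis .
qed

lemma norm1_sum: "norm1 (\<Sum>x\<in>X. f x) \<le> (\<Sum>x\<in>X. norm1 (f x))"
proof (induction X rule: infinite_finite_induct)
  case (insert x F)
  then show ?case using norm1_add[of "f x" "sum f F"] by simp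
qed auto

text \<open>Submultiplicativity is the reason to measure height by the sum of the absolute
  coefficients and not by their maximum: determinants and translates can then be bounded factor by
  factor.\<close>

lemma norm1_mult: "norm1 (P * R) \<le> norm1 P * norm1 R"
proof -
  have "norm1 (P * R) \<le> (\<Sum>i\<in>keys P. \<Sum>j\<in>keys R. \<bar>lookup P i * lookup R j\<bar>)"
    unfolding poly_mapping_times_expand[of P R]
    by (rule order_trans[OF norm1_sum sum_mono], rule order_trans[OF norm1_sum sum_mono]) simp
  also have "\<dots> = norm1 P * norm1 R"
    by (simp add: norm1_def sum_product abs_mult)
  finally show ?thesis .
qed

lemma norm1_one [simp]: "norm1 1 = 1"
  using norm1_single[of 0 1] by simp

lemma norm1_prod: "norm1 (\<Prod>x\<in>X. f x) \<le> (\<Prod>x\<in>X. norm1 (f x))"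
proof (induction X rule: infinite_finite_induct)
  case (insert x F)
  have "norm1 (f x * prod f F) \<le> norm1 (f x) * norm1 (prod f F)" by (rule norm1_mult)
  also have "\<dots> \<le> norm1 (f x) * (\<Prod>x\<in>F. norm1 (f x))"
    by (intro mult_left_mono insert norm1_nonneg)
  finally show ?case using insert by simp
qed auto

lemma abs_lookup_le_norm1: "\<bar>lookup P i\<bar> \<le> norm1 P"
proof (cases "i \<in> keys P")
  case True
  then show ?thesis unfolding norm1_def by (intro member_le_sum) auto
qed (simp add: norm1_nonneg in_keys_iff)

text \<open>Integrality is a predicate on real polynomials and not a separate type, so that the same
  polynomial can be translated by a real point and factored over the reals.\<close>

definition int_poly :: "mpol \<Rightarrow> bool" where
  "int_poly P \<longleftrightarrow> (\<forall>i. lookup P i \<in> \<int>)"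

lemma int_poly_add: "int_poly P \<Longrightarrow> int_poly R \<Longrightarrow> int_poly (P + R)"
  by (simp add: int_poly_def lookup_add)
lemma int_poly_0: "int_poly 0" by (simp add: int_poly_def)
lemma int_poly_1: "int_poly 1" by (simp add: int_poly_def lookup_one when_def)
lemma int_poly_uminus: "int_poly P \<Longrightarrow> int_poly (- P)" by (simp add: int_poly_def)
lemma int_poly_mult: "int_poly P \<Longrightarrow> int_poly R \<Longrightarrow> int_poly (P * R)"
  unfolding int_poly_def lookup_times_expand by (intro allI Ints_sum) auto
lemma int_poly_sum: "(\<And>x. x \<in> X \<Longrightarrow> int_poly (f x)) \<Longrightarrow> int_poly (\<Sum>x\<in>X. f x)"
  by (induction X rule: infinite_finite_induct) (auto intro: int_poly_add int_poly_0)
lemma int_poly_prod: "(\<And>x. x \<in> X \<Longrightarrow> int_poly (f x)) \<Longrightarrow> int_poly (\<Prod>x\<in>X. f x)"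
  by (induction X rule: infinite_finite_induct) (auto intro: int_poly_mult int_poly_1)

lemma norm1_ge_1: "int_poly P \<Longrightarrow> P \<noteq> 0 \<Longrightarrow> norm1 P \<ge> 1"
proof -
  assume *: "int_poly P" "P \<noteq> 0"
  then obtain i where "i \<in> keys P" by (metis keys_eq_empty ex_in_conv)
  then have "lookup P i \<in> \<int>" "lookup P i \<noteq> 0" using * by (auto simp: int_poly_def in_keys_iff)
  then have "\<bar>lookup P i\<bar> \<ge> 1" by (simp add: Ints_nonzero_abs_ge1)
  then show ?thesis using abs_lookup_le_norm1[of P i] by linarith
qed

text \<open>Applied both to the weight of an exponent and to minus one of its coordinates, so that
  lower bounds for the index and upper bounds for partial degrees share one argument.\<close>
definition wt_ge :: "(expo \<Rightarrow> real) \<Rightarrow> real \<Rightarrow> mpol \<Rightarrow> bool" where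
  "wt_ge w t P \<longleftrightarrow> (\<forall>i\<in>keys P. t \<le> w i)"

locale additive_weight =
  fixes w :: "expo \<Rightarrow> real"
  assumes w_add: "w (i + j) = w i + w j"
begin

lemma w_zero: "w 0 = 0" using w_add[of 0 0] by simp

lemma wt_ge_0 [simp]: "wt_ge w t 0" by (simp add: wt_ge_def)
lemma wt_ge_1: "wt_ge w 0 1" by (simp add: wt_ge_def w_zero)
lemma wt_ge_add: "wt_ge w t P \<Longrightarrow> wt_ge w t R \<Longrightarrow> wt_ge w t (P + R)"
  unfolding wt_ge_def using keys_add[of P R] by blast
lemma wt_ge_uminus: "wt_ge w t P \<Longrightarrow> wt_ge w t (- P)"
  by (auto simp: wt_ge_def in_keys_iff)
lemma wt_ge_sum: "(\<And>x. x \<in> X \<Longrightarrow> wt_ge w t (f x)) \<Longrightarrow> wt_ge w t (\<Sum>x\<in>X. f x)"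
  by (induction X rule: infinite_finite_induct) (auto intro: wt_ge_add)
lemma wt_ge_mult: "wt_ge w s P \<Longrightarrow> wt_ge w t R \<Longrightarrow> wt_ge w (s + t) (P * R)"
  unfolding wt_ge_def using keys_mult[of P R] by (force simp: w_add intro: add_mono)
lemma wt_ge_prod:
  "finite X \<Longrightarrow> (\<And>x. x \<in> X \<Longrightarrow> wt_ge w (t x) (f x)) \<Longrightarrow> wt_ge w (\<Sum>x\<in>X. t x) (\<Prod>x\<in>X. f x)"
  by (induction X rule: finite_induct) (auto intro: wt_ge_mult wt_ge_1)

text \<open>Each product in the Leibniz formula takes exactly one entry from every column, and the
  bound \<open>t b\<close> depends on the column alone, so all products get the same total.\<close>

lemma wt_ge_det:
  assumes "M \<in> carrier_mat h h" "\<And>a b. a < h \<Longrightarrow> b < h \<Longrightarrow> wt_ge w (t b) (M $$ (a, b))"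
  shows "wt_ge w (\<Sum>b<h. t b) (det M)"
  unfolding det_def'[OF assms(1)]
proof (rule wt_ge_sum)
  fix p assume p: "p \<in> {p. p permutes {0..<h}}"
  then have pp: "p permutes {0..<h}" by simp
  have "wt_ge w (\<Sum>i\<in>{0..<h}. t (p i)) (\<Prod>i\<in>{0..<h}. M $$ (i, p i))"
    by (rule wt_ge_prod) (use assms pp permutes_in_image[OF pp] in auto)
  moreover have "(\<Sum>i\<in>{0..<h}. t (p i)) = (\<Sum>b<h. t b)"
    using sum.permute[OF pp, of t] by (simp add: atLeast0LessThan)
  ultimately show "wt_ge w (\<Sum>b<h. t b) (signof p * (\<Prod>i\<in>{0..<h}. M $$ (i, p i)))"
    using wt_ge_uminus by (auto simp: sign_def)
qed

end

lemma int_poly_det: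
  assumes "M \<in> carrier_mat h h" "\<And>a b. a < h \<Longrightarrow> b < h \<Longrightarrow> int_poly (M $$ (a, b))"
  shows "int_poly (det M)"
  unfolding det_def'[OF assms(1)]
proof (rule int_poly_sum)
  fix p assume "p \<in> {p. p permutes {0..<h}}"
  then have pp: "p permutes {0..<h}" by simp
  have "int_poly (\<Prod>i\<in>{0..<h}. M $$ (i, p i))"
    by (rule int_poly_prod) (use assms pp permutes_in_image[OF pp] in auto)
  then show "int_poly (signof p * (\<Prod>i\<in>{0..<h}. M $$ (i, p i)))"
    using int_poly_uminus by (auto simp: sign_def)
qed

lemma norm1_uminus [simp]: "norm1 (- P) = norm1 P"
  by (simp add: norm1_def)

lemma norm1_det:
  assumes "M \<in> carrier_mat h h" "\<And>a b. a < h \<Longrightarrow> b < h \<Longrightarrow> norm1 (M $$ (a, b)) \<le> C"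
  shows "norm1 (det M) \<le> fact h * C ^ h"
proof -
  have "norm1 (det M) \<le> (\<Sum>p | p permutes {0..<h}. C ^ h)"
    unfolding det_def'[OF assms(1)]
  proof (rule order_trans[OF norm1_sum sum_mono])
    fix p assume "p \<in> {p. p permutes {0..<h}}"
    then have pp: "p permutes {0..<h}" by simp
    have "norm1 (signof p * (\<Prod>i\<in>{0..<h}. M $$ (i, p i))) = norm1 (\<Prod>i\<in>{0..<h}. M $$ (i, p i))"
      by (auto simp: sign_def)
    also have "\<dots> \<le> (\<Prod>i\<in>{0..<h}. norm1 (M $$ (i, p i)))" by (rule norm1_prod)
    also have "\<dots> \<le> (\<Prod>i\<in>{0..<h}. C)"
      by (intro prod_mono) (use assms pp permutes_in_image[OF pp] norm1_nonneg in auto)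
    finally show "norm1 (signof p * (\<Prod>i\<in>{0..<h}. M $$ (i, p i))) \<le> C ^ h" by simp
  qed
  also have "\<dots> = fact h * C ^ h"
    by (simp add: card_permutations[of "{0..<h}" h])
  finally show ?thesis .
qed

section \<open>Binomials of exponents and divided derivatives\<close>

lemma expo_induct [case_names zero unit]:
  fixes i :: expo
  assumes "Q 0" "\<And>i k. Q i \<Longrightarrow> Q (i + expo_unit k)"
  shows "Q i"
proof -
  \<comment> \<open>The claim is shifted by an arbitrary \<open>j\<close>, so that in the case of a
    sum the two hypotheses can be chained.\<close>
  have "\<forall>j. Q j \<longrightarrow> Q (j + i)"
  proof (induction i rule: poly_mapping_additive_induct)
    case (single k n)
    show ?case
    proof (intro allI impI)
      fix j assume "Q j"
      then show "Q (j + single k n)"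
      proof (induction n)
        case (Suc n)
        have "single k (Suc n) = single k n + expo_unit k"
          by (simp add: expo_unit_def flip: single_add)
        then show ?case using assms(2)[of "j + single k n" k] Suc by (simp add: add.assoc)
      qed simp
    qed
  next
    case (add P R)
    then show ?case by (metis add.assoc)
  qed simp
  then show ?thesis using assms(1) by force
qed

lemma expo_unit_cases:
  fixes i :: expo
  obtains "lookup i k = 0" | j where "i = j + expo_unit k"
proof (cases "lookup i k = 0")
  case False
  have "i = (i - expo_unit k) + expo_unit k"
    by (rule poly_mapping_eqI)
      (use False in \<open>auto simp: lookup_add minus_poly_mapping.rep_eq lookup_expo_unit\<close>)
  then show ?thesis using that by blast
qed (use that in blast)

definition mbinom :: "expo \<Rightarrow> expo \<Rightarrow> nat" where
  "mbinom i s = (\<Prod>k\<in>keys s. lookup i k choose lookup s k)"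

lemma mbinom_superset:
  assumes "finite S" "keys s \<subseteq> S"
  shows "mbinom i s = (\<Prod>k\<in>S. lookup i k choose lookup s k)"
  unfolding mbinom_def
  by (rule prod.mono_neutral_left) (use assms in \<open>auto simp: in_keys_iff\<close>)

lemma mbinom_zero [simp]: "mbinom i 0 = 1" by (simp add: mbinom_def)

lemma mbinom_eq_0: "lookup i k < lookup s k \<Longrightarrow> mbinom i s = 0"
  unfolding mbinom_def by (rule prod_zero) (auto simp: in_keys_iff intro!: bexI[of _ k])

lemma mbinom_cong_keys: "(\<And>k. k \<in> keys s \<Longrightarrow> lookup i k = lookup j k) \<Longrightarrow> mbinom i s = mbinom j s"
  unfolding mbinom_def by (rule prod.cong) auto

lemma keys_add_nat: "keys (i + j :: expo) = keys i \<union> keys j"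
  by (auto simp: in_keys_iff lookup_add)

lemma expo_add_eq_0: "i + j = 0 \<longleftrightarrow> i = 0 \<and> j = 0" for i j :: expo
  by (metis keys_add_nat Un_empty keys_eq_empty keys_zero)

text \<open>The identity for a product of two nested binomial coefficients, taken coordinatewise. It
  is the composition law of divided derivatives.\<close>

lemma mbinom_mult:
  "mbinom (i + s) s * mbinom (i + s + t) t = mbinom (s + t) s * mbinom (i + (s + t)) (s + t)"
proof -
  let ?S = "keys s \<union> keys t"
  have *: "((a + b) choose b) * ((a + b + c) choose c) = ((b + c) choose b) * ((a + b + c) choose (b + c))"
    for a b c :: nat
    using choose_mult[of c "b + c" "a + b + c"] binomial_symmetric[of b "b + c"] by (simp add: ac_simps)
  have "mbinom (i + s) s * mbinom (i + s + t) t =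
     (\<Prod>k\<in>?S. (lookup (i + s) k choose lookup s k) * (lookup (i + s + t) k choose lookup t k))"
    by (simp add: mbinom_superset[of ?S] prod.distrib)
  also have "\<dots> = (\<Prod>k\<in>?S. (lookup (s + t) k choose lookup s k) * (lookup (i + s + t) k choose lookup (s + t) k))"
    by (intro prod.cong refl) (simp add: lookup_add *)
  also have "\<dots> = mbinom (s + t) s * mbinom (i + (s + t)) (s + t)"
    by (simp add: mbinom_superset[of ?S] keys_add_nat prod.distrib add.assoc)
  finally show ?thesis .
qed

lemma mbinom_split:
  "mbinom i s = (lookup i k choose lookup s k) * (\<Prod>l\<in>keys s - {k}. lookup i l choose lookup s l)"
  using mbinom_superset[of "insert k (keys s)" s i]
  by (simp add: prod.insert_remove subset_insertI)

lemma mbinom_add_unit_other: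
  "lookup s k = 0 \<Longrightarrow> mbinom (i + expo_unit k) s = mbinom i s"
  by (rule mbinom_cong_keys) (auto simp: lookup_add lookup_expo_unit in_keys_iff)

lemma mbinom_pascal:
  "mbinom (i + expo_unit k) (s + expo_unit k) = mbinom i (s + expo_unit k) + mbinom i s"
proof -
  have K: "keys (s + expo_unit k) - {k} = keys s - {k}" by (auto simp: keys_add_nat)
  have P: "(\<Prod>l\<in>keys s - {k}. lookup (i + u) l choose lookup (s + expo_unit k) l) =
      (\<Prod>l\<in>keys s - {k}. lookup i l choose lookup s l)" if "u \<in> {0, expo_unit k}" for u
    by (rule prod.cong) (use that in \<open>auto simp: lookup_add lookup_expo_unit\<close>)
  show ?thesis
    using P[of "expo_unit k"] P[of 0]
    by (simp add: mbinom_split[of _ _ k] K lookup_add lookup_expo_unit ring_distribs)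
qed

text \<open>The partial derivative of order \<open>s\<close> divided by the factorials of
  \<open>s\<close>. The division keeps integral coefficients integral, and the factors that remain
  are binomials, so that norms grow only by a power of 2 and not by factorials.\<close>

lift_definition hasse :: "expo \<Rightarrow> mpol \<Rightarrow> mpol" is
  "\<lambda>s f i. real (mbinom (i + s) s) * f (i + s)"
proof -
  fix s :: expo and f :: "expo \<Rightarrow> real"
  assume "finite {i. f i \<noteq> 0}"
  then have "finite ((\<lambda>i. i + s) -` {i. f i \<noteq> 0})"
    by (rule finite_vimageI) (simp add: inj_on_def)
  then show "finite {i. real (mbinom (i + s) s) * f (i + s) \<noteq> 0}"
    by (rule rev_finite_subset) auto
qed

lemma lookup_hasse: "lookup (hasse s P) i = real (mbinom (i + s) s) * lookup P (i + s)"
  by transfer simp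

lemma hasse_zero [simp]: "hasse 0 P = P"
  by (rule poly_mapping_eqI) (simp add: lookup_hasse)
lemma hasse_0_right [simp]: "hasse s 0 = 0"
  by (rule poly_mapping_eqI) (simp add: lookup_hasse)
lemma hasse_add: "hasse s (P + R) = hasse s P + hasse s R"
  by (rule poly_mapping_eqI) (simp add: lookup_hasse lookup_add algebra_simps)
lemma hasse_sum: "hasse s (\<Sum>x\<in>X. f x) = (\<Sum>x\<in>X. hasse s (f x))"
  by (induction X rule: infinite_finite_induct) (auto simp: hasse_add)
lemma hasse_scale: "hasse s (single 0 c * P) = single 0 c * hasse s P"
  by (rule poly_mapping_eqI) (simp add: lookup_hasse)
lemma hasse_hasse: "hasse s (hasse t P) = single 0 (real (mbinom (s + t) s)) * hasse (s + t) P"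
proof (rule poly_mapping_eqI)
  fix i
  show "lookup (hasse s (hasse t P)) i = lookup (single 0 (real (mbinom (s + t) s)) * hasse (s + t) P) i"
    using arg_cong[OF mbinom_mult[of i s t], of real]
    by (simp add: lookup_hasse add.assoc mult.assoc[symmetric])
qed
lemma int_poly_hasse: "int_poly P \<Longrightarrow> int_poly (hasse s P)"
  by (simp add: int_poly_def lookup_hasse)
lemma keys_hasse: "i \<in> keys (hasse s P) \<Longrightarrow> i + s \<in> keys P"
  by (simp add: in_keys_iff lookup_hasse)

lemma lookup_mvar_times_add: "lookup (mvar k * P) (i + expo_unit k) = lookup P i"
proof (induction P rule: poly_mapping_additive_induct)
  case (single j c)
  then show ?case by (auto simp: mvar_def mult_single lookup_single when_def lookup_expo_unit add.commute)
qed (simp_all add: lookup_add algebra_simps)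

lemma lookup_mvar_times_0: "lookup i k = 0 \<Longrightarrow> lookup (mvar k * P) i = 0"
proof (induction P rule: poly_mapping_additive_induct)
  case (single j c)
  then show ?case by (auto simp: mvar_def mult_single lookup_single when_def lookup_expo_unit lookup_add)
qed (simp_all add: lookup_add algebra_simps)

lemma hasse_mvar_times_other:
  assumes "lookup s k = 0"
  shows "hasse s (mvar k * P) = mvar k * hasse s P"
proof (rule poly_mapping_eqI)
  fix i
  show "lookup (hasse s (mvar k * P)) i = lookup (mvar k * hasse s P) i"
  proof (cases i k rule: expo_unit_cases)
    case 1 then show ?thesis using assms by (simp add: lookup_hasse lookup_mvar_times_0 lookup_add)
  next
    case (2 j)
    have "j + expo_unit k + s = (j + s) + expo_unit k" by (simp add: ac_simps)
    then show ?thesis using 2 assms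
      by (simp add: lookup_hasse lookup_mvar_times_add mbinom_add_unit_other)
  qed
qed

text \<open>Leibniz rule for a factor that is a variable: of its divided derivatives only those of
  order 0 and 1 in direction \<open>k\<close> survive, and Pascal's rule does the counting.\<close>

lemma hasse_mvar_times_unit:
  "hasse (s + expo_unit k) (mvar k * P) = mvar k * hasse (s + expo_unit k) P + hasse s P"
proof (rule poly_mapping_eqI)
  fix i
  have A: "lookup (hasse (s + expo_unit k) (mvar k * P)) i
     = real (mbinom (i + s) (s + expo_unit k) + mbinom (i + s) s) * lookup P (i + s)"
    by (simp add: lookup_hasse lookup_mvar_times_add mbinom_pascal add.assoc[symmetric])
  show "lookup (hasse (s + expo_unit k) (mvar k * P)) i
     = lookup (mvar k * hasse (s + expo_unit k) P + hasse s P) i"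
  proof (cases i k rule: expo_unit_cases)
    case 1
    then have "mbinom (i + s) (s + expo_unit k) = 0"
      by (intro mbinom_eq_0[of _ k]) (simp add: lookup_add lookup_expo_unit)
    then show ?thesis using A 1 by (simp add: lookup_add lookup_mvar_times_0 lookup_hasse)
  next
    case (2 j)
    have "j + (s + expo_unit k) = i + s" using 2 by (simp add: ac_simps)
    then show ?thesis using A 2
      by (simp add: lookup_add lookup_mvar_times_add lookup_hasse algebra_simps)
  qed
qed

section \<open>Substitution, translation and Taylor's formula\<close>

definition mpower :: "(nat \<Rightarrow> 'b::comm_ring_1) \<Rightarrow> expo \<Rightarrow> 'b" where
  "mpower g i = (\<Prod>k\<in>keys i. g k ^ lookup i k)"

text \<open>The parameter \<open>e\<close> embeds the coefficients, so that evaluation at real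
  points, translation and the passage to polynomials in one variable are instances of one
  homomorphism.\<close>

definition insertion :: "(real \<Rightarrow> 'b::comm_ring_1) \<Rightarrow> (nat \<Rightarrow> 'b) \<Rightarrow> mpol \<Rightarrow> 'b" where
  "insertion e g P = (\<Sum>i\<in>keys P. e (lookup P i) * mpower g i)"

lemma mpower_superset:
  assumes "finite S" "keys i \<subseteq> S"
  shows "mpower g i = (\<Prod>k\<in>S. g k ^ lookup i k)"
  unfolding mpower_def
  by (rule prod.mono_neutral_left) (use assms in \<open>auto simp: in_keys_iff\<close>)

lemma mpower_zero [simp]: "mpower g 0 = 1" by (simp add: mpower_def)

lemma mpower_add: "mpower g (i + j) = mpower g i * mpower g j"
  using mpower_superset[of "keys i \<union> keys j" i g] mpower_superset[of "keys i \<union> keys j" j g]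
    mpower_superset[of "keys i \<union> keys j" "i + j" g]
  by (simp add: keys_add_nat lookup_add power_add prod.distrib)

lemma mpower_unit [simp]: "mpower g (expo_unit k) = g k" by (simp add: mpower_def lookup_expo_unit)

locale real_embedding =
  fixes e :: "real \<Rightarrow> 'b::comm_ring_1"
  assumes e_add: "e (x + y) = e x + e y" and e_mult: "e (x * y) = e x * e y" and e_1: "e 1 = 1"
begin

lemma e_0: "e 0 = 0" using e_add[of 0 0] by simp

lemma insertion_superset:
  assumes "finite S" "keys P \<subseteq> S"
  shows "insertion e g P = (\<Sum>i\<in>S. e (lookup P i) * mpower g i)"
  unfolding insertion_def
  by (rule sum.mono_neutral_left) (use assms in \<open>auto simp: in_keys_iff e_0\<close>)

lemma insertion_zero [simp]: "insertion e g 0 = 0" by (simp add: insertion_def)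
lemma insertion_single [simp]: "insertion e g (single i c) = e c * mpower g i"
  by (cases "c = 0") (simp_all add: insertion_def e_0)
lemma insertion_add: "insertion e g (P + R) = insertion e g P + insertion e g R"
  using insertion_superset[of "keys P \<union> keys R" P g] insertion_superset[of "keys P \<union> keys R" R g]
    insertion_superset[of "keys P \<union> keys R" "P + R" g] keys_add[of P R]
  by (simp add: lookup_add e_add ring_distribs sum.distrib)
lemma insertion_sum: "insertion e g (\<Sum>x\<in>X. f x) = (\<Sum>x\<in>X. insertion e g (f x))"
  by (induction X rule: infinite_finite_induct) (auto simp: insertion_add)
lemma insertion_mult: "insertion e g (P * R) = insertion e g P * insertion e g R"
  unfolding poly_mapping_times_expand[of P R]
  by (simp add: insertion_sum mpower_add e_mult)
     (simp add: insertion_def sum_product mult_ac)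
lemma insertion_one [simp]: "insertion e g 1 = 1"
  using insertion_single[of g 0 1] by (simp add: e_1)
lemma insertion_power: "insertion e g (P ^ n) = insertion e g P ^ n"
  by (induction n) (simp_all add: insertion_mult)
lemma insertion_prod: "insertion e g (\<Prod>x\<in>X. f x) = (\<Prod>x\<in>X. insertion e g (f x))"
  by (induction X rule: infinite_finite_induct) (simp_all add: insertion_mult)

end

interpretation eval: real_embedding "\<lambda>x::real. x" by standard simp_all
interpretation const: real_embedding "\<lambda>x. single 0 x :: mpol"
  by standard (simp_all add: single_add mult_single)

abbreviation ev :: "(nat \<Rightarrow> real) \<Rightarrow> mpol \<Rightarrow> real" where
  "ev b \<equiv> insertion (\<lambda>x. x) b"
text \<open>The polynomial P(b + X). The index of P at b is the least weight of an exponent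
  occurring in it.\<close>

definition translate :: "(nat \<Rightarrow> real) \<Rightarrow> mpol \<Rightarrow> mpol" where
  "translate b = insertion (single 0) (\<lambda>k. single 0 (b k) + mvar k)"

lemma translate_mult: "translate b (P * R) = translate b P * translate b R"
  by (simp add: translate_def const.insertion_mult)
lemma translate_add: "translate b (P + R) = translate b P + translate b R"
  by (simp add: translate_def const.insertion_add)
lemma translate_0 [simp]: "translate b 0 = 0" by (simp add: translate_def)
lemma translate_1 [simp]: "translate b 1 = 1" by (simp add: translate_def)
lemma translate_mvar: "translate b (mvar k) = single 0 (b k) + mvar k"
  by (simp add: translate_def mvar_def[of k] const.e_1)

lemma ev_mvar: "ev b (mvar k) = b k"
  by (simp add: mvar_def)

text \<open>Multiplying the monomial by one more variable changes both sides by the same rule: on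
  the left by the factor \<open>b k\<close> plus the variable, on the right by the Leibniz
  rule.\<close>

lemma lookup_translate_single: "lookup (translate b (single i c)) s = ev b (hasse s (single i c))"
proof (induction i arbitrary: s rule: expo_induct)
    case zero
    show ?case
    proof (cases "s = 0")
      case True
      show ?thesis unfolding True hasse_zero by (simp add: translate_def)
    next
      case False
      have h: "hasse s (single 0 c) = 0"
      proof (rule poly_mapping_eqI)
        fix i
        have "0 \<noteq> i + s" using False expo_add_eq_0[of i s] by metis
        then have "lookup (single 0 c) (i + s) = 0" by (rule lookup_single_not_eq)
        then show "lookup (hasse s (single 0 c)) i = lookup 0 i"
          unfolding lookup_hasse lookup_zero by (metis mult_zero_right)
      qed
      have t: "translate b (single 0 c) = single 0 c" by (simp add: translate_def)
      have "0 \<noteq> s" using False by metis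
      then have "lookup (single 0 c) s = 0" by (rule lookup_single_not_eq)
      then show ?thesis unfolding h t eval.insertion_zero .
    qed
  next
    case (unit i k)
    have e: "single (i + expo_unit k) c = mvar k * single i c" by (simp add: mvar_def mult_single add.commute)
    have t: "translate b (single (i + expo_unit k) c)
      = single 0 (b k) * translate b (single i c) + mvar k * translate b (single i c)"
      unfolding e translate_mult translate_mvar by (rule distrib_right)
    show ?case
    proof (cases s k rule: expo_unit_cases)
      case 1
      have "ev b (hasse s (single (i + expo_unit k) c)) = b k * ev b (hasse s (single i c))"
        unfolding e hasse_mvar_times_other[OF 1] eval.insertion_mult ev_mvar by (rule refl)
      then show ?thesis unfolding t lookup_add lookup_single_zero_times lookup_mvar_times_0[OF 1] unit by simp
    next
      case (2 j)
      have "ev b (hasse s (single (i + expo_unit k) c))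
          = b k * ev b (hasse s (single i c)) + ev b (hasse j (single i c))"
        unfolding e 2 hasse_mvar_times_unit eval.insertion_mult eval.insertion_add ev_mvar by (rule refl)
      then show ?thesis unfolding t lookup_add lookup_single_zero_times unit 2 lookup_mvar_times_add by simp
    qed
  qed

text \<open>Taylor's formula. It turns nonvanishing of a derivative at \<open>b\<close> into
  membership in the \<open>keys\<close> of the translate.\<close>

lemma lookup_translate: "lookup (translate b P) s = ev b (hasse s P)"
proof (induction P rule: poly_mapping_additive_induct)
  case zero
  show ?case unfolding translate_0 hasse_0_right eval.insertion_zero by (rule lookup_zero)
next
  case (add P R)
  show ?case unfolding translate_add lookup_add hasse_add eval.insertion_add add by (rule refl)
next
  case (single i c)
  show ?case by (rule lookup_translate_single)
qed

section \<open>Generalized Wronskians\<close>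

lift_definition restr :: "nat set \<Rightarrow> expo \<Rightarrow> expo" is "\<lambda>K f k. if k \<in> K then f k else 0"
  by (rule rev_finite_subset) auto

lemma lookup_restr: "lookup (restr K i) k = (if k \<in> K then lookup i k else 0)"
  by transfer simp
lemma keys_restr: "keys (restr K i) = keys i \<inter> K"
  by (auto simp: in_keys_iff lookup_restr split: if_splits)
lemma restr_add: "restr K (i + j) = restr K i + restr K j"
  by (rule poly_mapping_eqI) (simp add: lookup_restr lookup_add)
lemma restr_split: "restr K i + restr (- K) i = i"
  by (rule poly_mapping_eqI) (simp add: lookup_restr lookup_add)
lemma restr_id: "keys i \<subseteq> K \<Longrightarrow> restr K i = i"
  by (rule poly_mapping_eqI) (auto simp: lookup_restr in_keys_iff)
lemma restr_0: "keys i \<inter> K = {} \<Longrightarrow> restr K i = 0"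
  by (rule poly_mapping_eqI) (auto simp: lookup_restr in_keys_iff)

definition in_vars :: "nat set \<Rightarrow> mpol \<Rightarrow> bool" where
  "in_vars K P \<longleftrightarrow> (\<forall>i\<in>keys P. keys i \<subseteq> K)"

text \<open>Absence of a variable is a lower bound for minus the degree in it, so the weight bound
  for determinants also shows which variables a determinant contains.\<close>

lemma in_vars_iff_wt_ge: "in_vars K P \<longleftrightarrow> (\<forall>k\<in>-K. wt_ge (\<lambda>i. - real (lookup i k)) 0 P)"
proof -
  have "0 \<le> - real (lookup i k) \<longleftrightarrow> k \<notin> keys i" for i :: expo and k by (simp add: in_keys_iff)
  then show ?thesis unfolding in_vars_def wt_ge_def by blast
qed

lemma additive_weight_coord: "additive_weight (\<lambda>i. - real (lookup i k))"
  by standard (simp add: lookup_add)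

lemma in_vars_det:
  assumes "M \<in> carrier_mat h h" "\<And>a b. a < h \<Longrightarrow> b < h \<Longrightarrow> in_vars K (M $$ (a, b))"
  shows "in_vars K (det M)"
  using additive_weight.wt_ge_det[OF additive_weight_coord assms(1), where t = "\<lambda>_. 0"] assms(2)
  by (auto simp: in_vars_iff_wt_ge)

lemma in_vars_add: "in_vars K P \<Longrightarrow> in_vars K R \<Longrightarrow> in_vars K (P + R)"
  unfolding in_vars_def using keys_add[of P R] by blast
lemma in_vars_zero [simp]: "in_vars K 0" by (simp add: in_vars_def)
lemma in_vars_single: "keys i \<subseteq> K \<Longrightarrow> in_vars K (single i c)" by (simp add: in_vars_def)
lemma in_vars_sum: "(\<And>x. x \<in> X \<Longrightarrow> in_vars K (f x)) \<Longrightarrow> in_vars K (\<Sum>x\<in>X. f x)"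
  by (induction X rule: infinite_finite_induct) (auto intro: in_vars_add)
lemma in_vars_scale: "in_vars K P \<Longrightarrow> in_vars K (single 0 c * P)"
  by (auto simp: in_vars_def in_keys_iff)
lemma in_vars_mono: "in_vars K P \<Longrightarrow> K \<subseteq> L \<Longrightarrow> in_vars L P"
  by (auto simp: in_vars_def)
lemma in_vars_hasse: "in_vars K P \<Longrightarrow> in_vars K (hasse s P)"
  unfolding in_vars_def using keys_hasse[of _ s P] by (force simp: keys_add_nat)

lemma hasse_eq_0_vars:
  assumes "in_vars K P" "\<not> keys s \<subseteq> K"
  shows "hasse s P = 0"
proof -
  have "i \<notin> keys (hasse s P)" for i
  proof
    assume "i \<in> keys (hasse s P)"
    then have "keys (i + s) \<subseteq> K" using assms(1) keys_hasse unfolding in_vars_def by blast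
    then show False using assms(2) by (simp add: keys_add_nat)
  qed
  then have "keys (hasse s P) = {}" by blast
  then show ?thesis by simp
qed

lemma in_vars_translate:
  assumes "in_vars K P"
  shows "in_vars K (translate b P)"
  unfolding in_vars_def
proof
  fix i assume i: "i \<in> keys (translate b P)"
  show "keys i \<subseteq> K"
  proof (rule ccontr)
    assume "\<not> keys i \<subseteq> K"
    then have h: "hasse i P = 0" by (rule hasse_eq_0_vars[OF assms])
    have "lookup (translate b P) i = 0"
      by (simp only: lookup_translate h eval.insertion_zero)
    with i show False by (simp add: in_keys_iff)
  qed
qed

text \<open>With disjoint sets of variables an exponent splits in only one way, so nothing can
  cancel in the product.\<close>

lemma lookup_times_disjoint:
  assumes "in_vars K P" "in_vars (- K) R"
  shows "lookup (P * R) n = lookup P (restr K n) * lookup R (restr (- K) n)"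
proof -
  have *: "i + j = n \<longleftrightarrow> i = restr K n \<and> j = restr (- K) n" if "i \<in> keys P" "j \<in> keys R" for i j
  proof
    assume "i + j = n"
    moreover have "restr K i = i" "restr (- K) j = j" "restr (- K) i = 0" "restr K j = 0"
      using that assms by (auto simp: in_vars_def intro!: restr_id restr_0)
    ultimately show "i = restr K n \<and> j = restr (- K) n" by (auto simp: restr_add)
  qed (simp add: restr_split)
  have "lookup (P * R) n = (\<Sum>i\<in>keys P. \<Sum>j\<in>keys R.
      if i = restr K n then if j = restr (- K) n then lookup P i * lookup R j else 0 else 0)"
    unfolding lookup_times_expand by (intro sum.cong refl) (simp add: *)
  also have "\<dots> = (\<Sum>i\<in>keys P. if i = restr K n then lookup P i * lookup R (restr (- K) n) else 0)"
    by (intro sum.cong refl) (auto simp: sum.delta in_keys_iff)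
  also have "\<dots> = lookup P (restr K n) * lookup R (restr (- K) n)"
    by (auto simp: sum.delta in_keys_iff)
  finally show ?thesis .
qed

lemma hasse_times_disjoint:
  assumes "in_vars K P" "in_vars (- K) R" "keys s \<subseteq> K"
  shows "hasse s (P * R) = hasse s P * R"
proof (rule poly_mapping_eqI)
  fix i
  have "mbinom (restr K i + s) s = mbinom (i + s) s"
    by (rule mbinom_cong_keys) (use assms(3) in \<open>auto simp: lookup_add lookup_restr\<close>)
  moreover have "restr K s = s" "restr (- K) s = 0" using assms(3) by (auto intro!: restr_id restr_0)
  ultimately show "lookup (hasse s (P * R)) i = lookup (hasse s P * R) i"
    by (simp add: lookup_hasse lookup_times_disjoint[OF assms(1,2)] restr_add
       lookup_times_disjoint[OF in_vars_hasse[OF assms(1)] assms(2)])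
qed

text \<open>The operator X d/dX for the variable \<open>k\<close>. Unlike the plain derivative it is
  diagonal on monomials, so it leaves leading exponents in place and they can be compared.\<close>

lift_definition euler :: "nat \<Rightarrow> mpol \<Rightarrow> mpol" is "\<lambda>k f i. real (lookup i k) * f i"
  by (rule rev_finite_subset) auto

lemma lookup_euler: "lookup (euler k P) i = real (lookup i k) * lookup P i"
  by transfer simp
lemma euler_add: "euler k (P + R) = euler k P + euler k R"
  by (rule poly_mapping_eqI) (simp add: lookup_euler lookup_add algebra_simps)
lemma euler_0 [simp]: "euler k 0 = 0"
  by (rule poly_mapping_eqI) (simp add: lookup_euler)
lemma euler_sum: "euler k (\<Sum>x\<in>X. f x) = (\<Sum>x\<in>X. euler k (f x))"
  by (induction X rule: infinite_finite_induct) (auto simp: euler_add)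
lemma euler_single: "euler k (single i c) = single i (real (lookup i k) * c)"
  by (rule poly_mapping_eqI) (simp add: lookup_euler lookup_single when_def)

lemma euler_mult: "euler k (P * R) = euler k P * R + P * euler k R"
proof (induction P rule: poly_mapping_additive_induct)
  case (single i c)
  show ?case
  proof (induction R rule: poly_mapping_additive_induct)
    case (single j d)
    show ?case by (simp add: mult_single euler_single lookup_add algebra_simps flip: single_add)
  qed (simp_all add: euler_add algebra_simps)
qed (simp_all add: euler_add algebra_simps)

lemma euler_scale: "euler k (single 0 c * P) = single 0 c * euler k P"
  by (rule poly_mapping_eqI) (simp add: lookup_euler)

text \<open>Differentiating a divided derivative once more misses the division by the new order,
  which explains the factor \<open>Suc (lookup s k)\<close>.\<close>

lemma euler_hasse:
  "euler k (hasse s P) = single 0 (real (Suc (lookup s k))) * (mvar k * hasse (s + expo_unit k) P)"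
proof (rule poly_mapping_eqI)
  fix i
  show "lookup (euler k (hasse s P)) i
    = lookup (single 0 (real (Suc (lookup s k))) * (mvar k * hasse (s + expo_unit k) P)) i"
  proof (cases i k rule: expo_unit_cases)
    case 1 then show ?thesis
      unfolding lookup_single_zero_times by (simp add: lookup_euler lookup_mvar_times_0)
  next
    case (2 j)
    let ?n = "j + (s + expo_unit k)"
    have K: "keys (s + expo_unit k) - {k} = keys s - {k}" by (auto simp: keys_add_nat)
    have "(\<Prod>l\<in>keys s - {k}. lookup ?n l choose lookup (s + expo_unit k) l) =
        (\<Prod>l\<in>keys s - {k}. lookup ?n l choose lookup s l)"
      by (rule prod.cong) (auto simp: lookup_add lookup_expo_unit)
    then have "Suc (lookup j k) * mbinom ?n s = Suc (lookup s k) * mbinom ?n (s + expo_unit k)"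
      using Suc_times_binomial_add[of "lookup s k" "lookup j k"]
      by (simp add: mbinom_split[of _ _ k] K lookup_add lookup_expo_unit add.commute[of "lookup j k"]
         mult.assoc[symmetric] del: mult_Suc)
    from arg_cong[OF this, of real]
    have "real (Suc (lookup j k)) * real (mbinom ?n s) = real (Suc (lookup s k)) * real (mbinom ?n (s + expo_unit k))"
      unfolding of_nat_mult .
    moreover have "i + s = ?n" using 2 by (simp add: ac_simps)
    moreover have "lookup i k = Suc (lookup j k)" using 2 by (simp add: lookup_add lookup_expo_unit)
    ultimately show ?thesis unfolding lookup_single_zero_times
      using 2 by (simp only: lookup_euler lookup_hasse lookup_mvar_times_add mult.assoc[symmetric])
  qed
qed

text \<open>Exponents are linearly ordered compatibly with addition, so the largest possible sum
  arises from the two largest exponents only.\<close>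

lemma lookup_times_top:
  fixes P R :: mpol
  assumes "\<And>i. i \<in> keys P \<Longrightarrow> i \<le> a" "\<And>j. j \<in> keys R \<Longrightarrow> j \<le> b"
  shows "lookup (P * R) (a + b) = lookup P a * lookup R b"
proof -
  have *: "i + j = a + b \<longleftrightarrow> i = a \<and> j = b" if "i \<in> keys P" "j \<in> keys R" for i j
  proof
    assume e: "i + j = a + b"
    have "i \<le> a" "j \<le> b" using assms that by auto
    then show "i = a \<and> j = b"
      using e add_less_le_mono[of i a j b] add_le_less_mono[of i a j b] by (auto simp: le_less)
  qed simp
  have "lookup (P * R) (a + b) = (\<Sum>i\<in>keys P. \<Sum>j\<in>keys R.
      if i = a then if j = b then lookup P i * lookup R j else 0 else 0)"
    unfolding lookup_times_expand by (intro sum.cong refl) (simp add: *)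
  also have "\<dots> = (\<Sum>i\<in>keys P. if i = a then lookup P i * lookup R b else 0)"
    by (intro sum.cong refl) (auto simp: sum.delta in_keys_iff)
  also have "\<dots> = lookup P a * lookup R b"
    by (auto simp: sum.delta in_keys_iff)
  finally show ?thesis .
qed

text \<open>The hypothesis says that F / N has vanishing Euler derivatives. Subtracting the multiple
  of \<open>N\<close> that cancels the coefficient of \<open>F\<close> at the top exponent
  \<open>n\<close> of \<open>N\<close> leaves a \<open>G\<close> with the same property. If
  \<open>G\<close> were not 0, comparing top coefficients would show that its top exponent is
  \<open>n\<close>, but there its coefficient was cancelled.\<close>

lemma proportional_if_euler:
  assumes N: "N \<noteq> 0" and eq: "\<And>k. N * euler k F = F * euler k N"
  obtains c where "F = single 0 c * N"
proof -
  define n where "n = Max (keys N)"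
  have n: "n \<in> keys N" "\<And>i. i \<in> keys N \<Longrightarrow> i \<le> n"
    using N Max_in[of "keys N"] by (auto simp: n_def)
  define c where "c = lookup F n / lookup N n"
  define G where "G = F + single 0 (- c) * N"
  have G_eq: "N * euler k G = G * euler k N" for k
    unfolding G_def euler_add euler_scale using eq[of k] by (simp add: algebra_simps)
  have "G = 0"
  proof (rule ccontr)
    assume "G \<noteq> 0"
    define g where "g = Max (keys G)"
    have g: "g \<in> keys G" "\<And>i. i \<in> keys G \<Longrightarrow> i \<le> g"
      using \<open>G \<noteq> 0\<close> Max_in[of "keys G"] by (auto simp: g_def)
    have "lookup G n = 0" using n(1) by (simp add: G_def lookup_add c_def in_keys_iff)
    then have "g \<noteq> n" using g(1) by (auto simp: in_keys_iff)
    have top: "lookup (P * euler k R) (a + b) = lookup P a * (lookup b k * lookup R b)"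
      if "\<And>i. i \<in> keys P \<Longrightarrow> i \<le> a" "\<And>j. j \<in> keys R \<Longrightarrow> j \<le> b" for P R a b k
      using lookup_times_top[of P a "euler k R" b] that by (auto simp: lookup_euler in_keys_iff)
    have "lookup g k = lookup n k" for k
    proof -
      have "lookup (N * euler k G) (n + g) = lookup (G * euler k N) (g + n)"
        by (simp add: G_eq add.commute)
      then have "lookup N n * (lookup g k * lookup G g) = lookup G g * (lookup n k * lookup N n)"
        using top[of N n G g k] top[of G g N n k] n g by simp
      then show ?thesis using n(1) g(1) by (simp add: in_keys_iff)
    qed
    then have "g = n" by (intro poly_mapping_eqI)
    with \<open>g \<noteq> n\<close> show False by simp
  qed
  then have "F = single 0 c * N" by (simp add: G_def single_uminus eq_neg_iff_add_eq_0)
  then show ?thesis using that by blast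
qed

section \<open>Existence of a nonzero generalized Wronskian\<close>

definition expo_total :: "expo \<Rightarrow> nat" where "expo_total i = (\<Sum>k\<in>keys i. lookup i k)"

lemma expo_total_superset: "finite S \<Longrightarrow> keys i \<subseteq> S \<Longrightarrow> expo_total i = (\<Sum>k\<in>S. lookup i k)"
  unfolding expo_total_def by (rule sum.mono_neutral_left) (auto simp: in_keys_iff)
lemma expo_total_add: "expo_total (i + j) = expo_total i + expo_total j"
  using expo_total_superset[of "keys i \<union> keys j"] by (simp add: keys_add_nat lookup_add sum.distrib)
lemma expo_total_0 [simp]: "expo_total 0 = 0" by (simp add: expo_total_def)
lemma expo_total_unit [simp]: "expo_total (expo_unit k) = 1" by (simp add: expo_total_def lookup_expo_unit)

definition lin_indep :: "nat set \<Rightarrow> (nat \<Rightarrow> mpol) \<Rightarrow> bool" where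
  "lin_indep J f \<longleftrightarrow> (\<forall>c. (\<Sum>j\<in>J. single 0 (c j) * f j) = 0 \<longrightarrow> (\<forall>j\<in>J. c j = 0))"

text \<open>If all candidate rows failed, the cofactors \<open>F\<close> of the last row would form a vector killed
  by all \<open>hasse s\<close> with \<open>expo_total s \<le> h\<close>; differentiating this relation shows that the ratios
  \<open>F j / F h\<close> are constants, which contradicts linear independence.\<close>
lemma generalized_wronskian:
  assumes "lin_indep {..<h} f"
  shows "\<exists>s. (\<forall>a<h. expo_total (s a) \<le> a) \<and> det (mat h h (\<lambda>(a, j). hasse (s a) (f j))) \<noteq> 0"
  using assms
proof (induction h)
  case 0
  then show ?case by (auto simp: det_def)
next
  case (Suc h)
  have "lin_indep {..<h} f"
    unfolding lin_indep_def
  proof (intro allI impI)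
    fix c assume c: "(\<Sum>j<h. single 0 (c j) * f j) = 0"
    let ?c = "\<lambda>j. if j < h then c j else 0"
    have "(\<Sum>j<Suc h. single 0 (?c j) * f j) = 0" using c by simp
    then have "\<forall>j\<in>{..<Suc h}. ?c j = 0"
      using spec[OF Suc.prems[unfolded lin_indep_def], of ?c] by blast
    then show "\<forall>j\<in>{..<h}. c j = 0" by (metis lessThan_iff less_SucI)
  qed
  then obtain s where s: "\<forall>a<h. expo_total (s a) \<le> a"
    and N0: "det (mat h h (\<lambda>(a, j). hasse (s a) (f j))) \<noteq> 0"
    using Suc.IH by blast
  define A where "A = mat h h (\<lambda>(a, j). hasse (s a) (f j))"
  define N where "N = det A"
  \<comment> \<open>Only the last row varies with \<open>\<sigma>\<close>. Its cofactors are
    therefore the same for all \<open>\<sigma>\<close>, and the one in column \<open>h\<close> is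
    the nonzero minor \<open>N\<close>.\<close>
  define M where "M \<sigma> = mat (Suc h) (Suc h) (\<lambda>(a, j). hasse (if a < h then s a else \<sigma>) (f j))" for \<sigma>
  define F where "F j = cofactor (M 0) h j" for j
  have M: "M \<sigma> \<in> carrier_mat (Suc h) (Suc h)" for \<sigma> by (simp add: M_def)
  have cof: "cofactor (M \<sigma>) h j = F j" if "j < Suc h" for \<sigma> j
  proof -
    have "mat_delete (M \<sigma>) h j = mat_delete (M 0) h j"
      by (rule eq_matI) (use that in \<open>auto simp: M_def mat_delete_def\<close>)
    then show ?thesis by (simp add: F_def cofactor_def)
  qed
  have "mat_delete (M 0) h h = A"
    by (rule eq_matI) (auto simp: M_def A_def mat_delete_def)
  then have Fh: "F h = N" by (simp add: F_def cofactor_def N_def)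
  show ?case
  proof (rule ccontr)
    assume contra: "\<not> ?thesis"
    have rel: "(\<Sum>j<Suc h. hasse \<sigma> (f j) * F j) = 0" if "expo_total \<sigma> \<le> h" for \<sigma>
    proof -
      have "M \<sigma> = mat (Suc h) (Suc h) (\<lambda>(a, j). hasse ((s(h := \<sigma>)) a) (f j))"
        by (rule eq_matI) (auto simp: M_def less_Suc_eq)
      moreover have "\<forall>a<Suc h. expo_total ((s(h := \<sigma>)) a) \<le> a"
        using s that by (auto simp: less_Suc_eq)
      ultimately have "det (M \<sigma>) = 0" using contra by metis
      then have "(\<Sum>j<Suc h. M \<sigma> $$ (h, j) * cofactor (M \<sigma>) h j) = 0"
        using laplace_expansion_row[OF M[of \<sigma>], of h] by simp
      moreover have "M \<sigma> $$ (h, j) = hasse \<sigma> (f j)" if "j < Suc h" for j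
        using that by (simp add: M_def)
      ultimately show ?thesis by (simp add: cof)
    qed
    have dFk: "(\<Sum>j<Suc h. hasse (s a) (f j) * euler k (F j)) = 0" if "a < h" for a k
    proof -
      \<comment> \<open>As \<open>a < h\<close>, one further derivative still has order at most
        \<open>h\<close>, so \<open>rel\<close> also disposes of the terms in which the derivative
        falls on \<open>f j\<close>.\<close>
      have t: "expo_total (s a + expo_unit k) \<le> h" using s that by (fastforce simp: expo_total_add)
      have "0 = euler k (\<Sum>j<Suc h. hasse (s a) (f j) * F j)"
        using rel[of "s a"] s that by (simp add: order_trans[of "expo_total (s a)" a h])
      also have "\<dots> = single 0 (real (Suc (lookup (s a) k))) * mvar k *
          (\<Sum>j<Suc h. hasse (s a + expo_unit k) (f j) * F j)
          + (\<Sum>j<Suc h. hasse (s a) (f j) * euler k (F j))"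
        unfolding euler_sum euler_mult sum.distrib euler_hasse sum_distrib_left
        by (simp only: mult.assoc)
      finally show ?thesis using rel[OF t] by simp
    qed
    have ratio: "N * euler k (F j) = F j * euler k N" if "j < Suc h" for j k
    proof -
      \<comment> \<open>The numerator of the Euler derivative of \<open>F j / N\<close>. Because
        \<open>F h = N\<close>, the last one vanishes, and the first \<open>h\<close> form a vector
        killed by the nonsingular matrix \<open>A\<close>.\<close>
      define G where "G j = N * euler k (F j) - F j * euler k N" for j
      have "(\<Sum>j<h. hasse (s a) (f j) * G j) = 0" if "a < h" for a
      proof -
        have t: "expo_total (s a) \<le> h" using s that by (fastforce)
        have "(\<Sum>j<h. hasse (s a) (f j) * G j) = (\<Sum>j<Suc h. hasse (s a) (f j) * G j)"
          by (simp add: G_def Fh)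
        also have "\<dots> = N * (\<Sum>j<Suc h. hasse (s a) (f j) * euler k (F j))
            - euler k N * (\<Sum>j<Suc h. hasse (s a) (f j) * F j)"
          unfolding G_def sum_distrib_left sum_subtractf[symmetric]
          by (intro sum.cong refl) (simp add: algebra_simps)
        finally show ?thesis using dFk[OF that] rel[OF t] by simp
      qed
      then have "A *\<^sub>v vec h G = 0\<^sub>v h"
        by (intro eq_vecI) (simp_all add: A_def scalar_prod_def atLeast0LessThan)
      moreover have "A \<in> carrier_mat h h" by (simp add: A_def)
      ultimately have "vec h G = 0\<^sub>v h"
        using N0 det_0_iff_vec_prod_zero[of A h] unfolding A_def[symmetric] by (metis vec_carrier)
      then have "G j = 0" if "j < h" for j using that by (metis index_vec index_zero_vec(1))
      moreover have "G h = 0" by (simp add: G_def Fh)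
      ultimately have "G j = 0" using that by (auto simp: less_Suc_eq)
      then show ?thesis by (simp add: G_def)
    qed
    have N: "N \<noteq> 0" using N0 by (simp add: N_def A_def)
    have "\<exists>c. F j = single 0 c * N" if "j < Suc h" for j
      using proportional_if_euler[OF N ratio[OF that]] by blast
    then obtain c where c: "\<And>j. j < Suc h \<Longrightarrow> F j = single 0 (c j) * N" by metis
    \<comment> \<open>The relation of order 0 now has constant coefficients. Independence makes
      \<open>c h\<close> vanish, although \<open>F h = N\<close> is not zero.\<close>
    have "N * (\<Sum>j<Suc h. single 0 (c j) * f j) = (\<Sum>j<Suc h. hasse 0 (f j) * F j)"
      unfolding sum_distrib_left by (intro sum.cong refl) (simp add: c mult_ac)
    also have "\<dots> = 0" by (rule rel) simp
    finally have "(\<Sum>j<Suc h. single 0 (c j) * f j) = 0" using N by simp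
    then have "c h = 0" using Suc.prems unfolding lin_indep_def by blast
    then show False using c[of h] Fh N by simp
  qed
qed

context real_embedding begin

lemma insertion_mvar: "insertion e d (mvar k) = d k"
  by (simp add: mvar_def e_1)

lemma insertion_translate: "insertion e d (translate b P) = insertion e (\<lambda>k. e (b k) + d k) P"
proof (induction P rule: poly_mapping_additive_induct)
  case zero
  show ?case by (simp only: translate_0 insertion_zero)
next
  case (single i c)
  have "translate b (single i c) = single 0 c * (\<Prod>k\<in>keys i. (single 0 (b k) + mvar k) ^ lookup i k)"
    by (simp add: translate_def mpower_def)
  then show ?case
    by (simp add: insertion_mult insertion_prod insertion_power insertion_add insertion_mvar mpower_def)
next
  case (add P R)
  then show ?case by (simp only: translate_add insertion_add)
qed

end

section \<open>Vanishing order of an integral polynomial at a rational number\<close>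

interpretation upoly: real_embedding "\<lambda>x::real. [:x:]"
  by standard (simp_all add: one_pCons)

lemma content_power_eq_1: "content p = 1 \<Longrightarrow> content (p ^ n) = 1" for p :: "int poly"
  by (induction n) (simp_all add: content_mult)

text \<open>Gauss's lemma. Pseudo-division yields \<open>c * f = d * g + r\<close> over the
  integers; \<open>r\<close> vanishes by its degree, and since \<open>d\<close> is primitive,
  \<open>c\<close> divides the content of \<open>g\<close> and can be cancelled.\<close>

lemma primitive_dvd_if_of_int_dvd:
  fixes d f :: "int poly"
  assumes "content d = 1" "map_poly real_of_int d dvd map_poly real_of_int f"
  shows "d dvd f"
proof -
  have "d \<noteq> 0" using assms(1) by auto
  obtain g r where gr: "pseudo_divmod f d = (g, r)" by fastforce
  define c where "c = coeff d (degree d) ^ (Suc (degree f) - degree d)"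
  have c0: "c \<noteq> 0" using \<open>d \<noteq> 0\<close> by (simp add: c_def)
  have eq: "Polynomial.smult c f = d * g + r" using pseudo_divmod(1)[OF \<open>d \<noteq> 0\<close> gr] by (simp add: c_def)
  let ?h = "map_poly real_of_int"
  have "?h (Polynomial.smult c f) = ?h d * ?h g + ?h r"
    unfolding eq by (simp add: of_int_poly_hom.hom_add of_int_poly_hom.hom_mult)
  moreover have "?h (Polynomial.smult c f) = Polynomial.smult (of_int c) (?h f)"
    by (rule poly_eqI) (simp add: coeff_map_poly)
  ultimately have "?h r = Polynomial.smult (of_int c) (?h f) - ?h d * ?h g" by simp
  then have "?h d dvd ?h r" using assms(2) by (simp add: dvd_smult)
  moreover have "degree (?h p) = degree p" for p :: "int poly" by (simp add: degree_map_poly)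
  ultimately have "r = 0" using pseudo_divmod(2)[OF \<open>d \<noteq> 0\<close> gr]
    by (metis dvd_imp_degree_le not_le of_int_poly_hom.hom_zero of_int_hom.hom_zero map_poly_eq_0_iff
        of_int_eq_0_iff)
  then have eq: "Polynomial.smult c f = d * g" using eq by simp
  have "c dvd content (Polynomial.smult c f)" by simp
  then have "c dvd content g" unfolding eq using assms(1) by (simp add: content_mult)
  then obtain g' where "g = [:c:] * g'" by (meson const_poly_dvd_iff_dvd_content dvdE)
  then have "Polynomial.smult c f = Polynomial.smult c (d * g')" using eq by simp
  then have "f = d * g'" using c0 by (metis smult_cancel)
  then show ?thesis by simp
qed

text \<open>The case of one variable: if \<open>U\<close> vanishes to order \<open>e\<close> at p/q,
  then (q X - p)^e divides it over the integers, so \<open>q ^ e\<close> divides its leading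
  coefficient, which is bounded by the norm.\<close>

lemma vanishing_order_rational:
  fixes p q :: int
  assumes int: "int_poly U" and nz: "U \<noteq> 0" and vars: "in_vars {m} U"
    and q: "q > 0" and cop: "coprime p q" and b: "b m = of_int p / of_int q"
    and ord: "\<And>s. s \<in> keys (translate b U) \<Longrightarrow> e \<le> lookup s m"
  shows "real_of_int q ^ e \<le> norm1 U"
proof -
  \<comment> \<open>\<open>g\<close> sends the variable \<open>m\<close> to X and all others to 0;
    \<open>d\<close> is \<open>g\<close> minus the point \<open>b\<close>, so that substituting
    \<open>d\<close> into the translate gives the same polynomial in X.\<close>
  define g :: "nat \<Rightarrow> real poly" where "g k = (if k = m then [:0, 1:] else 0)" for k
  define d :: "nat \<Rightarrow> real poly" where "d k = (if k = m then [:- b m, 1:] else [:- b k:])" for k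
  define F where "F = insertion (\<lambda>x. [:x:]) g U"
  have ki: "i = single m (lookup i m)" if "i \<in> keys U" for i
    using vars that by (intro poly_mapping_eqI)
      (auto simp: in_vars_def lookup_single when_def in_keys_iff dest!: bspec)
  have cF: "coeff F n = lookup U (single m n)" for n
  proof -
    have "mpower g i = monom 1 (lookup i m)" if "i \<in> keys U" for i
      using ki[OF that] mpower_superset[of "{m}" i g] vars that
      by (simp add: g_def in_vars_def monom_altdef)
    then have "F = (\<Sum>i\<in>keys U. monom (lookup U i) (lookup i m))"
      unfolding F_def insertion_def by (intro sum.cong refl) (simp add: smult_monom)
    then have "coeff F n = (\<Sum>i\<in>keys U. if lookup i m = n then lookup U i else 0)"
      by (simp add: coeff_sum)
    also have "\<dots> = (\<Sum>i\<in>keys U. if i = single m n then lookup U i else 0)"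
      using ki by (intro sum.cong refl) (metis lookup_single_eq)
    also have "\<dots> = lookup U (single m n)" by (simp add: sum.delta in_keys_iff)
    finally show ?thesis .
  qed
  have "F = insertion (\<lambda>x. [:x:]) d (translate b U)"
    unfolding F_def upoly.insertion_translate
    by (rule arg_cong[of _ _ "\<lambda>g. insertion (\<lambda>x. [:x:]) g U"]) (auto simp: g_def d_def fun_eq_iff)
  also have "[:- b m, 1:] ^ e dvd \<dots>"
    unfolding insertion_def
  proof (intro dvd_sum dvd_mult)
    fix s assume s: "s \<in> keys (translate b U)"
    have "mpower d s = (\<Prod>k\<in>insert m (keys s). d k ^ lookup s k)"
      by (rule mpower_superset) auto
    also have "\<dots> = d m ^ lookup s m * (\<Prod>k\<in>keys s - {m}. d k ^ lookup s k)"
      by (simp add: prod.insert_remove)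
    finally show "[:- b m, 1:] ^ e dvd mpower d s"
      using le_imp_power_dvd[OF ord[OF s], of "[:- b m, 1:]"] by (simp add: d_def dvd_mult2)
  qed
  finally have dF: "[:- b m, 1:] ^ e dvd F" .
  define f where "f = map_poly floor F"
  have fF: "map_poly real_of_int f = F"
    by (rule poly_eqI) (use int in \<open>simp add: f_def coeff_map_poly cF int_poly_def\<close>)
  define D :: "int poly" where "D = [:- p, q:] ^ e"
  have "map_poly real_of_int [:- p, q:] = Polynomial.smult (of_int q) [:- b m, 1:]"
    using q by (simp add: b)
  then have "map_poly real_of_int D = Polynomial.smult (of_int q ^ e) ([:- b m, 1:] ^ e)"
    by (simp only: D_def of_int_poly_hom.hom_power smult_power)
  then have "map_poly real_of_int D dvd map_poly real_of_int f"
    unfolding fF using dF q by (simp add: smult_dvd)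
  moreover have "content [:- p, q:] = 1"
  proof -
    have "content [:- p, q:] dvd p" "content [:- p, q:] dvd q"
      using content_dvd_coeff[of "[:- p, q:]" 0] content_dvd_coeff[of "[:- p, q:]" 1] by auto
    then have "is_unit (content [:- p, q:])" using cop by (meson coprime_common_divisor)
    then show ?thesis by (simp only: is_unit_content_iff)
  qed
  then have "content D = 1" unfolding D_def by (rule content_power_eq_1)
  ultimately have "D dvd f" by (intro primitive_dvd_if_of_int_dvd)
  then obtain h where h: "f = D * h" by blast
  obtain i where i: "i \<in> keys U" using nz by (metis keys_eq_empty ex_in_conv)
  have "coeff F (lookup i m) \<noteq> 0" using i ki[OF i] by (simp add: cF in_keys_iff flip: ki[OF i])
  then have "f \<noteq> 0" using fF by auto
  then have "lead_coeff h \<noteq> 0" using h by auto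
  have lf: "lead_coeff f = q ^ e * lead_coeff h"
    unfolding h D_def lead_coeff_mult lead_coeff_power using q by simp
  have "q ^ e * 1 \<le> q ^ e * \<bar>lead_coeff h\<bar>"
    by (rule mult_left_mono) (use \<open>lead_coeff h \<noteq> 0\<close> q in linarith, use q in simp)
  also have "\<dots> = \<bar>lead_coeff f\<bar>" unfolding lf abs_mult using q by simp
  finally have "real_of_int (q ^ e) \<le> real_of_int \<bar>lead_coeff f\<bar>" by (simp only: of_int_le_iff mult_1_right)
  then have "\<bar>real_of_int (lead_coeff f)\<bar> \<ge> real_of_int q ^ e"
    by (simp only: of_int_power of_int_abs)
  moreover have "real_of_int (lead_coeff f) = lookup U (single m (degree f))"
    using arg_cong[OF fF, of "\<lambda>F. coeff F (degree f)"] by (simp add: coeff_map_poly cF)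
  ultimately show ?thesis using abs_lookup_le_norm1[of U "single m (degree f)"] by simp
qed

section \<open>Shortest decompositions into products over separate variables\<close>

lemma lin_indep_reindex:
  assumes "bij_betw g {..<h} S" "lin_indep S f"
  shows "lin_indep {..<h} (\<lambda>j. f (g j))"
  unfolding lin_indep_def
proof (intro allI impI)
  fix c assume c: "(\<Sum>j<h. single 0 (c j) * f (g j)) = 0"
  define c' where "c' = (\<lambda>k. c (inv_into {..<h} g k))"
  have inv: "c' (g j) = c j" if "j < h" for j
    using assms(1) that by (simp add: c'_def bij_betw_inv_into_left)
  have "(\<Sum>k\<in>S. single 0 (c' k) * f k) = (\<Sum>j<h. single 0 (c' (g j)) * f (g j))"
    using sum.reindex_bij_betw[OF assms(1), of "\<lambda>k. single 0 (c' k) * f k"] by simp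
  also have "\<dots> = 0" using c by (simp add: inv)
  finally have "\<forall>k\<in>S. c' k = 0" using assms(2) unfolding lin_indep_def by blast
  then show "\<forall>j\<in>{..<h}. c j = 0"
    using inv bij_betwE[OF assms(1)] by (metis lessThan_iff)
qed

text \<open>A linear relation expresses one \<open>f l\<close> through the others. Distributing
  \<open>f l * g l\<close> over the remaining summands changes each \<open>g j\<close> only by a
  constant multiple of \<open>g l\<close>.\<close>

lemma rank_reduction:
  assumes "finite S" "\<not> lin_indep S f" "\<And>j. j \<in> S \<Longrightarrow> in_vars L (g j)"
  obtains l g' where "l \<in> S" "(\<Sum>j\<in>S. f j * g j) = (\<Sum>j\<in>S-{l}. f j * g' j)"
    "\<And>j. j \<in> S \<Longrightarrow> in_vars L (g' j)"
proof -
  obtain c l where c: "(\<Sum>j\<in>S. single 0 (c j) * f j) = 0" "l \<in> S" "c l \<noteq> 0"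
    using assms(2) unfolding lin_indep_def by blast
  define g' where "g' j = g j + single 0 (- c j / c l) * g l" for j
  have "single 0 (c l) * f l = - (\<Sum>j\<in>S-{l}. single 0 (c j) * f j)"
    using c(1,2) assms(1) by (simp add: sum.remove eq_neg_iff_add_eq_0)
  then have "single 0 (1 / c l) * (single 0 (c l) * f l)
      = (\<Sum>j\<in>S-{l}. single 0 (1 / c l) * (single 0 (- c j) * f j))"
    by (simp add: sum_negf sum_distrib_left single_uminus)
  then have fl: "f l = (\<Sum>j\<in>S-{l}. single 0 (- c j / c l) * f j)"
    using c(3) by (simp add: mult.assoc[symmetric] mult_single)
  have "(\<Sum>j\<in>S. f j * g j) = f l * g l + (\<Sum>j\<in>S-{l}. f j * g j)"
    using c(2) assms(1) by (simp add: sum.remove)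
  also have "f l * g l = (\<Sum>j\<in>S-{l}. f j * (single 0 (- c j / c l) * g l))"
    by (subst fl) (simp add: sum_distrib_right sum_distrib_left mult_ac)
  also have "\<dots> + (\<Sum>j\<in>S-{l}. f j * g j) = (\<Sum>j\<in>S-{l}. f j * g' j)"
    by (simp only: g'_def sum.distrib[symmetric] distrib_left add.commute)
  finally have "(\<Sum>j\<in>S. f j * g j) = (\<Sum>j\<in>S-{l}. f j * g' j)" .
  moreover have "in_vars L (g' j)" if "j \<in> S" for j
    unfolding g'_def using assms(3) that c(2) by (intro in_vars_add in_vars_scale)
  ultimately show ?thesis using that c(2) by blast
qed

text \<open>As long as one of the two families is dependent, the sum can be shortened. Both families
  have to become independent, since each must have a nonzero generalized Wronskian.\<close>

lemma rank_decomposition: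
  fixes S :: "nat set"
  assumes "finite S" "P = (\<Sum>j\<in>S. f j * g j)"
    "\<And>j. j \<in> S \<Longrightarrow> in_vars K (f j)" "\<And>j. j \<in> S \<Longrightarrow> in_vars L (g j)"
  shows "\<exists>h f g. h \<le> card S \<and> P = (\<Sum>j<h. f j * g j) \<and> (\<forall>j<h. in_vars K (f j)) \<and>
    (\<forall>j<h. in_vars L (g j)) \<and> lin_indep {..<h} f \<and> lin_indep {..<h} g"
  using assms
proof (induction "card S" arbitrary: S f g rule: less_induct)
  case less
  show ?case
  proof (cases "lin_indep S f \<and> lin_indep S g")
    case True
    define h where "h = card S"
    obtain t where t: "bij_betw t {..<h} S"
      using ex_bij_betw_nat_finite[OF less.prems(1)] by (auto simp: h_def atLeast0LessThan)
    have t_in: "t j \<in> S" if "j < h" for j using bij_betwE[OF t] that by blast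
    have "P = (\<Sum>j<h. f (t j) * g (t j))"
      using sum.reindex_bij_betw[OF t, of "\<lambda>k. f k * g k"] less.prems(2) by simp
    moreover have "\<forall>j<h. in_vars K (f (t j))" "\<forall>j<h. in_vars L (g (t j))"
      using t_in less.prems(3,4) by blast+
    moreover have "lin_indep {..<h} (\<lambda>j. f (t j))" "lin_indep {..<h} (\<lambda>j. g (t j))"
      using True lin_indep_reindex[OF t] by blast+
    moreover have "h \<le> card S" by (simp add: h_def)
    ultimately show ?thesis
      by (rule_tac exI[of _ h], rule_tac exI[of _ "\<lambda>j. f (t j)"], rule_tac exI[of _ "\<lambda>j. g (t j)"],
        intro conjI)
  next
    case False
    have "\<exists>l f' g'. l \<in> S \<and> P = (\<Sum>j\<in>S-{l}. f' j * g' j) \<and> (\<forall>j\<in>S. in_vars K (f' j)) \<and> (\<forall>j\<in>S. in_vars L (g' j))"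
    proof (cases "lin_indep S f")
      case False
      obtain l g' where l: "l \<in> S" "(\<Sum>j\<in>S. f j * g j) = (\<Sum>j\<in>S-{l}. f j * g' j)"
        "\<And>j. j \<in> S \<Longrightarrow> in_vars L (g' j)"
        by (rule rank_reduction[of S f L g, OF less.prems(1) False less.prems(4)]) blast+
      have "l \<in> S \<and> P = (\<Sum>j\<in>S-{l}. f j * g' j) \<and> (\<forall>j\<in>S. in_vars K (f j)) \<and> (\<forall>j\<in>S. in_vars L (g' j))"
        using l less.prems(2,3) by simp
      then show ?thesis by (rule_tac exI[of _ l], rule_tac exI[of _ f], rule_tac exI[of _ g'])
    next
      case True
      then have "\<not> lin_indep S g" using False by simp
      obtain l f' where
        "l \<in> S" "(\<Sum>j\<in>S. g j * f j) = (\<Sum>j\<in>S-{l}. g j * f' j)" "\<And>j. j \<in> S \<Longrightarrow> in_vars K (f' j)"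
        by (rule rank_reduction[of S g K f, OF less.prems(1) \<open>\<not> lin_indep S g\<close> less.prems(3)]) blast+
      then have "l \<in> S \<and> P = (\<Sum>j\<in>S-{l}. f' j * g j) \<and> (\<forall>j\<in>S. in_vars K (f' j)) \<and> (\<forall>j\<in>S. in_vars L (g j))"
        using less.prems(2,4) by (simp add: mult.commute)
      then show ?thesis by (rule_tac exI[of _ l], rule_tac exI[of _ f'], rule_tac exI[of _ g])
    qed
    then obtain l f' g' where l: "l \<in> S" "P = (\<Sum>j\<in>S-{l}. f' j * g' j)"
      "\<forall>j\<in>S. in_vars K (f' j)" "\<forall>j\<in>S. in_vars L (g' j)" by blast
    have "card (S - {l}) < card S" by (rule card_Diff1_less[OF less.prems(1) l(1)])
    have c: "card (S - {l}) \<le> card S" by (rule card_Diff1_le)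
    note \<open>card (S - {l}) < card S\<close>
    moreover have "finite (S - {l})" using less.prems(1) by simp
    ultimately have "\<exists>h f g. h \<le> card (S - {l}) \<and> P = (\<Sum>j<h. f j * g j) \<and> (\<forall>j<h. in_vars K (f j)) \<and>
      (\<forall>j<h. in_vars L (g j)) \<and> lin_indep {..<h} f \<and> lin_indep {..<h} g"
      by (rule less.hyps[OF _ _ l(2)]) (use l(3,4) in auto)
    then show ?thesis
    proof (elim exE conjE)
      fix h f g
      assume h: "h \<le> card (S - {l})" and r: "P = (\<Sum>j<h. f j * g j)" "\<forall>j<h. in_vars K (f j)"
        "\<forall>j<h. in_vars L (g j)" "lin_indep {..<h} f" "lin_indep {..<h} g"
      show ?thesis
        by (rule exI[of _ h], rule exI[of _ f], rule exI[of _ g]) (intro conjI le_trans[OF h c] r)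
    qed
  qed
qed

section \<open>Roth's lemma\<close>

text \<open>The weight that defines Roth's index: each partial degree is normalized by its bound
  \<open>r k\<close>, so every variable contributes at most 1 for exponents within the
  bounds.\<close>

definition wt :: "(nat \<Rightarrow> nat) \<Rightarrow> nat \<Rightarrow> expo \<Rightarrow> real" where
  "wt r m s = (\<Sum>k<m. real (lookup s k) / real (r k))"

definition deg_le :: "nat \<Rightarrow> (nat \<Rightarrow> nat) \<Rightarrow> mpol \<Rightarrow> bool" where
  "deg_le m r P \<longleftrightarrow> in_vars {..<m} P \<and> (\<forall>i\<in>keys P. \<forall>k<m. lookup i k \<le> r k)"

lemma additive_weight_wt: "additive_weight (wt r m)"
  by standard (simp add: wt_def lookup_add add_divide_distrib sum.distrib)

lemmas wt_add = additive_weight.w_add[OF additive_weight_wt]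

lemma wt_nonneg: "wt r m s \<ge> 0" by (simp add: wt_def sum_nonneg)

lemma deg_le_hasse: "deg_le m r P \<Longrightarrow> deg_le m r (hasse s P)"
  unfolding deg_le_def using in_vars_hasse keys_hasse[of _ s P] by (fastforce simp: lookup_add)

lemma mbinom_le: "mbinom i s \<le> 2 ^ expo_total i"
proof (cases "keys s \<subseteq> keys i")
  case True
  have "mbinom i s = (\<Prod>k\<in>keys i. lookup i k choose lookup s k)"
    by (rule mbinom_superset) (use True in auto)
  also have "\<dots> \<le> (\<Prod>k\<in>keys i. 2 ^ lookup i k)"
    by (intro prod_mono) (simp add: binomial_le_pow2)
  also have "\<dots> = 2 ^ expo_total i" by (simp add: expo_total_def power_sum)
  finally show ?thesis .
next
  case False
  then obtain k where "k \<in> keys s" "k \<notin> keys i" by blast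
  then have "mbinom i s = 0" by (intro mbinom_eq_0[of _ k]) (simp add: in_keys_iff)
  then show ?thesis by simp
qed

lemma expo_total_le_if_deg_le:
  assumes "deg_le m r P" "i \<in> keys P"
  shows "expo_total i \<le> (\<Sum>k<m. r k)"
proof -
  have "expo_total i = (\<Sum>k<m. lookup i k)"
    by (rule expo_total_superset) (use assms in \<open>auto simp: deg_le_def in_vars_def\<close>)
  also have "\<dots> \<le> (\<Sum>k<m. r k)" by (rule sum_mono) (use assms in \<open>auto simp: deg_le_def\<close>)
  finally show ?thesis .
qed

lemma norm1_hasse:
  assumes "deg_le m r P"
  shows "norm1 (hasse s P) \<le> 2 ^ (\<Sum>k<m. r k) * norm1 P"
proof -
  have "norm1 (hasse s P) \<le> (\<Sum>i\<in>keys (hasse s P). 2 ^ (\<Sum>k<m. r k) * \<bar>lookup P (i + s)\<bar>)"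
    unfolding norm1_def
  proof (rule sum_mono)
    fix i assume "i \<in> keys (hasse s P)"
    then have "i + s \<in> keys P" by (rule keys_hasse)
    then have "mbinom (i + s) s \<le> 2 ^ (\<Sum>k<m. r k)"
      using mbinom_le[of "i + s" s] expo_total_le_if_deg_le[OF assms] by (meson le_trans one_le_numeral power_increasing)
    then have "real (mbinom (i + s) s) \<le> 2 ^ (\<Sum>k<m. r k)"
      by (metis of_nat_le_iff of_nat_numeral of_nat_power)
    then show "\<bar>lookup (hasse s P) i\<bar> \<le> 2 ^ (\<Sum>k<m. r k) * \<bar>lookup P (i + s)\<bar>"
      unfolding lookup_hasse abs_mult by (intro mult_right_mono) auto
  qed
  also have "\<dots> = 2 ^ (\<Sum>k<m. r k) * (\<Sum>j\<in>(\<lambda>i. i + s) ` keys (hasse s P). \<bar>lookup P j\<bar>)"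
    by (subst sum.reindex) (auto simp: inj_on_def sum_distrib_left)
  also have "\<dots> \<le> 2 ^ (\<Sum>k<m. r k) * norm1 P"
    unfolding norm1_def by (intro mult_left_mono sum_mono2) (use keys_hasse in auto)
  finally show ?thesis .
qed

text \<open>The real factors of an integral product are only determined up to scalars. Scaled by one
  coefficient of \<open>U\<close>, the factor \<open>V\<close> becomes a slice of the coefficients
  of \<open>V * U\<close>, and so inherits integrality and the bounds for norm and degrees.\<close>

lemma coefficient_slice:
  assumes V: "in_vars K V" and U: "in_vars (- K) U" and j: "j \<in> keys U"
    and int: "int_poly (V * U)"
  defines "V' \<equiv> single 0 (lookup U j) * V"
  shows "int_poly V'" "norm1 V' \<le> norm1 (V * U)" "i \<in> keys V' \<Longrightarrow> i + j \<in> keys (V * U)"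
proof -
  have *: "lookup V' i = lookup (V * U) (i + j)" if "i \<in> keys V'" for i
  proof -
    have "i \<in> keys V" using that by (auto simp: V'_def in_keys_iff)
    then have "restr K i = i" "restr (- K) i = 0" using V by (auto simp: in_vars_def intro!: restr_id restr_0)
    moreover have "restr K j = 0" "restr (- K) j = j"
      using U j by (auto simp: in_vars_def intro!: restr_id restr_0)
    ultimately show ?thesis by (simp add: V'_def lookup_times_disjoint[OF V U] restr_add)
  qed
  show "int_poly V'"
    unfolding int_poly_def
  proof
    fix i show "lookup V' i \<in> \<int>"
    proof (cases "i \<in> keys V'")
      case True
      show ?thesis unfolding *[OF True] using int by (simp add: int_poly_def)
    qed (simp add: in_keys_iff)
  qed
  show **: "i + j \<in> keys (V * U)" if "i \<in> keys V'" for i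
    using *[OF that] that by (simp add: in_keys_iff)
  have "norm1 V' = (\<Sum>i\<in>keys V'. \<bar>lookup (V * U) (i + j)\<bar>)"
    unfolding norm1_def by (intro sum.cong refl) (simp add: *)
  also have "\<dots> = (\<Sum>i\<in>(\<lambda>i. i + j) ` keys V'. \<bar>lookup (V * U) i\<bar>)"
    by (subst sum.reindex) (auto simp: inj_on_def)
  also have "\<dots> \<le> norm1 (V * U)"
    unfolding norm1_def by (intro sum_mono2) (use ** in auto)
  finally show "norm1 V' \<le> norm1 (V * U)" .
qed

text \<open>At least \<open>h * \<eta> / 4\<close> of the summands, namely those with
  \<open>b\<close> up to \<open>\<eta> * r / 2\<close>, are at least
  \<open>\<eta> / 2\<close>.\<close>

lemma truncated_sum_lower_bound:
  fixes \<eta> :: real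
  assumes "0 < \<eta>" "\<eta> \<le> 1" "h \<le> r + 1" "1 \<le> r"
  shows "real h * \<eta>\<^sup>2 / 8 \<le> (\<Sum>b<h. max 0 (\<eta> - real b / real r))"
proof -
  define n where "n = min h (nat \<lfloor>\<eta> * r / 2\<rfloor> + 1)"
  have pos: "\<eta> * r / 2 \<ge> 0" using assms by simp
  have "real (nat \<lfloor>\<eta> * r / 2\<rfloor> + 1) \<ge> real h * \<eta> / 4"
  proof -
    have "real (nat \<lfloor>\<eta> * r / 2\<rfloor> + 1) \<ge> \<eta> * r / 2" using pos by linarith
    moreover have "real (nat \<lfloor>\<eta> * r / 2\<rfloor> + 1) \<ge> \<eta>" using assms(2) by linarith
    moreover have "\<eta> * real h \<le> \<eta> * (real r + 1)" using assms by (intro mult_left_mono) auto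
    ultimately show ?thesis by (simp add: algebra_simps)
  qed
  moreover have "real h \<ge> real h * \<eta> / 4"
    using assms mult_left_mono[of \<eta> 4 "real h"] by simp
  ultimately have n: "real n \<ge> real h * \<eta> / 4" by (simp add: n_def min_def)
  have "real h * \<eta>\<^sup>2 / 8 = (real h * \<eta> / 4) * (\<eta> / 2)" by (simp add: power2_eq_square)
  also have "\<dots> \<le> real n * (\<eta> / 2)" using n assms by (intro mult_right_mono) auto
  also have "\<dots> = (\<Sum>b<n. \<eta> / 2)" by simp
  also have "\<dots> \<le> (\<Sum>b<n. max 0 (\<eta> - real b / real r))"
  proof (rule sum_mono)
    fix b assume "b \<in> {..<n}"
    then have "b \<le> nat \<lfloor>\<eta> * r / 2\<rfloor>" by (auto simp: n_def)
    then have "real b \<le> \<eta> * r / 2" using pos by linarith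
    then have "real b / real r \<le> \<eta> / 2" using assms(4) by (simp add: divide_simps)
    then show "\<eta> / 2 \<le> max 0 (\<eta> - real b / real r)"
      by (intro max.coboundedI2) linarith
  qed
  also have "\<dots> \<le> (\<Sum>b<h. max 0 (\<eta> - real b / real r))"
    by (intro sum_mono2) (auto simp: n_def)
  finally show ?thesis .
qed

interpretation translate_hom: comm_ring_hom "translate b" for b
  by standard (simp_all add: translate_add translate_mult)

text \<open>By the composition law a derivative of \<open>hasse s P\<close> is a multiple of a
  derivative of \<open>P\<close> of order larger by \<open>s\<close>, so the index drops by at most
  the weight of \<open>s\<close>.\<close>

lemma wt_ge_translate_hasse:
  assumes "additive_weight w" "wt_ge w T (translate b P)"
  shows "wt_ge w (T - w s) (translate b (hasse s P))"
  unfolding wt_ge_def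
proof
  fix i assume "i \<in> keys (translate b (hasse s P))"
  then have "ev b (hasse i (hasse s P)) \<noteq> 0" unfolding in_keys_iff lookup_translate .
  moreover have "ev b (hasse i (hasse s P)) = real (mbinom (i + s) i) * ev b (hasse (i + s) P)"
    by (simp add: hasse_hasse eval.insertion_mult)
  ultimately have "ev b (hasse (i + s) P) \<noteq> 0" by auto
  then have "i + s \<in> keys (translate b P)" unfolding in_keys_iff lookup_translate .
  then have "T \<le> w (i + s)" using assms(2) by (simp add: wt_ge_def)
  then show "T - w s \<le> w i" by (simp add: additive_weight.w_add[OF assms(1)])
qed

lemma det_eq_0_row:
  assumes "M \<in> carrier_mat n n" "a < n" "\<And>b. b < n \<Longrightarrow> M $$ (a, b) = 0"
  shows "det M = 0"
  using laplace_expansion_row[OF assms(1,2)] assms(3) by simp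

text \<open>For a decomposition of \<open>P\<close> into products \<open>f j * g j\<close>, the
  matrix of mixed derivatives is the Wronskian matrix of the \<open>f j\<close> times the transposed
  one of the \<open>g j\<close>. The powers of the last variable give a decomposition with
  \<open>R + 1\<close> summands, which bounds the rank \<open>h\<close>.\<close>

lemma wronskian_factorization:
  assumes P: "P \<noteq> 0" "in_vars {..<Suc m} P" and deg: "\<And>i. i \<in> keys P \<Longrightarrow> lookup i m \<le> R"
  obtains h s t V U where "1 \<le> h" "h \<le> R + 1"
    "\<And>a. a < h \<Longrightarrow> expo_total (s a) \<le> a \<and> keys (s a) \<subseteq> {..<m}"
    "\<And>a. a < h \<Longrightarrow> expo_total (t a) \<le> a \<and> keys (t a) \<subseteq> {m}"
    "V \<noteq> 0" "U \<noteq> 0" "in_vars {..<m} V" "in_vars {m} U"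
    "det (mat h h (\<lambda>(a, b). hasse (s a) (hasse (t b) P))) = V * U"
proof -
  define f0 where "f0 j = (\<Sum>i\<in>{i\<in>keys P. lookup i m = j}. single (restr {..<m} i) (lookup P i))" for j
  define g0 :: "nat \<Rightarrow> mpol" where "g0 j = single (single m j) 1" for j
  have "(\<Sum>j\<in>{..R}. f0 j * g0 j)
      = (\<Sum>j\<in>{..R}. \<Sum>i\<in>{i\<in>keys P. lookup i m = j}. single i (lookup P i))"
    unfolding f0_def g0_def sum_distrib_right
  proof (intro sum.cong refl)
    fix j i assume "i \<in> {i \<in> keys P. lookup i m = j}"
    then have "keys i \<subseteq> {..<Suc m}" "j = lookup i m" using P(2) by (auto simp: in_vars_def)
    then have "restr {..<m} i + single m j = i"
      by (intro poly_mapping_eqI)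
        (auto simp: lookup_add lookup_restr lookup_single when_def in_keys_iff less_Suc_eq)
    then show "single (restr {..<m} i) (lookup P i) * single (single m j) 1 = single i (lookup P i)"
      by (simp add: mult_single)
  qed
  also have "\<dots> = (\<Sum>i\<in>keys P. single i (lookup P i))"
    by (rule sum.group) (use deg in auto)
  also have "\<dots> = P" using poly_mapping_sum_single[of "keys P" P] by simp
  finally have P0: "P = (\<Sum>j\<in>{..R}. f0 j * g0 j)" by simp
  have "in_vars {..<m} (f0 j)" for j
    unfolding f0_def by (intro in_vars_sum in_vars_single) (auto simp: keys_restr)
  moreover have "in_vars {m} (g0 j)" for j unfolding g0_def by (intro in_vars_single) simp
  ultimately obtain h f g where h: "h \<le> card {..R}" and P1: "P = (\<Sum>j<h. f j * g j)"
    and f: "\<And>j. j < h \<Longrightarrow> in_vars {..<m} (f j)" and g: "\<And>j. j < h \<Longrightarrow> in_vars {m} (g j)"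
    and ind: "lin_indep {..<h} f" "lin_indep {..<h} g"
    using rank_decomposition[OF _ P0, of "{..<m}" "{m}"] by auto
  obtain s where s: "\<forall>a<h. expo_total (s a) \<le> a" and V: "det (mat h h (\<lambda>(a, j). hasse (s a) (f j))) \<noteq> 0"
    using generalized_wronskian[OF ind(1)] by blast
  obtain t where t: "\<forall>a<h. expo_total (t a) \<le> a" and U: "det (mat h h (\<lambda>(a, j). hasse (t a) (g j))) \<noteq> 0"
    using generalized_wronskian[OF ind(2)] by blast
  \<comment> \<open>A derivative in a foreign variable would produce a zero row.\<close>
  have ks: "keys (s a) \<subseteq> {..<m}" if "a < h" for a
  proof (rule ccontr)
    assume "\<not> keys (s a) \<subseteq> {..<m}"
    then have "hasse (s a) (f j) = 0" if "j < h" for j using hasse_eq_0_vars[OF f] that by blast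
    then have "det (mat h h (\<lambda>(a, j). hasse (s a) (f j))) = 0"
      by (intro det_eq_0_row[of _ h a]) (use \<open>a < h\<close> in auto)
    with V show False by contradiction
  qed
  have kt: "keys (t a) \<subseteq> {m}" if "a < h" for a
  proof (rule ccontr)
    assume "\<not> keys (t a) \<subseteq> {m}"
    then have "hasse (t a) (g j) = 0" if "j < h" for j using hasse_eq_0_vars[OF g] that by blast
    then have "det (mat h h (\<lambda>(a, j). hasse (t a) (g j))) = 0"
      by (intro det_eq_0_row[of _ h a]) (use \<open>a < h\<close> in auto)
    with U show False by contradiction
  qed
  define A where "A = mat h h (\<lambda>(a, j). hasse (s a) (f j))"
  define B where "B = mat h h (\<lambda>(a, j). hasse (t a) (g j))"
  have AB: "A \<in> carrier_mat h h" "B \<in> carrier_mat h h" by (simp_all add: A_def B_def)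
  have "mat h h (\<lambda>(a, b). hasse (s a) (hasse (t b) P)) = A * transpose_mat B"
  proof (rule eq_matI)
    fix a b assume "a < dim_row (A * transpose_mat B)" "b < dim_col (A * transpose_mat B)"
    then have ab: "a < h" "b < h" by (simp_all add: A_def B_def)
    have "hasse (s a) (hasse (t b) (f j * g j)) = hasse (s a) (f j) * hasse (t b) (g j)" if "j < h" for j
    proof -
      have "hasse (t b) (g j * f j) = hasse (t b) (g j) * f j"
        by (rule hasse_times_disjoint[OF g[OF that] _ kt[OF ab(2)]])
          (rule in_vars_mono[OF f[OF that]], auto)
      then have "hasse (t b) (f j * g j) = f j * hasse (t b) (g j)" by (simp only: mult.commute)
      moreover have "hasse (s a) (f j * hasse (t b) (g j)) = hasse (s a) (f j) * hasse (t b) (g j)"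
        by (rule hasse_times_disjoint[OF f[OF that] _ ks[OF ab(1)]])
          (rule in_vars_mono[OF in_vars_hasse[OF g[OF that]]], auto)
      ultimately show ?thesis by simp
    qed
    then have "hasse (s a) (hasse (t b) P) = (\<Sum>j<h. hasse (s a) (f j) * hasse (t b) (g j))"
      by (subst P1) (simp add: hasse_sum)
    then show "mat h h (\<lambda>(a, b). hasse (s a) (hasse (t b) P)) $$ (a, b) = (A * transpose_mat B) $$ (a, b)"
      using ab by (simp add: A_def B_def scalar_prod_def atLeast0LessThan)
  qed (simp_all add: A_def B_def)
  then have "det (mat h h (\<lambda>(a, b). hasse (s a) (hasse (t b) P))) = det A * det B"
    using AB by (simp add: det_mult[of A h] det_transpose[of B h])
  moreover have "in_vars {..<m} (det A)"
    by (rule in_vars_det[OF AB(1)]) (auto simp: A_def intro: in_vars_hasse f)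
  moreover have "in_vars {m} (det B)"
    by (rule in_vars_det[OF AB(2)]) (auto simp: B_def intro: in_vars_hasse g)
  moreover have "h \<noteq> 0" using P(1) P1 by (cases h) auto
  ultimately show ?thesis
    using that[of h s t "det A" "det B"] h s t ks kt V U by (simp add: A_def B_def)
qed

text \<open>\<open>L\<close> is a lower bound for all \<open>r k * ln (q k)\<close>, and the log
  norm is compared with it. For \<omega> > 0 the conditions \<open>r k \<le> \<omega> * L\<close>
  and \<open>L \<le> r k * ln (q k)\<close> force \<open>ln (q k) \<ge> 1 / \<omega>\<close>, so the
  denominators are large. All data are quantified inside, so a suitable \<omega> depends on
  \<open>m\<close> and \<epsilon> alone.\<close>

definition index_bound :: "nat \<Rightarrow> real \<Rightarrow> real \<Rightarrow> bool" where
  "index_bound m \<epsilon> \<omega> \<longleftrightarrow> (\<forall>r (p::nat \<Rightarrow> int) q b L P.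
     (\<forall>k<m. 1 \<le> r k \<and> real (r k) \<le> \<omega> * L \<and> 0 < q k \<and> coprime (p k) (q k) \<and>
        b k = of_int (p k) / of_int (q k) \<and> L \<le> real (r k) * ln (of_int (q k))) \<longrightarrow>
     (\<forall>k<m. \<forall>j<k. real (r k) \<le> \<omega> * real (r j)) \<longrightarrow>
     deg_le m r P \<longrightarrow> int_poly P \<longrightarrow> P \<noteq> 0 \<longrightarrow> ln (norm1 P) \<le> \<omega> * L \<longrightarrow>
     (\<exists>s. wt r m s \<le> \<epsilon> \<and> ev b (hasse s P) \<noteq> 0))"

section \<open>Induction on the number of variables\<close>

lemma index_bound_0:
  assumes "0 < \<epsilon>"
  shows "index_bound 0 \<epsilon> \<omega>"
  unfolding index_bound_def
proof (intro allI impI)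
  fix r :: "nat \<Rightarrow> nat" and b and P :: mpol
  assume "deg_le 0 r P" "P \<noteq> 0"
  then have keys: "keys P \<subseteq> {0}" by (auto simp: deg_le_def in_vars_def)
  then have "P = single 0 (lookup P 0)"
    using poly_mapping_sum_single[of "{0}" P] by simp
  then have "ev b P = lookup P 0"
    using eval.insertion_single[of b 0 "lookup P 0"] by simp
  moreover have "lookup P 0 \<noteq> 0" using keys \<open>P \<noteq> 0\<close> by (auto simp: in_keys_iff simp flip: keys_eq_empty)
  ultimately show "\<exists>s. wt r 0 s \<le> \<epsilon> \<and> ev b (hasse s P) \<noteq> 0"
    using assms by (intro exI[of _ 0]) (simp add: wt_def)
qed

text \<open>Crude, but sufficient: \<open>h - 1 \<le> r m \<le> \<omega> * L\<close> will make the
  right side linear in \<open>L\<close>.\<close>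

lemma ln_fact_le: "ln (fact h :: real) \<le> real h * (real h - 1)"
proof (cases "h = 0")
  case False
  have "(fact h :: real) \<le> real h ^ h" using fact_le_power[of h, where ?'a = real] by simp
  then have "ln (fact h :: real) \<le> ln (real h ^ h)" using False by (subst ln_le_cancel_iff) auto
  also have "\<dots> = real h * ln (real h)" using False by (simp add: ln_realpow)
  also have "\<dots> \<le> real h * (real h - 1)"
    using False by (intro mult_left_mono ln_le_minus_one) auto
  finally show ?thesis .
qed simp

text \<open>Suppose the index of \<open>P\<close> is at least \<epsilon>. Summing over the columns,
  the Wronskian determinant then has index at least h \<epsilon>^2 / 32. But it is a product
  \<open>V * U\<close>; the induction hypothesis for \<open>V\<close> and the case of one variable
  for \<open>U\<close> bound its index by 2 h \<epsilon>', which is h \<epsilon>^2 / 50. The divisor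
  100 in \<epsilon>' serves to separate these two values.\<close>

lemma index_bound_Suc:
  assumes IH: "index_bound m \<epsilon>' \<omega>'" and \<epsilon>: "0 < \<epsilon>" "\<epsilon> \<le> 1" and \<epsilon>': "\<epsilon>' = \<epsilon>\<^sup>2 / 100"
    and C: "C = 3 * real m + 5" and \<omega>: "0 < \<omega>" "\<omega> \<le> \<epsilon> / 2" "C * \<omega> \<le> \<omega>'" "C * \<omega> \<le> \<epsilon>'"
  shows "index_bound (Suc m) \<epsilon> \<omega>"
  unfolding index_bound_def
proof (intro allI impI)
  fix r :: "nat \<Rightarrow> nat" and p q :: "nat \<Rightarrow> int" and b :: "nat \<Rightarrow> real" and L :: real and P :: mpol
  assume pq: "\<forall>k<Suc m. 1 \<le> r k \<and> real (r k) \<le> \<omega> * L \<and> 0 < q k \<and> coprime (p k) (q k) \<and>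
        b k = of_int (p k) / of_int (q k) \<and> L \<le> real (r k) * ln (of_int (q k))"
    and decr: "\<forall>k<Suc m. \<forall>j<k. real (r k) \<le> \<omega> * real (r j)"
    and deg: "deg_le (Suc m) r P" and int: "int_poly P" and nz: "P \<noteq> 0"
    and height: "ln (norm1 P) \<le> \<omega> * L"
  have rpos: "0 < r k" if "k < Suc m" for k using pq that by (simp add: Suc_le_eq)
  have "1 \<le> \<omega> * L" using pq by (smt (verit) lessI of_nat_1 of_nat_le_iff)
  then have L: "0 < L" using \<omega>(1) by (smt (verit) mult_nonneg_nonpos)
  have \<epsilon>'pos: "0 < \<epsilon>'" using \<epsilon> by (simp add: \<epsilon>')
  have C1: "C \<ge> 1" by (simp add: C)
  have \<omega>\<omega>': "\<omega> \<le> \<omega>'"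
  proof -
    have "1 * \<omega> \<le> C * \<omega>" using C1 \<omega>(1) by (intro mult_right_mono) auto
    then show ?thesis using \<omega>(3) by linarith
  qed
  have degP: "in_vars {..<Suc m} P" "\<And>i. i \<in> keys P \<Longrightarrow> lookup i m \<le> r m"
    using deg by (auto simp: deg_le_def)
  obtain h s t V U where h: "1 \<le> h" "h \<le> r m + 1"
    and s: "\<And>a. a < h \<Longrightarrow> expo_total (s a) \<le> a \<and> keys (s a) \<subseteq> {..<m}"
    and t: "\<And>a. a < h \<Longrightarrow> expo_total (t a) \<le> a \<and> keys (t a) \<subseteq> {m}"
    and VU: "V \<noteq> 0" "U \<noteq> 0" "in_vars {..<m} V" "in_vars {m} U"
    and det: "det (mat h h (\<lambda>(a, b). hasse (s a) (hasse (t b) P))) = V * U"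
    by (rule wronskian_factorization[OF nz degP]) (assumption | (rule that; assumption))+
  define M where "M = mat h h (\<lambda>(a, b). hasse (s a) (hasse (t b) P))"
  define W where "W = V * U"
  have M: "M \<in> carrier_mat h h" and detM: "det M = W" by (simp_all add: M_def det W_def)
  have degM: "deg_le (Suc m) r (M $$ (a, b))" if "a < h" "b < h" for a b
    using that deg by (simp add: M_def deg_le_hasse)
  have intW: "int_poly W"
    unfolding detM[symmetric] by (rule int_poly_det[OF M]) (simp add: M_def int_poly_hasse int)
  have degW: "lookup i k \<le> h * r k" if "i \<in> keys W" "k < Suc m" for i k
  proof -
    have "wt_ge (\<lambda>i. - real (lookup i k)) (- real (r k)) (M $$ (a, b))" if "a < h" "b < h" for a b
      using degM[OF that] \<open>k < Suc m\<close> by (auto simp: deg_le_def wt_ge_def)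
    then have "wt_ge (\<lambda>i. - real (lookup i k)) (\<Sum>b<h. - real (r k)) W"
      unfolding detM[symmetric] by (intro additive_weight.wt_ge_det[OF additive_weight_coord M])
    then have "real (lookup i k) \<le> real (h * r k)" using that(1) by (auto simp: wt_ge_def)
    then show ?thesis by (simp only: of_nat_le_iff)
  qed
  have VU': "in_vars (- {..<m}) U" "in_vars (- {m}) V"
    using VU(3,4) by (auto elim!: in_vars_mono)
  have "V * U \<noteq> 0" using VU by simp
  then have W0: "W \<noteq> 0" by (simp add: W_def)
  have normP: "1 \<le> norm1 P" by (rule norm1_ge_1[OF int nz])
  have normW1: "1 \<le> norm1 W" by (rule norm1_ge_1[OF intW W0])
  define R where "R = (\<Sum>k<Suc m. r k)"
  have R: "real R \<le> (real m + 1) * (\<omega> * L)"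
  proof -
    have "real R \<le> (\<Sum>k<Suc m. \<omega> * L)" unfolding R_def of_nat_sum
      by (rule sum_mono) (use pq in auto)
    then show ?thesis by (simp add: add.commute)
  qed
  \<comment> \<open>The constant \<open>C\<close>: per row, the factorial and the norm of
    \<open>P\<close> cost \<open>\<omega> * L\<close> each, and the two divided derivatives cost
    \<open>R * ln 4\<close>, at most \<open>3 * (m + 1) * \<omega> * L\<close>.\<close>
  have normW: "ln (norm1 W) \<le> real h * (C * \<omega> * L)"
  proof -
    have "norm1 (M $$ (a, b)) \<le> 4 ^ R * norm1 P" if "a < h" "b < h" for a b
    proof -
      have "norm1 (M $$ (a, b)) \<le> 2 ^ R * norm1 (hasse (t b) P)"
        using norm1_hasse[OF deg_le_hasse[OF deg]] that by (simp add: M_def R_def)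
      also have "\<dots> \<le> 2 ^ R * (2 ^ R * norm1 P)"
        using norm1_hasse[OF deg] by (intro mult_left_mono) (auto simp: R_def)
      also have "\<dots> = 4 ^ R * norm1 P" by (simp flip: power_mult_distrib)
      finally show ?thesis .
    qed
    then have "norm1 W \<le> fact h * (4 ^ R * norm1 P) ^ h"
      unfolding detM[symmetric] by (rule norm1_det[OF M])
    then have "ln (norm1 W) \<le> ln (fact h * (4 ^ R * norm1 P) ^ h)"
      using normW1 by (subst ln_le_cancel_iff) auto
    also have "\<dots> = ln (fact h) + real h * (real R * ln 4 + ln (norm1 P))"
      using normP by (simp add: ln_mult ln_realpow)
    also have "\<dots> \<le> real h * (\<omega> * L) + real h * ((real m + 1) * (\<omega> * L) * 3 + \<omega> * L)"
    proof (intro add_mono mult_left_mono)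
      have "real h - 1 \<le> \<omega> * L" using pq h by (smt (verit) lessI of_nat_1 of_nat_add of_nat_le_iff)
      then have "real h * (real h - 1) \<le> real h * (\<omega> * L)" by (intro mult_left_mono) auto
      then show "ln (fact h) \<le> real h * (\<omega> * L)" using ln_fact_le[of h] by linarith
      have "ln (4::real) \<le> 3" using ln_le_minus_one[of "4::real"] by simp
      then show "real R * ln 4 \<le> (real m + 1) * (\<omega> * L) * 3"
        using R L \<omega> by (intro mult_mono) auto
    qed (use height in auto)
    also have "\<dots> = real h * (C * \<omega> * L)" by (simp add: C algebra_simps)
    finally show ?thesis .
  qed
  obtain iu where iu: "iu \<in> keys U" using VU(2) by (metis keys_eq_empty ex_in_conv)
  obtain iv where iv: "iv \<in> keys V" using VU(1) by (metis keys_eq_empty ex_in_conv)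
  define V' where "V' = single 0 (lookup U iu) * V"
  define U' where "U' = single 0 (lookup V iv) * U"
  have UV: "U * V = W" by (simp add: W_def mult.commute)
  note V'_slice = coefficient_slice[OF VU(3) VU'(1) iu intW[unfolded W_def], folded V'_def W_def]
  note U'_slice = coefficient_slice[OF VU(4) VU'(2) iv, folded U'_def, unfolded UV, OF intW]
  have single0: "single 0 c \<noteq> (0::mpol)" if "c \<noteq> 0" for c
    using that by (metis lookup_single_eq lookup_zero)
  have V'0: "V' \<noteq> 0" using single0[of "lookup U iu"] iu VU(1) by (simp add: V'_def in_keys_iff)
  have U'0: "U' \<noteq> 0" using single0[of "lookup V iv"] iv VU(2) by (simp add: U'_def in_keys_iff)
  \<comment> \<open>A determinant of size \<open>h\<close> multiplies degrees and log norm by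
    \<open>h\<close>, so the hypothesis is applied to \<open>h * r k\<close> and
    \<open>h * L\<close>. Going back to \<open>r\<close> multiplies the weight by
    \<open>h\<close>.\<close>
  have "\<exists>\<sigma>. wt (\<lambda>k. h * r k) m \<sigma> \<le> \<epsilon>' \<and> ev b (hasse \<sigma> V') \<noteq> 0"
  proof (rule IH[unfolded index_bound_def, rule_format, where L = "h * L" and p = p and q = q])
    have hL: "real h * L > 0" using h L by simp
    show "deg_le m (\<lambda>k. h * r k) V'"
      unfolding deg_le_def
    proof (intro conjI ballI allI impI)
      show "in_vars {..<m} V'" unfolding V'_def by (rule in_vars_scale[OF VU(3)])
      fix i k assume "i \<in> keys V'" "k < m"
      then have "lookup (i + iu) k \<le> h * r k" by (intro degW V'_slice(3)) auto
      then show "lookup i k \<le> h * r k" by (simp add: lookup_add)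
    qed
    have "ln (norm1 V') \<le> ln (norm1 W)"
      using V'_slice(2) norm1_ge_1[OF V'_slice(1) V'0] by (subst ln_le_cancel_iff) auto
    also have "\<dots> \<le> (C * \<omega>) * (real h * L)" using normW by (simp add: mult_ac)
    also have "\<dots> \<le> \<omega>' * (real h * L)" using \<omega>(3) hL by (intro mult_right_mono) auto
    finally show "ln (norm1 V') \<le> \<omega>' * (real h * L)" .
    fix k assume k: "k < m"
    have A: "real (r k) \<le> \<omega> * L" "0 < q k" "coprime (p k) (q k)" "b k = of_int (p k) / of_int (q k)"
      "L \<le> real (r k) * ln (of_int (q k))" "1 \<le> r k"
      using pq k by auto
    have "real h * real (r k) \<le> real h * (\<omega> * L)" using A(1) by (intro mult_left_mono) auto
    also have "\<dots> \<le> \<omega>' * (real h * L)" using \<omega>\<omega>' hL mult_right_mono[of \<omega> \<omega>' "real h * L"] by (simp add: mult_ac)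
    finally have B: "real (h * r k) \<le> \<omega>' * (real h * L)" by simp
    have D: "real h * L \<le> real (h * r k) * ln (of_int (q k))"
      using mult_left_mono[OF A(5), of "real h"] by (simp add: mult_ac)
    have E: "1 \<le> h * r k" using h(1) A(6) by (simp add: Suc_le_eq)
    show "1 \<le> h * r k \<and> real (h * r k) \<le> \<omega>' * (real h * L) \<and> 0 < q k \<and> coprime (p k) (q k) \<and>
        b k = of_int (p k) / of_int (q k) \<and> real h * L \<le> real (h * r k) * ln (of_int (q k))"
      by (intro conjI A B D E)
    fix j assume j: "j < k"
    have "real (r k) \<le> \<omega> * real (r j)" using decr[rule_format, OF less_SucI[OF k] j] .
    also have "\<dots> \<le> \<omega>' * real (r j)" using \<omega>\<omega>' by (intro mult_right_mono) auto
    finally have "real (r k) \<le> \<omega>' * real (r j)" .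
    then show "real (h * r k) \<le> \<omega>' * real (h * r j)"
      using mult_left_mono[of "real (r k)" "\<omega>' * real (r j)" "real h"] by (simp add: mult_ac)
  qed (rule V'_slice(1) V'0)+
  then obtain \<sigma> where \<sigma>: "wt (\<lambda>k. h * r k) m \<sigma> \<le> \<epsilon>'" "ev b (hasse \<sigma> V') \<noteq> 0" by blast
  have "wt r m \<sigma> = real h * wt (\<lambda>k. h * r k) m \<sigma>"
    using h(1) by (simp add: wt_def sum_distrib_left)
  then have wt\<sigma>: "wt r m \<sigma> \<le> real h * \<epsilon>'" using \<sigma>(1) by (simp add: mult_left_mono)
  have trV: "lookup (translate b V) \<sigma> \<noteq> 0"
  proof
    assume "lookup (translate b V) \<sigma> = 0"
    then have "ev b (hasse \<sigma> V) = 0" unfolding lookup_translate .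
    then have "ev b (hasse \<sigma> V') = 0" unfolding V'_def hasse_scale eval.insertion_mult by simp
    with \<sigma>(2) show False by contradiction
  qed
  \<comment> \<open>The least integer above \<open>h * \<epsilon>' * r m\<close>. Vanishing of
    \<open>U'\<close> to this order would make the norm of \<open>W\<close> at least
    \<open>q m ^ e\<close>, contradicting \<open>C * \<omega> \<le> \<epsilon>'\<close>.\<close>
  define e where "e = nat \<lfloor>real h * \<epsilon>' * r m\<rfloor> + 1"
  have epos: "real h * \<epsilon>' * r m \<ge> 0" using \<epsilon>'pos by simp
  have "\<exists>\<tau>\<in>keys (translate b U'). \<not> e \<le> lookup \<tau> m"
  proof (rule ccontr)
    assume contra: "\<not> ?thesis"
    have pqm: "0 < q m" "coprime (p m) (q m)" "b m = of_int (p m) / of_int (q m)"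
      "L \<le> real (r m) * ln (of_int (q m))" using pq by auto
    have "real_of_int (q m) ^ e \<le> norm1 U'"
    proof (rule vanishing_order_rational[where b = b and m = m and p = "p m"])
      show "in_vars {m} U'" unfolding U'_def by (rule in_vars_scale[OF VU(4)])
      show "e \<le> lookup \<tau> m" if "\<tau> \<in> keys (translate b U')" for \<tau> using contra that by blast
    qed (rule U'_slice(1) U'0 pqm(1,2,3))+
    also have "\<dots> \<le> norm1 W" by (rule U'_slice(2))
    finally have "ln (real_of_int (q m) ^ e) \<le> ln (norm1 W)"
      using pqm(1) normW1 by (subst ln_le_cancel_iff) auto
    then have "real e * ln (of_int (q m)) \<le> real h * (C * \<omega> * L)"
      using normW pqm(1) by (simp add: ln_realpow)
    also have "\<dots> \<le> real h * (\<epsilon>' * L)" using \<omega>(4) L by (intro mult_left_mono mult_right_mono) auto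
    also have "\<dots> \<le> real h * (\<epsilon>' * (real (r m) * ln (of_int (q m))))"
      using \<epsilon>'pos pqm(4) by (intro mult_left_mono) auto
    finally have "real e * ln (of_int (q m)) \<le> (real h * \<epsilon>' * r m) * ln (of_int (q m))"
      by (simp add: mult_ac)
    moreover have "ln (of_int (q m)) > (0::real)"
      using pqm(4) L rpos[of m] by (smt (verit) lessI mult_nonneg_nonpos of_nat_0_le_iff)
    ultimately have "real e \<le> real h * \<epsilon>' * r m" by simp
    then show False using epos by (simp add: e_def) linarith
  qed
  then obtain \<tau> where \<tau>: "\<tau> \<in> keys (translate b U')" "lookup \<tau> m < e" by auto
  have trU: "lookup (translate b U) \<tau> \<noteq> 0"
  proof
    assume "lookup (translate b U) \<tau> = 0"
    then have "ev b (hasse \<tau> U) = 0" unfolding lookup_translate .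
    then have "ev b (hasse \<tau> U') = 0" unfolding U'_def hasse_scale eval.insertion_mult by simp
    moreover have "ev b (hasse \<tau> U') \<noteq> 0" using \<tau>(1) unfolding in_keys_iff lookup_translate .
    ultimately show False by contradiction
  qed
  have k\<sigma>: "keys \<sigma> \<subseteq> {..<m}" using in_vars_translate[OF VU(3), of b] trV by (auto simp: in_vars_def in_keys_iff)
  have k\<tau>: "keys \<tau> \<subseteq> {m}" using in_vars_translate[OF VU(4), of b] trU by (auto simp: in_vars_def in_keys_iff)
  have "lookup (translate b W) (\<sigma> + \<tau>) = lookup (translate b V) \<sigma> * lookup (translate b U) \<tau>"
  proof -
    have "restr {..<m} \<sigma> = \<sigma>" "restr {..<m} \<tau> = 0" "restr (- {..<m}) \<sigma> = 0" "restr (- {..<m}) \<tau> = \<tau>"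
      using k\<sigma> k\<tau> by (auto intro!: restr_id restr_0)
    then show ?thesis
      unfolding W_def translate_mult
      by (simp add: lookup_times_disjoint[OF in_vars_translate[OF VU(3)] in_vars_translate[OF VU'(1)]] restr_add)
  qed
  then have key: "\<sigma> + \<tau> \<in> keys (translate b W)" using trV trU by (simp add: in_keys_iff)
  have "wt r (Suc m) \<tau> = real (lookup \<tau> m) / real (r m)"
  proof -
    have "lookup \<tau> k = 0" if "k < m" for k using k\<tau> that by (auto simp: in_keys_iff)
    then show ?thesis by (simp add: wt_def)
  qed
  also have "\<dots> \<le> real h * \<epsilon>'"
  proof -
    have "real (lookup \<tau> m) \<le> real h * \<epsilon>' * r m" using \<tau>(2) epos unfolding e_def by linarith
    then show ?thesis using rpos[of m] by (simp add: divide_simps)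
  qed
  finally have "wt r (Suc m) \<tau> \<le> real h * \<epsilon>'" .
  moreover have "wt r (Suc m) \<sigma> = wt r m \<sigma>"
  proof -
    have "lookup \<sigma> m = 0" using k\<sigma> by (auto simp: in_keys_iff)
    then show ?thesis by (simp add: wt_def)
  qed
  ultimately have upper: "wt r (Suc m) (\<sigma> + \<tau>) \<le> 2 * (real h * \<epsilon>')"
    using wt\<sigma> by (simp add: wt_add)
  show "\<exists>s. wt r (Suc m) s \<le> \<epsilon> \<and> ev b (hasse s P) \<noteq> 0"
  proof (rule ccontr)
    assume contra: "\<not> ?thesis"
    define w where "w = wt r (Suc m)"
    have aw: "additive_weight w" unfolding w_def by (rule additive_weight_wt)
    have P\<epsilon>: "wt_ge w \<epsilon> (translate b P)"
      unfolding wt_ge_def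
    proof
      fix i assume "i \<in> keys (translate b P)"
      then have "ev b (hasse i P) \<noteq> 0" unfolding in_keys_iff lookup_translate .
      then show "\<epsilon> \<le> w i" using contra unfolding w_def by (meson linear)
    qed
    \<comment> \<open>The order of \<open>s a\<close> is at most \<open>h - 1 \<le> r m\<close>, and
      it is spent in variables of much larger degree, \<open>r m \<le> \<omega> * r k\<close>. So
      these derivatives cost almost nothing.\<close>
    have ws: "w (s a) \<le> \<omega>" if "a < h" for a
    proof -
      have "w (s a) \<le> (\<Sum>k<m. real (lookup (s a) k) * (\<omega> / real (r m)))"
      proof -
        have "lookup (s a) m = 0" using s[OF that] by (auto simp: in_keys_iff)
        then have "w (s a) = (\<Sum>k<m. real (lookup (s a) k) * (1 / real (r k)))" by (simp add: w_def wt_def)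
        also have "\<dots> \<le> (\<Sum>k<m. real (lookup (s a) k) * (\<omega> / real (r m)))"
        proof (intro sum_mono mult_left_mono)
          fix k assume "k \<in> {..<m}"
          then have "real (r m) \<le> \<omega> * real (r k)" "0 < r k" "0 < r m" using decr rpos by auto
          then show "1 / real (r k) \<le> \<omega> / real (r m)" by (simp add: divide_simps mult_ac)
        qed simp
        finally show ?thesis .
      qed
      also have "\<dots> = real (expo_total (s a)) * (\<omega> / real (r m))"
      proof -
        have "expo_total (s a) = (\<Sum>k<m. lookup (s a) k)"
          by (rule expo_total_superset) (use s[OF that] in auto)
        then show ?thesis by (simp only: of_nat_sum sum_distrib_right)
      qed
      also have "\<dots> \<le> real (r m) * (\<omega> / real (r m))"
        using s[OF that] that h(2) \<omega>(1) by (intro mult_right_mono) auto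
      also have "\<dots> = \<omega>" using rpos[of m] by simp
      finally show ?thesis .
    qed
    have wt': "w (t b) \<le> real b / real (r m)" if "b < h" for b
    proof -
      have "lookup (t b) k = 0" if "k < m" for k using t[OF \<open>b < h\<close>] that by (auto simp: in_keys_iff)
      then have "w (t b) = real (lookup (t b) m) / real (r m)" by (simp add: w_def wt_def)
      also have "lookup (t b) m = expo_total (t b)" using expo_total_superset[of "{m}" "t b"] t[OF that] by simp
      finally show ?thesis using t[OF that] by (simp add: divide_right_mono)
    qed
    define \<eta> where "\<eta> = \<epsilon> - \<omega>"
    have \<eta>: "\<epsilon> / 2 \<le> \<eta>" "\<eta> \<le> 1" using \<omega> \<epsilon> by (auto simp: \<eta>_def)
    \<comment> \<open>Row and column derivatives cost at most \<omega> and \<open>c / r m\<close>.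
      As weights are nonnegative, the bound may be cut off at 0, so that columns with a negative
      bound do not reduce the sum.\<close>
    have "wt_ge w (max 0 (\<eta> - real c / real (r m))) (map_mat (translate b) M $$ (a, c))"
      if "a < h" "c < h" for a c
    proof -
      have "wt_ge w (\<epsilon> - w (t c) - w (s a)) (translate b (M $$ (a, c)))"
        using wt_ge_translate_hasse[OF aw wt_ge_translate_hasse[OF aw P\<epsilon>]] that by (simp add: M_def)
      moreover have "\<eta> - real c / real (r m) \<le> \<epsilon> - w (t c) - w (s a)"
        using ws[OF that(1)] wt'[OF that(2)] by (simp add: \<eta>_def)
      ultimately have "wt_ge w (max 0 (\<eta> - real c / real (r m))) (translate b (M $$ (a, c)))"
        unfolding wt_ge_def using wt_nonneg[of r "Suc m"] by (auto simp: w_def intro: order_trans)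
      then show ?thesis using that M by simp
    qed
    then have "wt_ge w (\<Sum>c<h. max 0 (\<eta> - real c / real (r m))) (det (map_mat (translate b) M))"
      by (intro additive_weight.wt_ge_det[OF aw]) (use M in auto)
    then have "wt_ge w (\<Sum>c<h. max 0 (\<eta> - real c / real (r m))) (translate b W)"
      by (simp add: detM)
    then have "(\<Sum>c<h. max 0 (\<eta> - real c / real (r m))) \<le> w (\<sigma> + \<tau>)"
      using key by (simp add: wt_ge_def)
    moreover have "real h * \<eta>\<^sup>2 / 8 \<le> (\<Sum>c<h. max 0 (\<eta> - real c / real (r m)))"
      by (rule truncated_sum_lower_bound) (use \<eta> \<epsilon> h rpos[of m] in auto)
    moreover have "(\<epsilon> / 2)\<^sup>2 \<le> \<eta>\<^sup>2" using \<eta> \<epsilon> by (intro power_mono) auto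
    then have "real h * (\<epsilon> / 2)\<^sup>2 \<le> real h * \<eta>\<^sup>2" by (intro mult_left_mono) auto
    ultimately have "real h * (\<epsilon> / 2)\<^sup>2 / 8 \<le> 2 * (real h * \<epsilon>')"
      using upper unfolding w_def by linarith
    then have "real h * \<epsilon>\<^sup>2 \<le> 0" by (simp add: \<epsilon>' power_divide)
    then show False using h(1) \<epsilon> by (simp add: mult_le_0_iff)
  qed
qed

theorem roth_lemma:
  assumes "0 < \<epsilon>" "\<epsilon> \<le> 1"
  shows "\<exists>\<omega>>0. index_bound m \<epsilon> \<omega>"
  using assms
proof (induction m arbitrary: \<epsilon>)
  case 0
  then show ?case using index_bound_0[of \<epsilon> 1] by (intro exI[of _ 1]) auto
next
  case (Suc m)
  define \<epsilon>' where "\<epsilon>' = \<epsilon>\<^sup>2 / 100"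
  have \<epsilon>': "0 < \<epsilon>'" "\<epsilon>' \<le> 1"
    using Suc.prems power_le_one[of \<epsilon> 2] by (auto simp: \<epsilon>'_def)
  obtain \<omega>' where \<omega>': "0 < \<omega>'" "index_bound m \<epsilon>' \<omega>'" using Suc.IH[OF \<epsilon>'] by blast
  define C where "C = 3 * real m + 5"
  define \<omega> where "\<omega> = min (\<epsilon> / 2) (min (\<omega>' / C) (\<epsilon>' / C))"
  have "0 < C" by (simp add: C_def)
  then have "0 < \<omega>" "\<omega> \<le> \<epsilon> / 2" "C * \<omega> \<le> \<omega>'" "C * \<omega> \<le> \<epsilon>'"
    using \<epsilon>' \<omega>' Suc.prems by (auto simp: \<omega>_def min_def field_simps)
  then show ?case using index_bound_Suc[OF \<omega>'(2) Suc.prems \<epsilon>'_def C_def] by blast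
qed

section \<open>Siegel's lemma and the auxiliary polynomial\<close>

text \<open>Pigeonhole principle: the box of the \<open>x\<close> has \<open>(B + 1) ^ N\<close>
  points, while their images have at most \<open>(B\<^sup>2 + 1) ^ card J\<close> values, which is
  smaller because \<open>2 * card J \<le> N\<close>. A difference of two points with equal image is
  a solution. The choice \<open>B = N * A\<close> makes \<open>N\<close> summands of size
  \<open>A * B\<close> add up to \<open>B\<^sup>2\<close>.\<close>

lemma siegel_lemma:
  fixes a :: "'j \<Rightarrow> 'i \<Rightarrow> int" and A :: nat
  assumes fin: "finite I" "finite J" and card: "2 * card J \<le> card I" and ne: "I \<noteq> {}"
    and A: "A \<ge> 1" "\<And>i j. i \<in> I \<Longrightarrow> j \<in> J \<Longrightarrow> \<bar>a j i\<bar> \<le> int A"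
  obtains x :: "'i \<Rightarrow> int" where "\<exists>i\<in>I. x i \<noteq> 0" "\<And>i. i \<in> I \<Longrightarrow> \<bar>x i\<bar> \<le> int (card I * A)"
    "\<And>j. j \<in> J \<Longrightarrow> (\<Sum>i\<in>I. a j i * x i) = 0"
proof -
  define N where "N = card I"
  define B where "B = N * A"
  have N: "N \<ge> 1" using fin ne by (simp add: N_def Suc_le_eq card_gt_0_iff)
  have B: "B \<ge> 1" using N A by (simp add: B_def)
  define X where "X = (I \<rightarrow>\<^sub>E {0..int B})"
  define Y where "Y = (J \<rightarrow>\<^sub>E {0..int (B * B)})"
  \<comment> \<open>The term with \<open>max\<close> does not depend on \<open>x\<close>. It shifts
    all values into the nonnegative range and cancels when two points are compared.\<close>
  define F where "F x = (\<lambda>j\<in>J. \<Sum>i\<in>I. a j i * x i + max 0 (- a j i) * int B)" for x :: "'i \<Rightarrow> int"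
  have "F ` X \<subseteq> Y"
  proof (intro image_subsetI)
    fix x assume x: "x \<in> X"
    have "(\<Sum>i\<in>I. a j i * x i + max 0 (- a j i) * int B) \<in> {0..int (B * B)}" if j: "j \<in> J" for j
    proof -
      have *: "0 \<le> a j i * x i + max 0 (- a j i) * int B \<and>
          a j i * x i + max 0 (- a j i) * int B \<le> int A * int B" if i: "i \<in> I" for i
      proof -
        have xi: "0 \<le> x i" "x i \<le> int B" using x i by (auto simp: X_def PiE_def Pi_def)
        have ai: "\<bar>a j i\<bar> \<le> int A" using A(2) i j by blast
        show ?thesis
        proof (cases "a j i \<ge> 0")
          case True
          then show ?thesis using xi ai by (auto intro!: mult_mono)
        next
          case False
          have "a j i * int B \<le> a j i * x i" using False xi by (intro mult_left_mono_neg) auto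
          moreover have "a j i * x i \<le> 0" using False xi by (intro mult_nonpos_nonneg) auto
          moreover have "- a j i * int B \<le> int A * int B" using False ai by (intro mult_right_mono) auto
          ultimately show ?thesis using False by (simp add: max_def)
        qed
      qed
      have le: "(\<Sum>i\<in>I. a j i * x i + max 0 (- a j i) * int B) \<le> (\<Sum>i\<in>I. int A * int B)"
        by (rule sum_mono) (use * in blast)
      have e: "(\<Sum>i\<in>I. int A * int B) = int (B * B)" by (simp add: B_def N_def)
      have nn: "0 \<le> (\<Sum>i\<in>I. a j i * x i + max 0 (- a j i) * int B)"
        by (rule sum_nonneg) (use * in blast)
      show ?thesis unfolding atLeastAtMost_iff using le e nn by linarith
    qed
    then show "F x \<in> Y" by (auto simp: F_def Y_def)
  qed
  moreover have "finite Y" unfolding Y_def by (rule finite_PiE) (use fin in auto)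
  ultimately have "card (F ` X) \<le> card Y" by (rule card_mono[rotated])
  also have "card Y = (B * B + 1) ^ card J" using fin by (simp add: Y_def card_PiE nat_add_distrib nat_mult_distrib)
  also have "\<dots> < (B + 1) ^ N"
  proof (cases "card J = 0")
    case True
    have "1 < (B + 1) ^ N" by (rule one_less_power) (use B N in auto)
    then show ?thesis by (simp add: True)
  next
    case False
    have "(B * B + 1) ^ card J < ((B + 1)\<^sup>2) ^ card J"
      by (rule power_strict_mono) (use B False in \<open>auto simp: power2_eq_square\<close>)
    also have "\<dots> \<le> (B + 1) ^ N"
      unfolding power_mult[symmetric] by (rule power_increasing) (use card in \<open>auto simp: N_def\<close>)
    finally show ?thesis .
  qed
  also have "(B + 1) ^ N = card X" using fin by (simp add: X_def card_PiE N_def nat_add_distrib)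
  finally have "\<not> inj_on F X" by (rule pigeonhole)
  then obtain x1 x2 where x: "x1 \<in> X" "x2 \<in> X" "F x1 = F x2" "x1 \<noteq> x2" by (auto simp: inj_on_def)
  show ?thesis
  proof (rule that[of "\<lambda>i. x1 i - x2 i"])
    show "\<exists>i\<in>I. x1 i - x2 i \<noteq> 0"
    proof (rule ccontr)
      assume "\<not> ?thesis"
      then have "x1 = x2" by (intro PiE_ext[OF x(1)[unfolded X_def] x(2)[unfolded X_def]]) auto
      with x(4) show False by contradiction
    qed
    show "\<bar>x1 i - x2 i\<bar> \<le> int (card I * A)" if "i \<in> I" for i
    proof -
      have "x1 i \<in> {0..int B}" "x2 i \<in> {0..int B}" using x(1,2) that by (auto simp: X_def PiE_def Pi_def)
      then show ?thesis unfolding N_def[symmetric] B_def[symmetric] by auto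
    qed
    show "(\<Sum>i\<in>I. a j i * (x1 i - x2 i)) = 0" if "j \<in> J" for j
      using fun_cong[OF x(3), of j] that by (simp add: F_def sum.distrib algebra_simps sum_subtractf)
  qed
qed

section \<open>Counting exponents of small weight\<close>

definition box :: "nat \<Rightarrow> (nat \<Rightarrow> nat) \<Rightarrow> expo set" where
  "box m r = {i. keys i \<subseteq> {..<m} \<and> (\<forall>k<m. lookup i k \<le> r k)}"

lemma box_0: "box 0 r = {0}"
  by (auto simp: box_def)

lemma bij_betw_box_Suc:
  "bij_betw (\<lambda>(i, s). i + single m s) (box m r \<times> {..r m}) (box (Suc m) r)"
proof (rule bij_betw_byWitness[where f' = "\<lambda>i. (restr {..<m} i, lookup i m)"])
  have *: "lookup i m = 0" if "i \<in> box m r" for i using that by (auto simp: box_def in_keys_iff)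
  have **: "restr {..<m} i = i" if "i \<in> box m r" for i using that by (intro restr_id) (simp add: box_def)
  have ***: "restr {..<m} (single m s) = 0" for s :: nat by (rule restr_0) auto
  show "\<forall>x\<in>box m r \<times> {..r m}. (restr {..<m} (case x of (i, s) \<Rightarrow> i + single m s),
      lookup (case x of (i, s) \<Rightarrow> i + single m s) m) = x"
    by (auto simp: * ** *** restr_add lookup_add)
  show "\<forall>i\<in>box (Suc m) r. (case (restr {..<m} i, lookup i m) of (i, s) \<Rightarrow> i + single m s) = i"
  proof
    fix i assume i: "i \<in> box (Suc m) r"
    have "restr {..<m} i + single m (lookup i m) = i"
      using i by (intro poly_mapping_eqI)
        (auto simp: box_def lookup_add lookup_restr lookup_single when_def in_keys_iff less_Suc_eq)
    then show "(case (restr {..<m} i, lookup i m) of (i, s) \<Rightarrow> i + single m s) = i" by simp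
  qed
  have "keys (i + single m s) \<subseteq> {..<Suc m}" if "keys i \<subseteq> {..<m}" for i :: expo and s
    using that by (auto simp: keys_add_nat split: if_splits)
  then show "(\<lambda>(i, s). i + single m s) ` (box m r \<times> {..r m}) \<subseteq> box (Suc m) r"
    using * by (auto simp: box_def lookup_add lookup_single when_def less_Suc_eq)
  show "(\<lambda>i. (restr {..<m} i, lookup i m)) ` box (Suc m) r \<subseteq> box m r \<times> {..r m}"
    by (auto simp: box_def keys_restr lookup_restr)
qed

lemma sum_box_Suc: "(\<Sum>i\<in>box (Suc m) r. f i) = (\<Sum>i\<in>box m r. \<Sum>s\<le>r m. f (i + single m s))"
  using sum.reindex_bij_betw[OF bij_betw_box_Suc, of f m r]
  by (simp add: sum.cartesian_product split_def)

lemma finite_box: "finite (box m r)"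
proof (induction m)
  case (Suc m)
  then show ?case using bij_betw_finite[OF bij_betw_box_Suc[of m r]] by simp
qed (simp add: box_0)

lemma card_box: "card (box m r) = (\<Prod>k<m. r k + 1)"
proof (induction m)
  case (Suc m)
  show ?case
    unfolding bij_betw_same_card[OF bij_betw_box_Suc, symmetric] card_cartesian_product Suc by simp
qed (simp add: box_0)

text \<open>Mean and variance of the weight of a uniformly chosen exponent. The normalized
  coordinates are independent with mean 1/2, and each deviates from it by at most 1/2, so its
  variance is at most 1/4.\<close>

lemma box_moments:
  assumes "\<And>k. k < m \<Longrightarrow> 1 \<le> r k"
  shows "(\<Sum>i\<in>box m r. wt r m i - real m / 2) = 0 \<and>
    (\<Sum>i\<in>box m r. (wt r m i - real m / 2)\<^sup>2) \<le> real m / 4 * real (card (box m r))"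
  using assms
proof (induction m)
  case 0
  then show ?case by (simp add: box_0 wt_def)
next
  case (Suc m)
  let ?D = "\<lambda>i. wt r m i - real m / 2" and ?u = "\<lambda>s::nat. real s / real (r m) - 1 / 2"
  let ?R = "real (r m) + 1"
  have IH: "(\<Sum>i\<in>box m r. ?D i) = 0" "(\<Sum>i\<in>box m r. (?D i)\<^sup>2) \<le> real m / 4 * real (card (box m r))"
    using Suc by auto
  have r: "real (r m) > 0" using Suc.prems[of m] by simp
  have D: "wt r (Suc m) (i + single m s) - real (Suc m) / 2 = ?D i + ?u s" if "i \<in> box m r" for i s
  proof -
    have "lookup i m = 0" using that by (auto simp: box_def in_keys_iff)
    moreover have "lookup (i + single m s) k = lookup i k" if "k < m" for k
      using that by (simp add: lookup_add lookup_single when_def)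
    ultimately show ?thesis by (simp add: wt_def lookup_add add_divide_distrib)
  qed
  have "(\<Sum>s\<le>r m. real s) = real (r m) * ?R / 2"
    using double_gauss_sum[of "r m", where ?'a = real] by (simp add: atMost_atLeast0)
  then have u1: "(\<Sum>s\<le>r m. ?u s) = 0"
    using r by (simp add: sum_subtractf flip: sum_divide_distrib)
  have u2: "(\<Sum>s\<le>r m. (?u s)\<^sup>2) \<le> ?R / 4"
  proof -
    have "(\<Sum>s\<le>r m. (?u s)\<^sup>2) \<le> (\<Sum>s\<le>r m. 1 / 4)"
    proof (rule sum_mono)
      fix s assume "s \<in> {..r m}"
      then have "0 \<le> real s / real (r m)" "real s / real (r m) \<le> 1" using r by auto
      then have "\<bar>?u s\<bar> \<le> 1 / 2" by linarith
      then have "\<bar>?u s\<bar>\<^sup>2 \<le> (1 / 2)\<^sup>2" by (intro power_mono) auto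
      then show "(?u s)\<^sup>2 \<le> 1 / 4" by (simp add: power2_eq_square)
    qed
    then show ?thesis by simp
  qed
  have "(\<Sum>i\<in>box (Suc m) r. wt r (Suc m) i - real (Suc m) / 2) = (\<Sum>i\<in>box m r. \<Sum>s\<le>r m. ?D i + ?u s)"
    unfolding sum_box_Suc by (intro sum.cong refl) (simp only: D)
  also have "\<dots> = (\<Sum>i\<in>box m r. ?R * ?D i)" unfolding sum.distrib u1 by (simp add: add.commute)
  also have "\<dots> = 0" by (simp only: sum_distrib_left[symmetric] IH(1) mult_zero_right)
  finally have 1: "(\<Sum>i\<in>box (Suc m) r. wt r (Suc m) i - real (Suc m) / 2) = 0" .
  have "(\<Sum>i\<in>box (Suc m) r. (wt r (Suc m) i - real (Suc m) / 2)\<^sup>2)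
      = (\<Sum>i\<in>box m r. \<Sum>s\<le>r m. (?D i + ?u s)\<^sup>2)"
    unfolding sum_box_Suc by (intro sum.cong refl) (simp only: D)
  also have "\<dots> = (\<Sum>i\<in>box m r. ?R * (?D i)\<^sup>2 + (\<Sum>s\<le>r m. (?u s)\<^sup>2))"
  proof (intro sum.cong refl)
    fix i
    have "(\<Sum>s\<le>r m. (?D i + ?u s)\<^sup>2) = (\<Sum>s\<le>r m. (?D i)\<^sup>2 + 2 * ?D i * ?u s + (?u s)\<^sup>2)"
      by (intro sum.cong refl) (simp only: power2_sum ac_simps)
    also have "\<dots> = ?R * (?D i)\<^sup>2 + 2 * ?D i * (\<Sum>s\<le>r m. ?u s) + (\<Sum>s\<le>r m. (?u s)\<^sup>2)"
      by (simp only: sum.distrib sum_distrib_left[symmetric] sum_constant card_atMost) simp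
    finally show "(\<Sum>s\<le>r m. (?D i + ?u s)\<^sup>2) = ?R * (?D i)\<^sup>2 + (\<Sum>s\<le>r m. (?u s)\<^sup>2)" unfolding u1 by simp
  qed
  also have "\<dots> = ?R * (\<Sum>i\<in>box m r. (?D i)\<^sup>2) + real (card (box m r)) * (\<Sum>s\<le>r m. (?u s)\<^sup>2)"
    by (simp only: sum.distrib sum_distrib_left[symmetric] sum_constant)
  also have "\<dots> \<le> ?R * (real m / 4 * real (card (box m r))) + real (card (box m r)) * (?R / 4)"
    using IH(2) u2 by (intro add_mono mult_left_mono) auto
  also have "\<dots> = real (Suc m) / 4 * real (card (box (Suc m) r))"
    by (simp add: card_box field_simps)
  finally show ?case using 1 by blast
qed

text \<open>Chebyshev's inequality. The share of these exponents tends to 0 as \<open>m\<close>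
  grows, which is what makes room for the degree of \<alpha>.\<close>

lemma card_low_weight:
  assumes "\<And>k. k < m \<Longrightarrow> 1 \<le> r k" "0 < \<epsilon>" "0 < m"
  shows "4 * \<epsilon>\<^sup>2 * real m * real (card {i\<in>box m r. wt r m i < real m / 2 - \<epsilon> * real m}) \<le> real (card (box m r))"
proof -
  let ?S = "{i\<in>box m r. wt r m i < real m / 2 - \<epsilon> * real m}"
  have "(\<Sum>i\<in>?S. (\<epsilon> * real m)\<^sup>2) \<le> (\<Sum>i\<in>?S. (wt r m i - real m / 2)\<^sup>2)"
  proof (rule sum_mono)
    fix i assume "i \<in> ?S"
    then have "\<epsilon> * real m \<le> real m / 2 - wt r m i" by simp
    then have "(\<epsilon> * real m)\<^sup>2 \<le> (real m / 2 - wt r m i)\<^sup>2" using assms by (intro power_mono) auto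
    then show "(\<epsilon> * real m)\<^sup>2 \<le> (wt r m i - real m / 2)\<^sup>2" by (simp add: power2_commute)
  qed
  also have "\<dots> \<le> (\<Sum>i\<in>box m r. (wt r m i - real m / 2)\<^sup>2)"
    by (intro sum_mono2) (auto simp: finite_box)
  also have "\<dots> \<le> real m / 4 * real (card (box m r))" using box_moments[of m r, OF assms(1)] by blast
  finally have "real (card ?S) * (\<epsilon> * real m)\<^sup>2 \<le> real m / 4 * real (card (box m r))" by simp
  then have "real m * (4 * \<epsilon>\<^sup>2 * real m * real (card ?S)) \<le> real m * real (card (box m r))"
    by (simp add: power2_eq_square algebra_simps)
  then show ?thesis using assms(3) by simp
qed

text \<open>The truncated subtraction is harmless: unless \<open>i\<close> dominates
  \<open>s\<close>, the factor \<open>mbinom i s\<close> is 0.\<close>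

lemma ev_hasse_single:
  "ev (\<lambda>_. \<alpha>) (hasse s (single i c)) = c * (real (mbinom i s) * \<alpha> ^ (expo_total i - expo_total s))"
proof (cases "\<exists>j. i = j + s")
  case True
  then obtain j where j: "i = j + s" by blast
  have "hasse s (single i c) = single j (real (mbinom i s) * c)"
    by (rule poly_mapping_eqI) (auto simp: lookup_hasse lookup_single when_def j)
  moreover have "mpower (\<lambda>_. \<alpha>) j = \<alpha> ^ expo_total j"
    by (simp add: mpower_def expo_total_def power_sum)
  ultimately show ?thesis by (simp add: j expo_total_add)
next
  case False
  have "\<exists>k. lookup i k < lookup s k"
  proof (rule ccontr)
    assume "\<not> ?thesis"
    then have "i = (i - s) + s"
      by (intro poly_mapping_eqI) (auto simp: lookup_add minus_poly_mapping.rep_eq not_less)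
    with False show False by blast
  qed
  then have "mbinom i s = 0" using mbinom_eq_0 by blast
  moreover have "hasse s (single i c) = 0"
    by (rule poly_mapping_eqI) (use False in \<open>auto simp: lookup_hasse lookup_single when_def\<close>)
  ultimately show ?thesis by simp
qed

text \<open>Coordinates of the powers of \<open>f d * \<alpha>\<close>. Multiplication by
  \<open>f d * \<alpha>\<close> shifts them, and the overflow at \<alpha>^d is removed by the
  equation of \<alpha>.\<close>

primrec power_coords :: "(nat \<Rightarrow> int) \<Rightarrow> nat \<Rightarrow> nat \<Rightarrow> nat \<Rightarrow> int" where
  "power_coords f d 0 l = (if l = 0 then 1 else 0)"
| "power_coords f d (Suc n) l = (if l = 0 then 0 else f d * power_coords f d n (l - 1))
      - f l * power_coords f d n (d - 1)"

text \<open>Multiplying \<open>\<alpha>\<close> by the leading coefficient keeps the coordinates with respect to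
  \<open>1, \<alpha>, \<dots>, \<alpha> ^ (d - 1)\<close> integral.\<close>
lemma power_coords_sum:
  assumes d: "0 < d" and root: "(\<Sum>l\<le>d. of_int (f l) * \<alpha> ^ l) = (0::real)"
  shows "of_int (f d) ^ n * \<alpha> ^ n = (\<Sum>l<d. of_int (power_coords f d n l) * \<alpha> ^ l)"
proof (induction n)
  case 0
  have "(\<Sum>l<d. of_int (power_coords f d 0 l) * \<alpha> ^ l) = (\<Sum>l<d. if l = 0 then 1 else 0)"
    by (intro sum.cong) auto
  then show ?case using d by simp
next
  case (Suc n)
  let ?b = "\<lambda>l. real_of_int (power_coords f d n l)" and ?f = "\<lambda>l. real_of_int (f l)"
  obtain d' where d': "d = Suc d'" using d by (cases d) auto
  have top: "?f d * \<alpha> ^ d = - (\<Sum>l<d. ?f l * \<alpha> ^ l)"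
    using root by (simp add: lessThan_Suc_atMost[symmetric])
  have "?f d ^ Suc n * \<alpha> ^ Suc n = ?f d * \<alpha> * (\<Sum>l<d. ?b l * \<alpha> ^ l)"
    unfolding Suc[symmetric] by (simp add: mult_ac)
  also have "\<dots> = (\<Sum>l<d'. ?f d * ?b l * \<alpha> ^ Suc l) + ?b d' * (?f d * \<alpha> ^ d)"
    by (simp add: d' sum_distrib_left ring_distribs mult_ac)
  also have "(\<Sum>l<d'. ?f d * ?b l * \<alpha> ^ Suc l)
      = (\<Sum>l<d. (if l = 0 then 0 else ?f d * ?b (l - 1)) * \<alpha> ^ l)"
    unfolding d' sum.lessThan_Suc_shift by simp
  also have "?b d' * (?f d * \<alpha> ^ d) = - (\<Sum>l<d. ?f l * ?b (d - 1) * \<alpha> ^ l)"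
    unfolding top mult_minus_right sum_distrib_left by (simp add: d' mult_ac)
  also have "(\<Sum>l<d. (if l = 0 then 0 else ?f d * ?b (l - 1)) * \<alpha> ^ l) + - (\<Sum>l<d. ?f l * ?b (d - 1) * \<alpha> ^ l)
      = (\<Sum>l<d. of_int (power_coords f d (Suc n) l) * \<alpha> ^ l)"
    unfolding sum_negf[symmetric] sum.distrib[symmetric]
    by (intro sum.cong refl) (auto simp: algebra_simps)
  finally show ?case .
qed

lemma power_coords_bound:
  assumes "\<And>l. l \<le> d \<Longrightarrow> \<bar>f l\<bar> \<le> F" "0 < d" "0 \<le> F" "l < d"
  shows "\<bar>power_coords f d n l\<bar> \<le> (2 * F) ^ n"
  using assms(4)
proof (induction n arbitrary: l)
  case (Suc n)
  have "\<bar>if l = 0 then 0 else f d * power_coords f d n (l - 1)\<bar> \<le> F * (2 * F) ^ n"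
    using Suc assms by (auto simp: abs_mult intro!: mult_mono)
  moreover have "\<bar>f l * power_coords f d n (d - 1)\<bar> \<le> F * (2 * F) ^ n"
    unfolding abs_mult using Suc assms by (intro mult_mono) auto
  ultimately show ?case by (simp add: abs_le_iff)
qed simp

text \<open>The unknowns are the coefficients, and each low weight \<open>s\<close> gives
  \<open>d\<close> equations, together at most half as many as unknowns. The base
  \<open>16 * F\<close> collects \<open>4 * F\<close> from the entries of the system and 2 from each
  of two factors \<open>card I\<close>, one from Siegel's bound and one from adding up the
  coefficients.\<close>

lemma auxiliary_polynomial:
  fixes f :: "nat \<Rightarrow> int" and \<alpha> :: real
  assumes d: "0 < d" "f d \<noteq> 0" and root: "(\<Sum>l\<le>d. of_int (f l) * \<alpha> ^ l) = 0"
    and F: "\<And>l. l \<le> d \<Longrightarrow> \<bar>f l\<bar> \<le> int F"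
    and \<epsilon>: "0 < \<epsilon>" and m: "0 < m" "real d \<le> 2 * \<epsilon>\<^sup>2 * real m" and r: "\<And>k. k < m \<Longrightarrow> 1 \<le> r k"
  shows "\<exists>P. int_poly P \<and> P \<noteq> 0 \<and> deg_le m r P \<and> norm1 P \<le> (16 * real F) ^ (\<Sum>k<m. r k) \<and>
    (\<forall>s. wt r m s < real m / 2 - \<epsilon> * real m \<longrightarrow> ev (\<lambda>_. \<alpha>) (hasse s P) = 0)"
proof -
  define R where "R = (\<Sum>k<m. r k)"
  define I where "I = box m r"
  define J0 where "J0 = {s\<in>box m r. wt r m s < real m / 2 - \<epsilon> * real m}"
  define J where "J = J0 \<times> {..<d}"
  define e where "e s i = expo_total i - expo_total s" for s i
  \<comment> \<open>The power \<open>f d ^ (R - e s i)\<close> brings all monomials to the common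
    multiplier \<open>f d ^ R\<close>, so that one equation in \<alpha> splits into \<open>d\<close>
    integral ones.\<close>
  define a :: "expo \<times> nat \<Rightarrow> expo \<Rightarrow> int" where
    "a j i = (case j of (s, l) \<Rightarrow> int (mbinom i s) * (f d ^ (R - e s i) * power_coords f d (e s i) l))" for j i
  define A where "A = (4 * F) ^ R"
  have F1: "F \<ge> 1" using F[of d] d by linarith
  have tot: "expo_total i \<le> R" if "i \<in> I" for i
  proof -
    have "expo_total i = (\<Sum>k<m. lookup i k)"
      by (rule expo_total_superset) (use that in \<open>auto simp: I_def box_def\<close>)
    also have "\<dots> \<le> R" unfolding R_def by (rule sum_mono) (use that in \<open>auto simp: I_def box_def\<close>)
    finally show ?thesis .
  qed
  have eR: "e s i \<le> R" if "i \<in> I" for s i using tot[OF that] by (simp add: e_def)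
  have finI: "finite I" "finite J" by (simp_all add: I_def J_def J0_def finite_box)
  have cardI: "card I \<le> 2 ^ R"
  proof -
    have "card I = (\<Prod>k<m. r k + 1)" by (simp add: I_def card_box)
    also have "\<dots> \<le> (\<Prod>k<m. 2 ^ r k)"
      by (intro prod_mono conjI) (simp_all add: Suc_le_eq less_exp)
    also have "\<dots> = 2 ^ R" by (simp add: R_def power_sum)
    finally show ?thesis .
  qed
  have card0: "0 \<in> I" by (simp add: I_def box_def)
  then have Ine: "I \<noteq> {}" by blast
  have "2 * card J \<le> card I"
  proof -
    have "2 * real d * real (card J0) \<le> 4 * \<epsilon>\<^sup>2 * real m * real (card J0)"
      by (rule mult_right_mono) (use m(2) in linarith, simp)
    also have "\<dots> \<le> real (card I)"
      unfolding J0_def I_def by (rule card_low_weight[OF r \<epsilon> m(1)])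
    finally have "real (2 * (card J0 * d)) \<le> real (card I)" by (simp add: mult_ac)
    then have "2 * (card J0 * d) \<le> card I" by (simp only: of_nat_le_iff)
    then show ?thesis by (simp add: J_def card_cartesian_product)
  qed
  moreover have "A \<ge> 1" using F1 by (simp add: A_def)
  moreover have "\<bar>a j i\<bar> \<le> int A" if ij: "i \<in> I" "j \<in> J" for i j
  proof -
    obtain s l where j: "j = (s, l)" "l < d" using ij(2) by (auto simp: J_def)
    have "int (mbinom i s) \<le> 2 ^ R"
    proof -
      have "mbinom i s \<le> 2 ^ R"
        using mbinom_le[of i s] tot[OF ij(1)] by (meson le_trans one_le_numeral power_increasing)
      then have "int (mbinom i s) \<le> int (2 ^ R)" by (simp only: of_nat_le_iff)
      then show ?thesis by simp
    qed
    moreover have "\<bar>f d ^ (R - e s i)\<bar> \<le> (2 * int F) ^ (R - e s i)"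
      unfolding power_abs using F[of d] by (intro power_mono) auto
    moreover have "\<bar>power_coords f d (e s i) l\<bar> \<le> (2 * int F) ^ e s i"
      by (rule power_coords_bound) (use F d j in auto)
    ultimately have "\<bar>a j i\<bar> \<le> 2 ^ R * ((2 * int F) ^ (R - e s i) * (2 * int F) ^ e s i)"
      unfolding a_def j abs_mult prod.case by (intro mult_mono) auto
    also have "\<dots> = 2 ^ R * (2 * int F) ^ R"
      unfolding power_add[symmetric] using eR[OF ij(1), of s] by simp
    also have "\<dots> = (2 * (2 * int F)) ^ R" by (rule power_mult_distrib[symmetric])
    also have "\<dots> = int A" by (simp add: A_def)
    finally show ?thesis .
  qed
  ultimately obtain x where x: "\<exists>i\<in>I. x i \<noteq> 0" "\<And>i. i \<in> I \<Longrightarrow> \<bar>x i\<bar> \<le> int (card I * A)"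
    "\<And>j. j \<in> J \<Longrightarrow> (\<Sum>i\<in>I. a j i * x i) = 0"
    by (rule siegel_lemma[OF finI _ Ine, where A = A and a = a]) (assumption | (rule that; assumption))+
  define P :: mpol where "P = (\<Sum>i\<in>I. single i (of_int (x i)))"
  have lookup_P: "lookup P i = (if i \<in> I then of_int (x i) else 0)" for i
  proof -
    have "lookup P i = (\<Sum>k\<in>I. if k = i then of_int (x i) else 0)"
      unfolding P_def lookup_sum by (intro sum.cong) (auto simp: lookup_single when_def)
    then show ?thesis using finI(1) by (simp add: sum.delta)
  qed
  have keys_P: "keys P \<subseteq> I" by (auto simp: in_keys_iff lookup_P split: if_splits)
  show ?thesis
  proof (intro exI[of _ P] conjI allI impI)
    show "int_poly P" by (simp add: int_poly_def lookup_P)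
    obtain i where "i \<in> I" "x i \<noteq> 0" using x(1) by blast
    then have "lookup P i \<noteq> 0" by (simp add: lookup_P)
    then show "P \<noteq> 0" by auto
    show "deg_le m r P" using keys_P by (auto simp: deg_le_def in_vars_def I_def box_def)
    have "norm1 P = (\<Sum>i\<in>I. \<bar>lookup P i\<bar>)" by (rule norm1_superset[OF finI(1) keys_P])
    also have "\<dots> \<le> (\<Sum>i\<in>I. real (card I * A))"
    proof (rule sum_mono)
      fix i assume i: "i \<in> I"
      have "real_of_int \<bar>x i\<bar> \<le> real_of_int (int (card I * A))" using x(2)[OF i] by (simp only: of_int_le_iff)
      then show "\<bar>lookup P i\<bar> \<le> real (card I * A)" using i by (simp add: lookup_P)
    qed
    also have "\<dots> = real (card I * card I * A)" by (simp add: mult_ac)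
    also have "\<dots> \<le> real (2 ^ R * 2 ^ R * A)"
      unfolding of_nat_le_iff using cardI by (intro mult_mono) auto
    also have "2 ^ R * 2 ^ R * A = (2 * 2 * (4 * F)) ^ R" by (simp only: A_def power_mult_distrib)
    finally show "norm1 P \<le> (16 * real F) ^ (\<Sum>k<m. r k)" by (simp add: R_def)
    fix s assume s: "wt r m s < real m / 2 - \<epsilon> * real m"
    have evP: "ev (\<lambda>_. \<alpha>) (hasse s P) = (\<Sum>i\<in>I. of_int (x i) * (real (mbinom i s) * \<alpha> ^ e s i))"
      unfolding P_def hasse_sum eval.insertion_sum ev_hasse_single e_def by (rule refl)
    show "ev (\<lambda>_. \<alpha>) (hasse s P) = 0"
    proof (cases "s \<in> box m r")
      case False
      \<comment> \<open>Outside the box the derivative vanishes identically, so no equation had to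
        be imposed for \<open>s\<close>.\<close>
      have "mbinom i s = 0" if "i \<in> I" for i
      proof -
        from False obtain k where "k \<in> keys s \<and> k \<notin> {..<m} \<or> k < m \<and> r k < lookup s k"
          by (auto simp: box_def not_le)
        then have "lookup i k < lookup s k"
        proof
          assume "k \<in> keys s \<and> k \<notin> {..<m}"
          moreover then have "k \<notin> keys i" using that by (auto simp: I_def box_def)
          ultimately show ?thesis by (simp add: in_keys_iff)
        next
          assume "k < m \<and> r k < lookup s k"
          moreover then have "lookup i k \<le> r k" using that by (simp add: I_def box_def)
          ultimately show ?thesis by linarith
        qed
        then show ?thesis by (rule mbinom_eq_0)
      qed
      then show ?thesis unfolding evP by (intro sum.neutral) simp
    next
      case True
      have "real_of_int (f d) ^ R * ev (\<lambda>_. \<alpha>) (hasse s P)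
          = (\<Sum>i\<in>I. \<Sum>l<d. of_int (a (s, l) i * x i) * \<alpha> ^ l)"
        unfolding evP sum_distrib_left
      proof (intro sum.cong refl)
        fix i assume i: "i \<in> I"
        have "real_of_int (f d) ^ R * \<alpha> ^ e s i
            = real_of_int (f d) ^ (R - e s i) * (real_of_int (f d) ^ e s i * \<alpha> ^ e s i)"
          using eR[OF i, of s] by (simp flip: power_add mult.assoc)
        also have "\<dots> = (\<Sum>l<d. real_of_int (f d) ^ (R - e s i) * (of_int (power_coords f d (e s i) l) * \<alpha> ^ l))"
          unfolding power_coords_sum[OF d(1) root] by (rule sum_distrib_left)
        finally have *: "real_of_int (f d) ^ R * \<alpha> ^ e s i
          = (\<Sum>l<d. real_of_int (f d) ^ (R - e s i) * (of_int (power_coords f d (e s i) l) * \<alpha> ^ l))" .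
        have "real_of_int (f d) ^ R * (of_int (x i) * (real (mbinom i s) * \<alpha> ^ e s i))
          = of_int (x i) * real (mbinom i s) * (real_of_int (f d) ^ R * \<alpha> ^ e s i)" by (simp only: mult_ac)
        also have "\<dots> = (\<Sum>l<d. of_int (a (s, l) i * x i) * \<alpha> ^ l)"
          unfolding * sum_distrib_left by (intro sum.cong refl) (simp add: a_def mult_ac)
        finally show "real_of_int (f d) ^ R * (of_int (x i) * (real (mbinom i s) * \<alpha> ^ e s i))
          = (\<Sum>l<d. of_int (a (s, l) i * x i) * \<alpha> ^ l)" .
      qed
      also have "\<dots> = (\<Sum>l<d. of_int (\<Sum>i\<in>I. a (s, l) i * x i) * \<alpha> ^ l)"
        by (subst sum.swap) (simp only: of_int_sum sum_distrib_right)
      also have "\<dots> = 0"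
      proof (rule sum.neutral, rule ballI)
        fix l assume "l \<in> {..<d}"
        then have "(s, l) \<in> J" using True s by (simp add: J_def J0_def)
        then show "of_int (\<Sum>i\<in>I. a (s, l) i * x i) * \<alpha> ^ l = 0" by (simp only: x(3) of_int_0 mult_zero_left)
      qed
      finally show ?thesis using d(2) by simp
    qed
  qed
qed

section \<open>Roth's theorem\<close>

lemma norm1_translate:
  assumes "deg_le m r P"
  shows "norm1 (translate (\<lambda>_. \<alpha>) P) \<le> (1 + \<bar>\<alpha>\<bar>) ^ (\<Sum>k<m. r k) * norm1 P"
proof -
  have "norm1 (translate (\<lambda>_. \<alpha>) P) \<le> (\<Sum>i\<in>keys P. \<bar>lookup P i\<bar> * (1 + \<bar>\<alpha>\<bar>) ^ (\<Sum>k<m. r k))"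
    unfolding translate_def insertion_def
  proof (rule order_trans[OF norm1_sum sum_mono])
    fix i assume i: "i \<in> keys P"
    let ?g = "\<lambda>k. single 0 \<alpha> + mvar k"
    have g: "norm1 (?g k) \<le> 1 + \<bar>\<alpha>\<bar>" for k
      using norm1_add[of "single 0 \<alpha>" "mvar k"] by (simp add: mvar_def)
    have "norm1 (mpower ?g i) \<le> (\<Prod>k\<in>keys i. norm1 (?g k ^ lookup i k))"
      unfolding mpower_def by (rule norm1_prod)
    also have "\<dots> \<le> (\<Prod>k\<in>keys i. (1 + \<bar>\<alpha>\<bar>) ^ lookup i k)"
    proof (intro prod_mono conjI norm1_nonneg)
      fix k
      have "norm1 (?g k ^ n) \<le> norm1 (?g k) ^ n" for n
        using norm1_prod[of "\<lambda>_. ?g k" "{..<n}"] by simp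
      also have "norm1 (?g k) ^ lookup i k \<le> (1 + \<bar>\<alpha>\<bar>) ^ lookup i k"
        by (intro power_mono g norm1_nonneg)
      finally show "norm1 (?g k ^ lookup i k) \<le> (1 + \<bar>\<alpha>\<bar>) ^ lookup i k" .
    qed
    also have "\<dots> = (1 + \<bar>\<alpha>\<bar>) ^ expo_total i" by (simp add: expo_total_def power_sum)
    also have "\<dots> \<le> (1 + \<bar>\<alpha>\<bar>) ^ (\<Sum>k<m. r k)"
      by (intro power_increasing expo_total_le_if_deg_le[OF assms i]) simp
    finally have "\<bar>lookup P i\<bar> * norm1 (mpower ?g i) \<le> \<bar>lookup P i\<bar> * (1 + \<bar>\<alpha>\<bar>) ^ (\<Sum>k<m. r k)"
      by (intro mult_left_mono) auto
    then show "norm1 (single 0 (lookup P i) * mpower ?g i) \<le> \<bar>lookup P i\<bar> * (1 + \<bar>\<alpha>\<bar>) ^ (\<Sum>k<m. r k)"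
      using norm1_mult[of "single 0 (lookup P i)" "mpower ?g i"] by simp
  qed
  then show ?thesis by (simp add: norm1_def sum_distrib_right mult.commute)
qed

text \<open>The product of the \<open>q k ^ r k\<close> clears every denominator, and a nonzero
  integer has absolute value at least 1.\<close>

lemma ev_rational_lower_bound:
  fixes p q :: "nat \<Rightarrow> int"
  assumes deg: "deg_le m r G" and int: "int_poly G" and q: "\<And>k. k < m \<Longrightarrow> 0 < q k"
    and b: "\<And>k. k < m \<Longrightarrow> b k = of_int (p k) / of_int (q k)" and nz: "ev b G \<noteq> 0"
  shows "1 \<le> \<bar>ev b G\<bar> * (\<Prod>k<m. real_of_int (q k) ^ r k)"
proof -
  let ?Q = "\<Prod>k<m. real_of_int (q k) ^ r k"
  have Q: "?Q > 0" by (intro prod_pos) (use q in auto)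
  have "ev b G * ?Q = (\<Sum>i\<in>keys G. lookup G i * (mpower b i * ?Q))"
    by (simp add: insertion_def sum_distrib_right mult.assoc)
  also have "\<dots> \<in> \<int>"
  proof (rule Ints_sum)
    fix i assume i: "i \<in> keys G"
    have c: "lookup G i \<in> \<int>" using int by (simp add: int_poly_def)
    have "mpower b i = (\<Prod>k<m. b k ^ lookup i k)"
      by (rule mpower_superset) (use deg i in \<open>auto simp: deg_le_def in_vars_def\<close>)
    then have "mpower b i * ?Q = (\<Prod>k<m. b k ^ lookup i k * real_of_int (q k) ^ r k)"
      by (simp add: prod.distrib)
    also have "\<dots> = (\<Prod>k<m. of_int (p k ^ lookup i k * q k ^ (r k - lookup i k)))"
    proof (intro prod.cong refl)
      fix k assume "k \<in> {..<m}"
      then have k: "k < m" "lookup i k \<le> r k" using deg i by (auto simp: deg_le_def)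
      have "real_of_int (q k) ^ r k = real_of_int (q k) ^ lookup i k * real_of_int (q k) ^ (r k - lookup i k)"
        using k(2) by (simp flip: power_add)
      then show "b k ^ lookup i k * real_of_int (q k) ^ r k
          = of_int (p k ^ lookup i k * q k ^ (r k - lookup i k))"
        using q[OF k(1)] by (simp add: b[OF k(1)] power_divide)
    qed
    also have "\<dots> \<in> \<int>" by (intro Ints_prod) auto
    finally show "lookup G i * (mpower b i * ?Q) \<in> \<int>" by (rule Ints_mult[OF c])
  qed
  finally have "ev b G * ?Q \<in> \<int>" .
  moreover have "ev b G * ?Q \<noteq> 0" using nz Q by (metis less_irrefl mult_eq_0_iff)
  ultimately have "\<bar>ev b G * ?Q\<bar> \<ge> 1" by (rule Ints_nonzero_abs_ge1)
  then show ?thesis using Q by (simp add: abs_mult)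
qed

lemma ev_upper_bound:
  assumes "\<And>i. i \<in> keys (translate a G) \<Longrightarrow> \<bar>mpower (\<lambda>k. b k - a k) i\<bar> \<le> D"
  shows "\<bar>ev b G\<bar> \<le> norm1 (translate a G) * D"
proof -
  have "ev b G = ev (\<lambda>k. b k - a k) (translate a G)"
    by (simp add: eval.insertion_translate)
  also have "\<bar>\<dots>\<bar> \<le> (\<Sum>i\<in>keys (translate a G). \<bar>lookup (translate a G) i * mpower (\<lambda>k. b k - a k) i\<bar>)"
    unfolding insertion_def by (rule sum_abs)
  also have "\<dots> \<le> (\<Sum>i\<in>keys (translate a G). \<bar>lookup (translate a G) i\<bar> * D)"
    unfolding abs_mult by (intro sum_mono mult_left_mono assms) auto
  finally show ?thesis by (simp add: norm1_def sum_distrib_right)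
qed

text \<open>With \<open>r k\<close> close to \<open>L / ln (q k)\<close>, the lower bound \<open>exp (- m L)\<close> for a nonzero value at the
  rational point meets the upper bound \<open>exp (- (2 + \<delta>) (m / 2) L)\<close>, up to small errors.\<close>
lemma roth_inequality:
  fixes p q :: "nat \<Rightarrow> int"
  assumes \<delta>: "0 < \<delta>" "\<delta> \<le> 1" and \<epsilon>: "\<epsilon> = \<delta> / 24" and m: "0 < m"
    and P: "int_poly P" "deg_le m r P" and c: "c \<ge> 1" "norm1 P \<le> c ^ (\<Sum>k<m. r k)"
    and low: "\<And>s. wt r m s < real m / 2 - \<epsilon> * real m \<Longrightarrow> ev (\<lambda>_. \<alpha>) (hasse s P) = 0"
    and s: "wt r m s \<le> \<epsilon>" "ev b (hasse s P) \<noteq> 0"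
    and r: "\<And>k. k < m \<Longrightarrow> 1 \<le> r k" and q: "\<And>k. k < m \<Longrightarrow> 1 < q k"
    and b: "\<And>k. k < m \<Longrightarrow> b k = of_int (p k) / of_int (q k)"
    and close: "\<And>k. k < m \<Longrightarrow> \<bar>b k - \<alpha>\<bar> \<le> exp (- (2 + \<delta>) * ln (of_int (q k)))"
    and rL: "\<And>k. k < m \<Longrightarrow> L \<le> r k * ln (of_int (q k))" "\<And>k. k < m \<Longrightarrow> r k * ln (of_int (q k)) \<le> (1 + \<delta> / 16) * L"
    and L: "L > 0" and R: "real (\<Sum>k<m. r k) * ln (2 * c * (1 + \<bar>\<alpha>\<bar>)) \<le> \<delta> / 16 * (real m * L)"
  shows False
proof -
  define G where "G = hasse s P"
  define R where "R = (\<Sum>k<m. r k)"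
  \<comment> \<open>At \<alpha> the index of \<open>P\<close> is at least
    \<open>m / 2 - \<epsilon> * m\<close>. Passing to \<open>hasse s P\<close> costs at most
    \<epsilon>, which is rounded up to \<open>\<epsilon> * m\<close>.\<close>
  define T where "T = real m / 2 - 2 * \<epsilon> * real m"
  define D where "D = exp (- (2 + \<delta>) * L * T)"
  have \<epsilon>0: "0 < \<epsilon>" using \<delta> by (simp add: \<epsilon>)
  have degG: "deg_le m r G" and intG: "int_poly G"
    unfolding G_def using P by (auto intro: deg_le_hasse int_poly_hasse)
  have "wt_ge (wt r m) (real m / 2 - \<epsilon> * real m) (translate (\<lambda>_. \<alpha>) P)"
    unfolding wt_ge_def
  proof
    fix i assume "i \<in> keys (translate (\<lambda>_. \<alpha>) P)"
    then have "ev (\<lambda>_. \<alpha>) (hasse i P) \<noteq> 0" unfolding in_keys_iff lookup_translate .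
    then show "real m / 2 - \<epsilon> * real m \<le> wt r m i" using low[of i] by (meson not_le)
  qed
  then have wG: "wt_ge (wt r m) (real m / 2 - \<epsilon> * real m - wt r m s) (translate (\<lambda>_. \<alpha>) G)"
    unfolding G_def by (rule wt_ge_translate_hasse[OF additive_weight_wt])
  have "\<epsilon> * 1 \<le> \<epsilon> * real m" using m \<epsilon>0 by (intro mult_left_mono) auto
  then have T: "T \<le> wt r m i" if "i \<in> keys (translate (\<lambda>_. \<alpha>) G)" for i
    using wG that s(1) unfolding wt_ge_def T_def by fastforce
  have kG: "keys i \<subseteq> {..<m}" if "i \<in> keys (translate (\<lambda>_. \<alpha>) G)" for i
    using in_vars_translate[of "{..<m}" G "\<lambda>_. \<alpha>"] degG that by (auto simp: deg_le_def in_vars_def)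
  have "\<bar>mpower (\<lambda>k. b k - \<alpha>) i\<bar> \<le> D" if i: "i \<in> keys (translate (\<lambda>_. \<alpha>) G)" for i
  proof -
    have "mpower (\<lambda>k. b k - \<alpha>) i = (\<Prod>k<m. (b k - \<alpha>) ^ lookup i k)"
      by (rule mpower_superset) (use kG[OF i] in auto)
    then have "\<bar>mpower (\<lambda>k. b k - \<alpha>) i\<bar> = (\<Prod>k<m. \<bar>b k - \<alpha>\<bar> ^ lookup i k)"
      by (simp add: abs_prod power_abs)
    also have "\<dots> \<le> (\<Prod>k<m. exp (- (2 + \<delta>) * L * (real (lookup i k) / real (r k))))"
    proof (intro prod_mono conjI)
      fix k assume "k \<in> {..<m}"
      then have k: "k < m" by simp
      have "\<bar>b k - \<alpha>\<bar> ^ lookup i k \<le> exp (- (2 + \<delta>) * ln (of_int (q k))) ^ lookup i k"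
        using close[OF k] by (intro power_mono) auto
      also have "\<dots> = exp (- (2 + \<delta>) * (real (lookup i k) * ln (of_int (q k))))"
        by (simp flip: exp_of_nat_mult)
      also have "\<dots> \<le> exp (- (2 + \<delta>) * L * (real (lookup i k) / real (r k)))"
      proof -
        have "L * (real (lookup i k) / real (r k)) \<le> r k * ln (of_int (q k)) * (real (lookup i k) / real (r k))"
          using rL(1)[OF k] by (intro mult_right_mono) auto
        also have "\<dots> = real (lookup i k) * ln (of_int (q k))" using r[OF k] by simp
        finally have "(2 + \<delta>) * (L * (real (lookup i k) / real (r k))) \<le> (2 + \<delta>) * (real (lookup i k) * ln (of_int (q k)))"
          using \<delta> by (intro mult_left_mono) auto
        then show ?thesis by (simp only: exp_le_cancel_iff mult_minus_left neg_le_iff_le mult.assoc)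
      qed
      finally show "\<bar>b k - \<alpha>\<bar> ^ lookup i k \<le> exp (- (2 + \<delta>) * L * (real (lookup i k) / real (r k)))" .
    qed simp
    also have "\<dots> = exp (- (2 + \<delta>) * L * wt r m i)"
      by (simp only: wt_def exp_sum finite_lessThan sum_distrib_left)
    also have "\<dots> \<le> D"
    proof -
      have "(2 + \<delta>) * L * T \<le> (2 + \<delta>) * L * wt r m i"
        using \<delta> L T[OF i] by (intro mult_left_mono) auto
      then show ?thesis by (simp only: D_def exp_le_cancel_iff mult_minus_left neg_le_iff_le)
    qed
    finally show ?thesis .
  qed
  then have "\<bar>ev b G\<bar> \<le> norm1 (translate (\<lambda>_. \<alpha>) G) * D" by (rule ev_upper_bound)
  also have "\<dots> \<le> (2 * c * (1 + \<bar>\<alpha>\<bar>)) ^ R * D"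
  proof (rule mult_right_mono)
    have "norm1 (translate (\<lambda>_. \<alpha>) G) \<le> (1 + \<bar>\<alpha>\<bar>) ^ R * norm1 G"
      unfolding R_def by (rule norm1_translate[OF degG])
    also have "\<dots> \<le> (1 + \<bar>\<alpha>\<bar>) ^ R * (2 ^ R * c ^ R)"
    proof (rule mult_left_mono)
      have "norm1 G \<le> 2 ^ R * norm1 P" unfolding G_def R_def by (rule norm1_hasse[OF P(2)])
      also have "\<dots> \<le> 2 ^ R * c ^ R" using c(2) by (intro mult_left_mono) (auto simp: R_def)
      finally show "norm1 G \<le> 2 ^ R * c ^ R" .
    qed simp
    finally show "norm1 (translate (\<lambda>_. \<alpha>) G) \<le> (2 * c * (1 + \<bar>\<alpha>\<bar>)) ^ R"
      by (simp only: power_mult_distrib mult_ac)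
  qed (simp add: D_def)
  finally have up: "\<bar>ev b G\<bar> \<le> (2 * c * (1 + \<bar>\<alpha>\<bar>)) ^ R * D" .
  define Q where "Q = (\<Prod>k<m. real_of_int (q k) ^ r k)"
  have "1 \<le> \<bar>ev b G\<bar> * Q"
    unfolding Q_def
  proof (rule ev_rational_lower_bound[OF degG intG])
    show "0 < q k" if "k < m" for k using q[OF that] by simp
    show "ev b G \<noteq> 0" unfolding G_def by (rule s(2))
  qed (rule b)
  moreover have Qpos: "Q > 0"
    unfolding Q_def
  proof (rule prod_pos)
    fix k assume "k \<in> {..<m}"
    then show "0 < real_of_int (q k) ^ r k" using q[of k] by simp
  qed
  ultimately have "1 \<le> (2 * c * (1 + \<bar>\<alpha>\<bar>)) ^ R * D * Q"
    using mult_right_mono[OF up, of Q] by linarith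
  then have "ln 1 \<le> ln ((2 * c * (1 + \<bar>\<alpha>\<bar>)) ^ R * D * Q)" by (subst ln_le_cancel_iff) auto
  also have "\<dots> = real R * ln (2 * c * (1 + \<bar>\<alpha>\<bar>)) - (2 + \<delta>) * L * T + ln Q"
  proof -
    have X: "0 < 2 * c * (1 + \<bar>\<alpha>\<bar>)" using c by (simp add: add_pos_nonneg)
    have D: "0 < D" by (simp add: D_def)
    have "ln ((2 * c * (1 + \<bar>\<alpha>\<bar>)) ^ R * D * Q) = ln ((2 * c * (1 + \<bar>\<alpha>\<bar>)) ^ R * D) + ln Q"
      by (rule ln_mult_pos) (use X D Qpos in simp_all)
    also have "ln ((2 * c * (1 + \<bar>\<alpha>\<bar>)) ^ R * D) = ln ((2 * c * (1 + \<bar>\<alpha>\<bar>)) ^ R) + ln D"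
      by (rule ln_mult_pos) (use X D in simp_all)
    also have "ln ((2 * c * (1 + \<bar>\<alpha>\<bar>)) ^ R) = real R * ln (2 * c * (1 + \<bar>\<alpha>\<bar>))"
      by (rule ln_realpow)
    also have "ln D = - ((2 + \<delta>) * L * T)" unfolding D_def ln_exp by (simp add: algebra_simps)
    finally show ?thesis by simp
  qed
  also have "ln Q = (\<Sum>k<m. r k * ln (of_int (q k)))"
  proof -
    have "real_of_int (q k) ^ r k \<noteq> 0" if "k \<in> {..<m}" for k using q[of k] that by simp
    then have "ln Q = (\<Sum>k<m. ln (real_of_int (q k) ^ r k))"
      unfolding Q_def by (rule ln_prod[OF finite_lessThan])
    then show ?thesis by (simp only: ln_realpow)
  qed
  also have "real R * ln (2 * c * (1 + \<bar>\<alpha>\<bar>)) - (2 + \<delta>) * L * T + (\<Sum>k<m. r k * ln (of_int (q k)))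
      \<le> \<delta> / 16 * (real m * L) - (2 + \<delta>) * L * T + (\<Sum>k<m. (1 + \<delta> / 16) * L)"
    using R rL(2) unfolding R_def by (intro add_mono diff_mono sum_mono) auto
  also have "\<dots> = real m * L * (1 + \<delta> / 8 - (2 + \<delta>) * (1 / 2 - 2 * \<epsilon>))"
    by (simp add: T_def algebra_simps)
  finally have nonneg: "0 \<le> real m * L * (1 + \<delta> / 8 - (2 + \<delta>) * (1 / 2 - 2 * \<epsilon>))" by simp
  \<comment> \<open>The gain \<delta>/2 beats the losses: \<delta>/16 from the norms, \<delta>/16
    from rounding the \<open>r k\<close>, and 2 \<epsilon> (2 + \<delta>) from the index. For
    \<epsilon> = \<delta>/24 the last is \<delta>/6 + \<delta>^2/12, which leaves a negative sum for
    \<delta> \<le> 1.\<close>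
  have "1 + \<delta> / 8 - (2 + \<delta>) * (1 / 2 - 2 * \<epsilon>) = - 5 / 24 * \<delta> + \<delta> * \<delta> / 12"
    by (simp add: \<epsilon> field_simps)
  moreover have "- 5 / 24 * \<delta> + \<delta> * \<delta> / 12 < 0"
    using \<delta> mult_left_mono[of \<delta> 1 \<delta>] by simp
  ultimately have "1 + \<delta> / 8 - (2 + \<delta>) * (1 / 2 - 2 * \<epsilon>) < 0" by linarith
  moreover have "0 < real m * L" using m L by simp
  ultimately have "real m * L * (1 + \<delta> / 8 - (2 + \<delta>) * (1 / 2 - 2 * \<epsilon>)) < 0" by (rule mult_pos_neg[rotated])
  with nonneg show False by linarith
qed

text \<open>The order of the choices avoids circularity: \<open>m\<close> depends on \<delta> and
  \<open>d\<close>, then \<omega> on \<open>m\<close> and \<delta>, then the approximations on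
  \<omega> and the equation of \<alpha>, and only then \<open>L\<close> and the degrees
  \<open>r k\<close>. Infinitely many good fractions are needed to choose \<open>m\<close> of them
  that are large and far apart.\<close>

lemma roth_aux:
  fixes f :: "nat \<Rightarrow> int" and \<alpha> \<delta> :: real
  assumes d: "0 < d" "f d \<noteq> 0" and root: "(\<Sum>l\<le>d. of_int (f l) * \<alpha> ^ l) = 0"
    and \<delta>: "0 < \<delta>" "\<delta> \<le> 1"
  shows "\<exists>B::int. \<forall>p q::int. 0 < q \<longrightarrow> coprime p q \<longrightarrow>
    \<bar>of_int p / of_int q - \<alpha>\<bar> \<le> exp (- (2 + \<delta>) * ln (of_int q)) \<longrightarrow> q \<le> B"
proof (rule ccontr)
  define good where "good p q \<longleftrightarrow> 0 < q \<and> coprime p q \<and>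
    \<bar>of_int p / of_int q - \<alpha>\<bar> \<le> exp (- (2 + \<delta>) * ln (of_int q))" for p q :: int
  assume contra: "\<not> ?thesis"
  have ex: "\<exists>p q. good p q \<and> X \<le> ln (real_of_int q)" for X
  proof -
    obtain p q :: int where pq: "good p q" "\<lceil>exp X\<rceil> < q"
      using contra unfolding good_def by (meson not_le)
    have "exp X \<le> of_int q" using pq(2) by linarith
    then have "ln (exp X) \<le> ln (of_int q)" using pq(1) by (subst ln_le_cancel_iff) (auto simp: good_def)
    then show ?thesis using pq(1) by auto
  qed
  define \<epsilon> where "\<epsilon> = \<delta> / 24"
  have \<epsilon>: "0 < \<epsilon>" "\<epsilon> \<le> 1" using \<delta> by (simp_all add: \<epsilon>_def)
  \<comment> \<open>Large enough for the \<open>d\<close> equations per low weight exponent to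
    amount to at most half the number of unknowns.\<close>
  define m where "m = nat \<lceil>real d / (2 * \<epsilon>\<^sup>2)\<rceil> + 1"
  have m: "0 < m" "real d \<le> 2 * \<epsilon>\<^sup>2 * real m"
  proof -
    have "real d / (2 * \<epsilon>\<^sup>2) \<le> real m" unfolding m_def by linarith
    then show "real d \<le> 2 * \<epsilon>\<^sup>2 * real m" using \<epsilon>(1) by (simp add: divide_simps mult_ac)
  qed (simp add: m_def)
  obtain \<omega> where \<omega>: "0 < \<omega>" "index_bound m \<epsilon> \<omega>" using roth_lemma[OF \<epsilon>] by blast
  define F where "F = (\<Sum>l\<le>d. nat \<bar>f l\<bar>)"
  have F: "\<bar>f l\<bar> \<le> int F" if "l \<le> d" for l
  proof -
    have "nat \<bar>f l\<bar> \<le> F" unfolding F_def by (rule member_le_sum) (use that in auto)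
    then show ?thesis by linarith
  qed
  define c where "c = 16 * real F"
  have c: "1 \<le> c" using F[of d] d(2) by (simp add: c_def)
  define C where "C = ln (2 * c * (1 + \<bar>\<alpha>\<bar>))"
  have cC: "c \<le> 2 * c * (1 + \<bar>\<alpha>\<bar>)"
  proof -
    have "c * 1 \<le> c * (2 * (1 + \<bar>\<alpha>\<bar>))" using c by (intro mult_left_mono) auto
    then show ?thesis by (simp add: mult_ac)
  qed
  have lnc: "ln c \<le> C" "0 \<le> C"
  proof -
    show "ln c \<le> C" unfolding C_def using c cC by (intro ln_mono) linarith+
    show "0 \<le> C" unfolding C_def using c cC by (intro ln_ge_zero) linarith
  qed
  \<comment> \<open>A lower bound for all \<open>ln (q k)\<close>. Its summands ensure, in turn,
    positivity, \<open>r k \<le> \<omega> * L\<close>, the bound \<open>\<omega> * L\<close> for the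
    log norm of \<open>P\<close>, and the error term \<open>\<delta> / 16\<close> of the final
    inequality.\<close>
  define K where "K = 1 + 2 / \<omega> + 2 * real m * C / \<omega> + 32 * C / \<delta>"
  \<comment> \<open>The growth factor of the logarithms of successive denominators;
    \<open>2 \<le> \<omega> * \<Lambda>\<close> yields the decrease of the degrees, the 2 absorbing
    the rounding of \<open>r k\<close>.\<close>
  define \<Lambda> where "\<Lambda> = 1 + 2 / \<omega>"
  have pos: "0 \<le> 2 / \<omega>" "0 \<le> 2 * real m * C / \<omega>" "0 \<le> 32 * C / \<delta>" using \<omega>(1) lnc(2) \<delta>(1) by auto
  have K1: "1 \<le> K" "2 / \<omega> \<le> K" "2 * real m * C / \<omega> \<le> K" "32 * C / \<delta> \<le> K"
    using pos unfolding K_def by linarith+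
  have K: "0 < K" "2 \<le> \<omega> * K" "2 * real m * C \<le> \<omega> * K" "32 * C \<le> \<delta> * K"
    using K1 \<omega>(1) \<delta>(1) by (simp_all add: pos_divide_le_eq mult.commute)
  have \<Lambda>: "1 \<le> \<Lambda>" "2 \<le> \<omega> * \<Lambda>" using pos(1) \<omega>(1) by (simp_all add: \<Lambda>_def distrib_left)
  have "\<exists>g. \<forall>n. (good (fst (g n)) (snd (g n)) \<and> K \<le> ln (of_int (snd (g n)))) \<and>
      \<Lambda> * ln (real_of_int (snd (g n))) \<le> ln (real_of_int (snd (g (Suc n))))"
  proof (rule dependent_nat_choice)
    show "\<exists>x. good (fst x) (snd x) \<and> K \<le> ln (of_int (snd x))" using ex[of K] by auto
    fix x :: "int \<times> int" and n :: nat
    show "\<exists>y. (good (fst y) (snd y) \<and> K \<le> ln (of_int (snd y))) \<and>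
        \<Lambda> * ln (real_of_int (snd x)) \<le> ln (real_of_int (snd y))"
      using ex[of "max K (\<Lambda> * ln (real_of_int (snd x)))"] by auto
  qed
  then obtain g where g: "\<And>n. good (fst (g n)) (snd (g n))" "\<And>n. K \<le> ln (of_int (snd (g n)))"
    "\<And>n. \<Lambda> * ln (real_of_int (snd (g n))) \<le> ln (real_of_int (snd (g (Suc n))))" by blast
  define p where "p n = fst (g n)" for n
  define q where "q n = snd (g n)" for n
  define l where "l n = ln (real_of_int (q n))" for n
  have good: "good (p n) (q n)" and lK: "K \<le> l n" and lS: "\<Lambda> * l n \<le> l (Suc n)" for n
    using g unfolding p_def q_def l_def by blast+
  have lpos: "0 < l n" for n using lK[of n] K(1) by linarith
  have mono: "l n \<le> l (Suc n)" for n
    using lS[of n] mult_right_mono[OF \<Lambda>(1), of "l n"] lpos[of n] by linarith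
  have lchain: "\<Lambda> * l j \<le> l k" if "j < k" for j k
    using that
  proof (induction k)
    case (Suc k)
    then show ?case using lS[of j] mono[of k] by (cases "j = k") (auto intro: order_trans)
  qed simp
  define \<theta> where "\<theta> = \<delta> / 16"
  have \<theta>: "0 < \<theta>" "\<theta> \<le> 1" using \<delta> by (simp_all add: \<theta>_def)
  \<comment> \<open>Division by \<theta> makes every \<open>l k\<close> at most
    \<open>\<theta> * L\<close>, so that rounding \<open>L / l k\<close> up to the integer
    \<open>r k\<close> enlarges \<open>r k * l k\<close> beyond \<open>L\<close> by at most a factor
    \<open>1 + \<theta>\<close>.\<close>
  define L where "L = (\<Sum>k<m. l k) / \<theta>"
  have lL: "l k \<le> \<theta> * L" if "k < m" for k
  proof -
    have "l k \<le> (\<Sum>k<m. l k)" by (rule member_le_sum) (use that lpos in \<open>auto intro: less_imp_le\<close>)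
    then show ?thesis using \<theta>(1) by (simp add: L_def)
  qed
  have "0 < \<theta> * L" using lL[of 0] lpos[of 0] m(1) by linarith
  then have L: "0 < L" using \<theta>(1) by (simp add: zero_less_mult_iff)
  define r where "r k = nat \<lceil>L / l k\<rceil>" for k
  have r_lower: "L \<le> real (r k) * l k" for k
  proof -
    have "L / l k \<le> real (r k)" unfolding r_def by linarith
    then show ?thesis using lpos[of k] by (simp add: pos_divide_le_eq)
  qed
  have r1: "1 \<le> r k" for k
  proof -
    have "r k \<noteq> 0" using r_lower[of k] L by (intro notI) simp
    then show ?thesis by simp
  qed
  have r_upper: "real (r k) * l k \<le> (1 + \<theta>) * L" if "k < m" for k
  proof -
    have "0 < L / l k" using L lpos[of k] by simp
    then have "real (r k) \<le> L / l k + 1" unfolding r_def by linarith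
    then have "real (r k) * l k \<le> (L / l k + 1) * l k" using lpos[of k] by (intro mult_right_mono) auto
    also have "\<dots> = L + l k" using lpos[of k] by (simp add: distrib_right)
    finally show ?thesis using lL[OF that] by (simp add: distrib_right)
  qed
  have r2: "real (r k) * l k \<le> 2 * L" if "k < m" for k
    using r_upper[OF that] mult_right_mono[of "1 + \<theta>" 2 L] \<theta> L by linarith
  have rK: "real (r k) * K \<le> 2 * L" if "k < m" for k
    using mult_left_mono[OF lK[of k], of "real (r k)"] r2[OF that] by simp
  have R: "real (\<Sum>k<m. r k) * K \<le> real m * (2 * L)"
  proof -
    have "real (\<Sum>k<m. r k) * K = (\<Sum>k<m. real (r k) * K)" by (simp add: sum_distrib_right)
    also have "\<dots> \<le> (\<Sum>k<m. 2 * L)" by (intro sum_mono rK) simp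
    finally show ?thesis by simp
  qed
  have RC: "real (\<Sum>k<m. r k) * C \<le> \<omega> * L" "real (\<Sum>k<m. r k) * C \<le> \<delta> / 16 * (real m * L)"
  proof -
    have *: "(real (\<Sum>k<m. r k) * C) * K \<le> (2 * real m * C) * L"
      using mult_right_mono[OF R lnc(2)] by (simp only: mult_ac)
    have "(2 * real m * C) * L \<le> (\<omega> * K) * L" using K(3) L by (intro mult_right_mono) auto
    with * have "(real (\<Sum>k<m. r k) * C) * K \<le> (\<omega> * L) * K" by (simp only: mult_ac)
    then show "real (\<Sum>k<m. r k) * C \<le> \<omega> * L" using K(1) by (rule mult_right_le_imp_le)
    have "(32 * C) * (real m * L) \<le> (\<delta> * K) * (real m * L)" using K(4) L by (intro mult_right_mono) auto
    then have "(2 * real m * C) * L \<le> (\<delta> / 16 * (real m * L)) * K" by (simp add: mult_ac)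
    with * have "(real (\<Sum>k<m. r k) * C) * K \<le> (\<delta> / 16 * (real m * L)) * K" by (rule order_trans)
    then show "real (\<Sum>k<m. r k) * C \<le> \<delta> / 16 * (real m * L)" using K(1) by (rule mult_right_le_imp_le)
  qed
  obtain P where P: "int_poly P" "P \<noteq> 0" "deg_le m r P" "norm1 P \<le> c ^ (\<Sum>k<m. r k)"
    and low: "\<forall>s. wt r m s < real m / 2 - \<epsilon> * real m \<longrightarrow> ev (\<lambda>_. \<alpha>) (hasse s P) = 0"
    using auxiliary_polynomial[of d f \<alpha> F \<epsilon> m r, OF d root F \<epsilon>(1) m r1] unfolding c_def by blast
  define b where "b k = real_of_int (p k) / of_int (q k)" for k
  have "\<exists>s. wt r m s \<le> \<epsilon> \<and> ev b (hasse s P) \<noteq> 0"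
  proof (rule \<omega>(2)[unfolded index_bound_def, rule_format, where L = L and p = p and q = q])
    have "ln (norm1 P) \<le> ln (c ^ (\<Sum>k<m. r k))"
      using norm1_ge_1[OF P(1,2)] P(4) by (subst ln_le_cancel_iff) auto
    also have "\<dots> = real (\<Sum>k<m. r k) * ln c" by (rule ln_realpow)
    also have "\<dots> \<le> real (\<Sum>k<m. r k) * C" by (rule mult_left_mono[OF lnc(1) of_nat_0_le_iff])
    also have "\<dots> \<le> \<omega> * L" by (rule RC)
    finally show "ln (norm1 P) \<le> \<omega> * L" .
    fix k assume k: "k < m"
    have "real (r k) * 2 \<le> real (r k) * (\<omega> * K)" using K(2) by (intro mult_left_mono) auto
    also have "\<dots> = \<omega> * (real (r k) * K)" by (simp only: mult_ac)
    also have "\<dots> \<le> \<omega> * (2 * L)" using rK[OF k] \<omega>(1) by (intro mult_left_mono) auto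
    finally have A: "real (r k) \<le> \<omega> * L" by simp
    have B: "L \<le> real (r k) * ln (of_int (q k))" using r_lower[of k] unfolding l_def .
    have G: "0 < q k" "coprime (p k) (q k)" using good[of k] by (simp_all add: good_def)
    show "1 \<le> r k \<and> real (r k) \<le> \<omega> * L \<and> 0 < q k \<and> coprime (p k) (q k) \<and>
        b k = of_int (p k) / of_int (q k) \<and> L \<le> real (r k) * ln (of_int (q k))"
      by (intro conjI r1 A B G) (simp add: b_def)
    fix j assume j: "j < k"
    have "(real (r k) * 2) * l j \<le> (real (r k) * (\<omega> * \<Lambda>)) * l j"
      using \<Lambda>(2) lpos[of j] by (intro mult_right_mono mult_left_mono) auto
    also have "\<dots> = \<omega> * (real (r k) * (\<Lambda> * l j))" by (simp only: mult_ac)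
    also have "\<dots> \<le> \<omega> * (real (r k) * l k)" using lchain[OF j] \<omega>(1) by (intro mult_left_mono) auto
    also have "\<dots> \<le> \<omega> * (2 * L)" using r2[OF k] \<omega>(1) by (intro mult_left_mono) auto
    also have "\<dots> \<le> \<omega> * (2 * (real (r j) * l j))" using r_lower[of j] \<omega>(1) by (intro mult_left_mono) auto
    finally have "(2 * l j) * real (r k) \<le> (2 * l j) * (\<omega> * real (r j))" by (simp only: mult_ac)
    then show "real (r k) \<le> \<omega> * real (r j)" using lpos[of j] by simp
  qed (rule P(1) P(2) P(3))+
  then obtain s where s: "wt r m s \<le> \<epsilon>" "ev b (hasse s P) \<noteq> 0" by blast
  show False
  proof (rule roth_inequality[OF \<delta> \<epsilon>_def m(1) P(1,3) c P(4) _ s, where L = L and q = q and p = p])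
    show "ev (\<lambda>_. \<alpha>) (hasse s P) = 0" if "wt r m s < real m / 2 - \<epsilon> * real m" for s
      using low that by blast
    show "real (\<Sum>k<m. r k) * ln (2 * c * (1 + \<bar>\<alpha>\<bar>)) \<le> \<delta> / 16 * (real m * L)"
      using RC(2) unfolding C_def .
    fix k assume k: "k < m"
    show "1 < q k"
    proof -
      have "0 < q k" using good[of k] by (simp add: good_def)
      moreover have "q k \<noteq> 1" using lpos[of k] by (auto simp: l_def)
      ultimately show ?thesis by linarith
    qed
    show "\<bar>b k - \<alpha>\<bar> \<le> exp (- (2 + \<delta>) * ln (of_int (q k)))"
      using good[of k] by (simp add: good_def b_def)
    show "L \<le> real (r k) * ln (of_int (q k))" using r_lower[of k] unfolding l_def .
    show "real (r k) * ln (of_int (q k)) \<le> (1 + \<delta> / 16) * L"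
      using r_upper[OF k] unfolding l_def \<theta>_def .
  qed (rule L r1 | simp add: b_def)+
qed

theorem roth:
  fixes \<alpha> \<delta> :: real
  assumes "algebraic \<alpha>" "0 < \<delta>"
  shows "\<exists>B::int. \<forall>p q::int. 0 < q \<longrightarrow> coprime p q \<longrightarrow>
    \<bar>\<alpha> - of_int p / of_int q\<bar> < of_int q powr (- (2 + \<delta>)) \<longrightarrow> q \<le> B"
proof -
  obtain P where P: "\<And>i. coeff P i \<in> \<int>" "P \<noteq> 0" "poly P \<alpha> = 0"
    using assms(1) by (auto simp: algebraic_def)
  define f where "f i = \<lfloor>coeff P i\<rfloor>" for i
  have f: "of_int (f i) = coeff P i" for i using P(1)[of i] by (simp add: f_def)
  have "f (degree P) \<noteq> 0" using P(2) f[of "degree P"] by auto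
  moreover have root: "(\<Sum>l\<le>degree P. of_int (f l) * \<alpha> ^ l) = 0"
    using P(3) by (simp add: f poly_altdef)
  moreover have "0 < degree P"
  proof (rule ccontr)
    assume "\<not> ?thesis"
    then obtain c where "P = [:c:]" by (metis degree_eq_zeroE neq0_conv)
    then show False using P(2,3) by simp
  qed
  \<comment> \<open>For \<open>q \<ge> 1\<close> a smaller \<delta> only weakens the condition on
    the fraction, so it may be cut down to 1.\<close>
  moreover define \<delta>' where "\<delta>' = min \<delta> 1"
  then have \<delta>': "0 < \<delta>'" "\<delta>' \<le> 1" "\<delta>' \<le> \<delta>" using assms(2) by auto
  ultimately obtain B :: int where B: "\<And>p q::int. 0 < q \<Longrightarrow> coprime p q \<Longrightarrow>
    \<bar>of_int p / of_int q - \<alpha>\<bar> \<le> exp (- (2 + \<delta>') * ln (of_int q)) \<Longrightarrow> q \<le> B"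
    using roth_aux[of "degree P" f \<alpha> \<delta>'] by blast
  show ?thesis
  proof (intro exI[of _ B] allI impI)
    fix p q :: int
    assume q: "0 < q" and cop: "coprime p q" and close: "\<bar>\<alpha> - of_int p / of_int q\<bar> < of_int q powr (- (2 + \<delta>))"
    have "of_int q powr (- (2 + \<delta>)) \<le> real_of_int q powr (- (2 + \<delta>'))"
      by (rule powr_mono) (use q \<delta>' in auto)
    also have "\<dots> = exp (- (2 + \<delta>') * ln (of_int q))" using q by (simp add: powr_def)
    finally show "q \<le> B"
      using close by (intro B[OF q cop]) (simp add: abs_minus_commute)
  qed
qed

section \<open>Continued fractions\<close>

no_syntax
  "_Sum_any" :: "pttrn \<Rightarrow> 'a \<Rightarrow> 'a::comm_monoid_add"    (\<open>(\<open>indent=2 notation=\<open>binder \<Sum>\<close>\<close>\<Sum>_. _)\<close> [0, 10] 10)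

text \<open>Shifted by one like \<open>cfrac_denom\<close>: argument 0 stands for the index -1, and
  the convergent with index \<open>n\<close> uses the argument \<open>Suc n\<close>.\<close>

fun conv_num :: "(nat \<Rightarrow> real) \<Rightarrow> nat \<Rightarrow> real" where
  "conv_num c 0 = 1"
| "conv_num c (Suc 0) = c 0"
| "conv_num c (Suc (Suc n)) = c (Suc n) * conv_num c (Suc n) + conv_num c n"

fun conv_den :: "(nat \<Rightarrow> real) \<Rightarrow> nat \<Rightarrow> real" where
  "conv_den c 0 = 0"
| "conv_den c (Suc 0) = 1"
| "conv_den c (Suc (Suc n)) = c (Suc n) * conv_den c (Suc n) + conv_den c n"

text \<open>\<open>cfrac_trunc\<close> recurs at the front of the sequence, the convergents at its
  end. Removing the first term turns denominators into numerators, which reconciles the two.\<close>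

lemma conv_den_Suc_shift: "conv_den c (Suc n) = conv_num (\<lambda>i. c (Suc i)) n"
  by (induction c n rule: conv_num.induct) simp_all

lemma conv_num_Suc_shift:
  "conv_num c (Suc n) = c 0 * conv_num (\<lambda>i. c (Suc i)) n + conv_den (\<lambda>i. c (Suc i)) n"
  by (induction c n rule: conv_num.induct) (simp_all add: algebra_simps)

lemma conv_num_pos: "(\<And>i. c i > 0) \<Longrightarrow> conv_num c n > 0"
  by (induction c n rule: conv_num.induct) (simp_all add: add_pos_pos)

lemma conv_den_pos: "(\<And>i. i \<ge> 1 \<Longrightarrow> c i > 0) \<Longrightarrow> conv_den c (Suc n) > 0"
  unfolding conv_den_Suc_shift by (rule conv_num_pos) simp

lemma cfrac_trunc_eq:
  "(\<And>i. i \<ge> 1 \<Longrightarrow> c i > 0) \<Longrightarrow> cfrac_trunc n c = conv_num c (Suc n) / conv_den c (Suc n)"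
proof (induction n arbitrary: c)
  case (Suc n)
  let ?c = "\<lambda>i. c (Suc i)"
  have pos: "conv_num ?c (Suc n) > 0" by (rule conv_num_pos) (use Suc.prems in simp)
  have "cfrac_trunc (Suc n) c = c 0 + 1 / (conv_num ?c (Suc n) / conv_den ?c (Suc n))"
    using Suc.IH[of ?c] Suc.prems by simp
  also have "\<dots> = (c 0 * conv_num ?c (Suc n) + conv_den ?c (Suc n)) / conv_num ?c (Suc n)"
    using pos by (simp add: add_divide_distrib)
  finally show ?case by (simp only: conv_num_Suc_shift[of c "Suc n"] conv_den_Suc_shift[of c "Suc n"])
qed simp

lemma cfrac_trunc_cong: "(\<And>i. i \<le> n \<Longrightarrow> c i = c' i) \<Longrightarrow> cfrac_trunc n c = cfrac_trunc n c'"
proof (induction n arbitrary: c c')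
  case (Suc n)
  have "cfrac_trunc n (\<lambda>i. c (Suc i)) = cfrac_trunc n (\<lambda>i. c' (Suc i))"
    by (rule Suc.IH) (use Suc.prems in simp)
  then show ?case using Suc.prems[of 0] by simp
qed simp

text \<open>Used for coprimality of numerator and denominator and for the differences of
  convergents.\<close>

lemma conv_determinant:
  "conv_num c (Suc n) * conv_den c n - conv_num c n * conv_den c (Suc n) = (- 1) ^ Suc n"
proof (induction n)
  case (Suc n)
  have "conv_num c (Suc (Suc n)) * conv_den c (Suc n) - conv_num c (Suc n) * conv_den c (Suc (Suc n))
    = - (conv_num c (Suc n) * conv_den c n - conv_num c n * conv_den c (Suc n))"
    by (simp add: algebra_simps)
  then show ?case using Suc by simp
qed simp

lemma conv_Ints:
  assumes "\<And>i. c i \<in> \<int>"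
  shows "conv_num c n \<in> \<int>" "conv_den c n \<in> \<int>"
  using assms by (induction c n rule: conv_num.induct) auto

lemma conv_den_cfrac_denom:
  "(\<And>i. 1 \<le> i \<Longrightarrow> i < n \<Longrightarrow> c i = of_int (a i)) \<Longrightarrow> conv_den c n = of_int (cfrac_denom a n)"
  by (induction a n rule: cfrac_denom.induct) simp_all

lemma LIMSEQ_even_odd:
  fixes f :: "nat \<Rightarrow> 'a::metric_space"
  assumes "(\<lambda>n. f (2 * n)) \<longlonglongrightarrow> l" "(\<lambda>n. f (2 * n + 1)) \<longlonglongrightarrow> l"
  shows "f \<longlonglongrightarrow> l"
proof (rule metric_LIMSEQ_I)
  fix e :: real assume "0 < e"
  obtain M where M: "\<And>n. n \<ge> M \<Longrightarrow> dist (f (2 * n)) l < e" using metric_LIMSEQ_D[OF assms(1) \<open>0 < e\<close>] by blast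
  obtain N where N: "\<And>n. n \<ge> N \<Longrightarrow> dist (f (2 * n + 1)) l < e" using metric_LIMSEQ_D[OF assms(2) \<open>0 < e\<close>] by blast
  have "dist (f n) l < e" if "n \<ge> 2 * max M N + 1" for n
  proof (cases "even n")
    case True
    then show ?thesis using M[of "n div 2"] that by (auto elim!: evenE)
  next
    case False
    then show ?thesis using N[of "n div 2"] that by (auto elim!: oddE)
  qed
  then show "\<exists>no. \<forall>n\<ge>no. dist (f n) l < e" by blast
qed

theorem theorem2:
  fixes p q :: int and k :: nat and a :: "nat \<Rightarrow> int" and z :: "nat \<Rightarrow> nat"
    and x y c :: "nat \<Rightarrow> real"
  assumes "q \<ge> 1" and "coprime p q"
    and "\<And>i. 1 \<le> i \<Longrightarrow> i \<le> 2 * k \<Longrightarrow> a i > 0"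
    and "of_int p / of_int q = cfrac_trunc (2 * k) (\<lambda>i. of_int (a i))"
    and "\<And>n. n \<ge> 1 \<Longrightarrow> z n > 0"
    and "x 1 = of_int q"
    and "y 0 = of_int (cfrac_denom a (2 * k)) + 1"
    and "\<And>n. n \<ge> 1 \<Longrightarrow> x (n + 1) = x n * y (n - 1) * (x n * of_nat (z n) + 1)"
    and "\<And>n. n \<ge> 1 \<Longrightarrow> y n = x (n + 1) / x n"
    and "\<And>i. i \<le> 2 * k \<Longrightarrow> c i = of_int (a i)"
    and "\<And>j. j \<ge> 1 \<Longrightarrow> c (2 * k + 2 * j - 1) = y (j - 1) * of_nat (z j)"
    and "\<And>j. j \<ge> 1 \<Longrightarrow> c (2 * k + 2 * j) = x j"
  shows "summable (\<lambda>j. 1 / x (j + 2)) \<and>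
    (let S = of_int p / of_int q + (\<Sum>j. 1 / x (j + 2)) in
       simple_cfrac_expansion c S \<and> \<not> algebraic S)"
proof -
  note q1 = assms(1) and cop = assms(2) and a_pos = assms(3) and pq = assms(4) and z_pos = assms(5)
    and x1 = assms(6) and y0 = assms(7) and x_rec = assms(8) and y_rec = assms(9)
    and c_a = assms(10) and c_odd = assms(11) and c_even = assms(12)
  define K where "K = 2 * k"
  have yS: "y (Suc n) = y n * (x (Suc n) * of_nat (z (Suc n)) + 1)" if "x (Suc n) > 0" for n
    using y_rec[of "Suc n"] x_rec[of "Suc n"] that by simp
  have xS: "x (Suc (Suc n)) = x (Suc n) * y (Suc n)" if "x (Suc n) > 0" for n
    using y_rec[of "Suc n"] that by simp
  have den_K: "conv_den c K = of_int (cfrac_denom a K)"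
    by (rule conv_den_cfrac_denom) (simp add: c_a K_def)
  have y0_ge: "y 0 \<ge> 1"
  proof -
    \<comment> \<open>Positivity of \<open>c\<close> beyond \<open>K\<close> rests on
      \<open>y 0 \<ge> 1\<close>, so those terms are replaced by 1 here; they do not affect the
      denominator. For \<open>K = 0\<close> the denominator is 0.\<close>
    have "0 \<le> conv_den (\<lambda>i. if i \<le> K then c i else 1) K"
    proof (cases K)
      case (Suc K')
      have "conv_den (\<lambda>i. if i \<le> K then c i else 1) (Suc K') > 0"
        by (rule conv_den_pos) (use a_pos c_a in \<open>auto simp: K_def\<close>)
      then show ?thesis by (simp add: Suc)
    qed simp
    moreover have "conv_den (\<lambda>i. if i \<le> K then c i else 1) K = of_int (cfrac_denom a K)"
      by (rule conv_den_cfrac_denom) (simp add: c_a K_def)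
    ultimately show ?thesis using y0 by (simp add: K_def)
  qed
  have main: "x (Suc n) \<ge> 1 \<and> x (Suc n) \<in> \<int> \<and> y n \<ge> 1 \<and> y n \<in> \<int>" for n
  proof (induction n)
    case 0
    then show ?case using x1 q1 y0 y0_ge by simp
  next
    case (Suc n)
    let ?t = "x (Suc n) * of_nat (z (Suc n)) + 1"
    have x: "x (Suc n) > 0" using Suc by linarith
    have "?t \<ge> 1" using x by simp
    moreover have "?t \<in> \<int>" using Suc by auto
    ultimately have y: "y (Suc n) \<ge> 1" "y (Suc n) \<in> \<int>"
      using Suc mult_mono[of 1 "y n" 1 ?t] unfolding yS[OF x] by auto
    then show ?case using Suc mult_mono[of 1 "x (Suc n)" 1 "y (Suc n)"] unfolding xS[OF x] by auto
  qed
  have x_pos: "x (Suc n) > 0" for n using main[of n] by linarith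
  have y_ge_x: "x (Suc n) + 1 \<le> y (Suc n)" for n
  proof -
    have "x (Suc n) * 1 \<le> x (Suc n) * of_nat (z (Suc n))"
      using x_pos[of n] z_pos[of "Suc n"] by (intro mult_left_mono) auto
    then have "1 * (x (Suc n) + 1) \<le> y n * (x (Suc n) * of_nat (z (Suc n)) + 1)"
      using main[of n] x_pos[of n] by (intro mult_mono) auto
    then show ?thesis by (simp add: yS[OF x_pos])
  qed
  have x_double: "2 * x (Suc n) \<le> x (Suc (Suc n))" for n
  proof -
    have "2 \<le> y (Suc n)" using y_ge_x[of n] main[of n] by linarith
    then show ?thesis using x_pos[of n] by (simp add: xS[OF x_pos])
  qed
  have c_cases: "c i \<in> \<int> \<and> (i \<ge> 1 \<longrightarrow> c i > 0)" for i
  proof -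
    consider "i \<le> K" | j where "i = K + 2 * j + 1" | j where "i = K + 2 * j + 2"
    proof (cases "i \<le> K")
      case False
      then obtain l where l: "i = K + Suc l" by (metis less_imp_Suc_add not_le add_Suc_right)
      show ?thesis
      proof (cases "even l")
        case True
        then obtain j where "l = 2 * j" by (elim evenE)
        then show ?thesis using that(2)[of j] l by simp
      next
        case False
        then obtain j where "l = 2 * j + 1" by (elim oddE)
        then show ?thesis using that(3)[of j] l by simp
      qed
    qed (use that in blast)
    then show ?thesis
    proof cases
      case 1
      then show ?thesis using c_a[of i] a_pos[of i] by (simp add: K_def)
    next
      case (2 j)
      have ci: "c i = y j * of_nat (z (Suc j))" using c_odd[of "Suc j"] by (simp add: 2 K_def)
      have "y j > 0" using main[of j] by linarith
      then show ?thesis unfolding ci using main[of j] z_pos[of "Suc j"] by (auto intro: Ints_mult)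
    next
      case (3 j)
      have ci: "c i = x (Suc j)" using c_even[of "Suc j"] by (simp add: 3 K_def)
      then show ?thesis using main[of j] x_pos[of j] by simp
    qed
  qed
  have c_Ints: "c i \<in> \<int>" for i using c_cases by blast
  have c_pos: "c i > 0" if "i \<ge> 1" for i using c_cases that by blast
  have trunc: "cfrac_trunc n c = conv_num c (Suc n) / conv_den c (Suc n)" for n
    by (rule cfrac_trunc_eq) (rule c_pos)
  have den_pos: "conv_den c (Suc n) > 0" for n by (rule conv_den_pos) (rule c_pos)
  define Nm where "Nm n = \<lfloor>conv_num c n\<rfloor>" for n
  define Dn where "Dn n = \<lfloor>conv_den c n\<rfloor>" for n
  have Nm: "conv_num c n = of_int (Nm n)" for n
    using conv_Ints(1)[of c n, OF c_Ints] by (simp add: Nm_def)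
  have Dn: "conv_den c n = of_int (Dn n)" for n
    using conv_Ints(2)[of c n, OF c_Ints] by (simp add: Dn_def)
  have cop_ND: "coprime (Nm (Suc n)) (Dn (Suc n))" for n
  proof (rule coprimeI)
    fix d assume d: "d dvd Nm (Suc n)" "d dvd Dn (Suc n)"
    have "real_of_int (Nm (Suc n) * Dn n - Nm n * Dn (Suc n)) = of_int ((- 1) ^ Suc n)"
      using conv_determinant[of c n] by (simp add: Nm Dn)
    then have "Nm (Suc n) * Dn n - Nm n * Dn (Suc n) = (- 1) ^ Suc n" by (simp only: of_int_eq_iff)
    moreover have "d dvd Nm (Suc n) * Dn n - Nm n * Dn (Suc n)"
      using d by (intro dvd_diff dvd_mult2 dvd_mult)
    ultimately have "d dvd (- 1) ^ Suc n" by simp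
    moreover have "(- 1 :: int) ^ Suc n dvd 1" by (cases "even n") simp_all
    ultimately show "is_unit d" by (rule dvd_trans)
  qed
  have pq_trunc: "of_int p / of_int q = cfrac_trunc K c"
    unfolding pq K_def by (rule cfrac_trunc_cong) (simp add: c_a)
  \<comment> \<open>\<open>p / q\<close> and the convergent are equal fractions in lowest terms with
    positive denominators.\<close>
  have den_SK: "conv_den c (Suc K) = of_int q"
  proof -
    have "of_int p * conv_den c (Suc K) = conv_num c (Suc K) * of_int q"
      using pq_trunc den_pos[of K] q1 unfolding trunc by (simp add: frac_eq_eq)
    then have "real_of_int (p * Dn (Suc K)) = real_of_int (Nm (Suc K) * q)" by (simp add: Nm Dn)
    then have "p * Dn (Suc K) = Nm (Suc K) * q" by (simp only: of_int_eq_iff)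
    then have "\<bar>p\<bar> * \<bar>Dn (Suc K)\<bar> = \<bar>Nm (Suc K)\<bar> * \<bar>q\<bar>" by (simp flip: abs_mult)
    then have "\<bar>Dn (Suc K)\<bar> = \<bar>q\<bar>"
      using coprime_crossproduct_int[OF cop cop_ND[of K]] by blast
    moreover have "Dn (Suc K) > 0" using den_pos[of K] by (simp add: Dn)
    ultimately show ?thesis using q1 by (simp add: Dn)
  qed
  \<comment> \<open>The reason for the 1 added in \<open>y 0\<close>: once a denominator plus 1
    equals \<open>y n\<close>, the step with partial quotient \<open>x (n + 1)\<close> factors as
    \<open>x (n + 1)\<close> times the next denominator plus 1, which is
    \<open>x (n + 1) * y (n + 1)\<close>.\<close>
  have den: "conv_den c (K + 2 * n) + 1 = y n \<and> conv_den c (K + 2 * n + 1) = x (Suc n)" for n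
  proof (induction n)
    case 0
    then show ?case using den_K den_SK y0 x1 by (simp add: K_def)
  next
    case (Suc n)
    have c1: "c (K + 2 * n + 1) = y n * of_nat (z (Suc n))" using c_odd[of "Suc n"] by (simp add: K_def)
    have c2: "c (K + 2 * n + 2) = x (Suc n)" using c_even[of "Suc n"] by (simp add: K_def)
    have "conv_den c (K + 2 * n + 2) = y n * of_nat (z (Suc n)) * x (Suc n) + (y n - 1)"
      using Suc c1 by (simp add: numeral_2_eq_2)
    then have d1: "conv_den c (K + 2 * n + 2) + 1 = y (Suc n)"
      unfolding yS[OF x_pos] by (simp add: algebra_simps)
    have "conv_den c (K + 2 * n + 3) = x (Suc n) * conv_den c (K + 2 * n + 2) + x (Suc n)"
      using Suc c2 by (simp add: numeral_3_eq_3 numeral_2_eq_2)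
    then have "conv_den c (K + 2 * n + 3) = x (Suc n) * (conv_den c (K + 2 * n + 2) + 1)"
      by (simp add: algebra_simps)
    then have "conv_den c (K + 2 * n + 3) = x (Suc (Suc n))" unfolding d1 xS[OF x_pos] .
    then show ?case using d1 by (simp add: numeral_3_eq_3 numeral_2_eq_2)
  qed
  define s where "s n = cfrac_trunc (K + 2 * n) c" for n
  have s_eq: "s n = of_int (Nm (K + 2 * n + 1)) / x (Suc n)" for n
    unfolding s_def trunc using den[of n] by (simp add: Nm)
  \<comment> \<open>\<open>K\<close> is even, so the determinant has sign +1 and these convergents
    lie above \<open>s n\<close>.\<close>
  have odd_step: "cfrac_trunc (K + 2 * n + 1) c - s n = 1 / (x (Suc n) * conv_den c (K + 2 * n + 2))" for n
  proof -
    have "conv_num c (K + 2 * n + 2) * conv_den c (K + 2 * n + 1)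
        - conv_num c (K + 2 * n + 1) * conv_den c (K + 2 * n + 2) = 1"
      using conv_determinant[of c "K + 2 * n + 1"] by (simp add: K_def)
    moreover have "cfrac_trunc (K + 2 * n + 1) c = conv_num c (K + 2 * n + 2) / conv_den c (K + 2 * n + 2)"
      unfolding trunc by simp
    moreover have "s n = conv_num c (K + 2 * n + 1) / conv_den c (K + 2 * n + 1)"
      unfolding s_def trunc by simp
    moreover have "conv_den c (K + 2 * n + 1) > 0" "conv_den c (K + 2 * n + 2) > 0"
      using den_pos[of "K + 2 * n"] den_pos[of "K + 2 * n + 1"] by simp_all
    ultimately show ?thesis using den[of n] by (simp add: diff_frac_eq mult.commute)
  qed
  \<comment> \<open>Two convergents at distance 2 have as determinant the partial quotient between
    them, here \<open>x (n + 1)\<close>. It cancels one of the two denominators, leaving a unit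
    fraction.\<close>
  have s_step: "s (Suc n) = s n + 1 / x (n + 2)" for n
  proof -
    let ?j = "K + 2 * n"
    have c2: "c (?j + 2) = x (Suc n)" using c_even[of "Suc n"] by (simp add: K_def)
    have det: "conv_num c (?j + 2) * conv_den c (?j + 1) - conv_num c (?j + 1) * conv_den c (?j + 2) = 1"
      using conv_determinant[of c "?j + 1"] by (simp add: K_def)
    have N3: "conv_num c (?j + 3) = x (Suc n) * conv_num c (?j + 2) + conv_num c (?j + 1)"
      and D3: "conv_den c (?j + 3) = x (Suc n) * conv_den c (?j + 2) + conv_den c (?j + 1)"
      using c2 by (simp_all add: numeral_3_eq_3 numeral_2_eq_2)
    have "conv_num c (?j + 3) * conv_den c (?j + 1) - conv_num c (?j + 1) * conv_den c (?j + 3)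
      = x (Suc n) * (conv_num c (?j + 2) * conv_den c (?j + 1) - conv_num c (?j + 1) * conv_den c (?j + 2))"
      unfolding N3 D3 by (simp add: algebra_simps)
    also have "\<dots> = x (Suc n)" unfolding det by simp
    finally have e: "conv_num c (?j + 3) * conv_den c (?j + 1) - conv_num c (?j + 1) * conv_den c (?j + 3) = x (Suc n)" .
    have d: "conv_den c (?j + 1) = x (Suc n)" "conv_den c (?j + 3) = x (Suc (Suc n))"
      using den[of n] den[of "Suc n"] by (simp_all add: numeral_3_eq_3)
    have "s (Suc n) = conv_num c (?j + 3) / conv_den c (?j + 3)"
      unfolding s_def trunc by (simp add: numeral_3_eq_3)
    moreover have "s n = conv_num c (?j + 1) / conv_den c (?j + 1)"
      unfolding s_def trunc by simp
    ultimately have "s (Suc n) - s n = x (Suc n) / (x (Suc (Suc n)) * x (Suc n))"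
      using e x_pos[of n] x_pos[of "Suc n"] unfolding d by (simp add: diff_frac_eq mult.commute)
    then show ?thesis using x_pos[of n] by (simp add: field_simps)
  qed
  have s_sum: "s n = of_int p / of_int q + (\<Sum>j<n. 1 / x (j + 2))" for n
  proof (induction n)
    case 0
    then show ?case by (simp add: s_def pq_trunc)
  qed (simp add: s_step)
  have x_shift: "2 ^ j * x (Suc n) \<le> x (Suc (n + j))" for n j
  proof (induction j)
    case (Suc j)
    then show ?case using x_double[of "n + j"] by simp
  qed simp
  \<comment> \<open>The \<open>x\<close> at least double in each step, so every tail is dominated by
    a geometric series and is at most twice its first term.\<close>
  have term_le: "1 / x (j + n + 2) \<le> 1 / x (n + 2) * (1 / 2) ^ j" for n j
  proof -
    have "2 ^ j * x (n + 2) \<le> x (j + n + 2)" using x_shift[of j "Suc n"] by (simp add: add.commute)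
    then have "1 / x (j + n + 2) \<le> 1 / (2 ^ j * x (n + 2))"
      using x_pos[of "Suc n"] by (intro divide_left_mono mult_pos_pos) (auto intro: less_le_trans[of 0 "2 ^ j * x (n + 2)"])
    then show ?thesis by (simp add: power_divide mult.commute)
  qed
  have x2_pos: "x (n + 2) > 0" for n using x_pos[of "Suc n"] by simp
  have summable: "summable (\<lambda>j. 1 / x (j + 2))"
  proof (rule summable_comparison_test')
    show "summable (\<lambda>j. 1 / x (0 + 2) * (1 / 2) ^ j)" by (intro summable_mult summable_geometric) simp
    show "norm (1 / x (j + 2)) \<le> 1 / x (0 + 2) * (1 / 2) ^ j" if "j \<ge> 0" for j
      using term_le[of j 0] x2_pos[of j] by simp
  qed
  define S where "S = of_int p / of_int q + (\<Sum>j. 1 / x (j + 2))"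
  have s_lim: "s \<longlonglongrightarrow> S"
    unfolding S_def s_sum[abs_def] by (intro tendsto_add tendsto_const summable_LIMSEQ summable)
  have tail: "S - s n = (\<Sum>j. 1 / x (j + n + 2))" for n
    using suminf_split_initial_segment[OF summable, of n] by (simp add: S_def s_sum)
  have tail_bound: "0 \<le> S - s n \<and> S - s n \<le> 2 / x (n + 2)" for n
  proof -
    have g: "(\<lambda>j. 1 / x (n + 2) * (1 / 2) ^ j) sums (1 / x (n + 2) * (1 / (1 - 1 / 2)))"
      by (intro sums_mult geometric_sums) simp
    have sm: "summable (\<lambda>j. 1 / x (j + n + 2))"
      using summable_ignore_initial_segment[OF summable, of n] by (simp add: add.assoc)
    have "(\<Sum>j. 1 / x (j + n + 2)) \<le> (\<Sum>j. 1 / x (n + 2) * (1 / 2) ^ j)"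
      by (rule suminf_le[OF term_le sm sums_summable[OF g]])
    moreover have "0 \<le> (\<Sum>j. 1 / x (j + n + 2))"
      by (rule suminf_nonneg[OF sm]) (use x2_pos in \<open>simp add: less_imp_le\<close>)
    ultimately show ?thesis unfolding tail using sums_unique[OF g] by simp
  qed
  have x_lim: "(\<lambda>n. 1 / x (n + 2)) \<longlonglongrightarrow> 0" by (rule summable_LIMSEQ_zero[OF summable])
  have odd_lim: "(\<lambda>n. cfrac_trunc (K + 2 * n + 1) c) \<longlonglongrightarrow> S"
  proof -
    have "(\<lambda>n. cfrac_trunc (K + 2 * n + 1) c - s n) \<longlonglongrightarrow> 0"
    proof (rule tendsto_sandwich)
      have xn: "(\<lambda>n. 1 / x (Suc n)) \<longlonglongrightarrow> 0"
        by (rule LIMSEQ_imp_Suc) (use x_lim in simp)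
      show "(\<lambda>n. 0 :: real) \<longlonglongrightarrow> 0" by simp
      show "(\<lambda>n. 1 / x (Suc n)) \<longlonglongrightarrow> 0" by (rule xn)
      have B: "conv_den c (K + 2 * n + 2) \<ge> 1" for n
      proof -
        have "Suc (K + 2 * n + 1) = K + 2 * n + 2" by simp
        then have "0 < conv_den c (K + 2 * n + 2)" using den_pos[of "K + 2 * n + 1"] by metis
        then have "0 < Dn (K + 2 * n + 2)" unfolding Dn of_int_0_less_iff .
        then show ?thesis unfolding Dn by linarith
      qed
      show "\<forall>\<^sub>F n in sequentially. 0 \<le> cfrac_trunc (K + 2 * n + 1) c - s n"
        unfolding odd_step
      proof (intro always_eventually allI)
        fix n
        have "0 \<le> x (Suc n) * conv_den c (K + 2 * n + 2)"
          by (rule mult_nonneg_nonneg) (use B[of n] x_pos[of n] in linarith)+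
        then show "0 \<le> 1 / (x (Suc n) * conv_den c (K + 2 * n + 2))" by (rule zero_le_divide_1_iff[THEN iffD2])
      qed
      show "\<forall>\<^sub>F n in sequentially. cfrac_trunc (K + 2 * n + 1) c - s n \<le> 1 / x (Suc n)"
        unfolding odd_step
      proof (intro always_eventually allI divide_left_mono)
        fix n
        show "x (Suc n) \<le> x (Suc n) * conv_den c (K + 2 * n + 2)"
          using mult_left_mono[OF B[of n], of "x (Suc n)"] x_pos[of n] by simp
        show "0 < x (Suc n) * conv_den c (K + 2 * n + 2) * x (Suc n)"
          by (intro mult_pos_pos) (use B[of n] x_pos[of n] in linarith)+
      qed simp
    qed
    from tendsto_add[OF this s_lim] show ?thesis by simp
  qed
  have "(\<lambda>n. cfrac_trunc (n + K) c) \<longlonglongrightarrow> S"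
    by (rule LIMSEQ_even_odd) (use s_lim odd_lim in \<open>simp_all add: s_def[abs_def] add.commute\<close>)
  then have "(\<lambda>n. cfrac_trunc n c) \<longlonglongrightarrow> S" by (rule LIMSEQ_offset)
  then have expansion: "simple_cfrac_expansion c S"
    unfolding simple_cfrac_expansion_def using c_Ints c_pos by blast
  have "\<not> algebraic S"
  proof
    assume "algebraic S"
    \<comment> \<open>The approximations have exponent 5/2. Taking 2 + 1/4 leaves a factor
      \<open>X powr (1 / 4)\<close> to absorb the constant 2 of the tail bound, which works once
      \<open>X > 16\<close>; \<open>n\<close> is chosen to give this and to exceed
      \<open>B\<close>.\<close>
    then obtain B :: int where B: "\<And>p q::int. 0 < q \<Longrightarrow> coprime p q \<Longrightarrow>
        \<bar>S - of_int p / of_int q\<bar> < of_int q powr (- (2 + 1 / 4)) \<Longrightarrow> q \<le> B"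
      using roth[of S "1 / 4"] by auto
    obtain n where n: "max (of_int B) 16 < (2::real) ^ n" using real_arch_pow[of 2 "max (of_int B) 16"] by auto
    define X where "X = x (Suc (Suc n))"
    have "2 ^ Suc n * x (Suc 0) \<le> X" using x_shift[of "Suc n" 0] by (simp add: X_def)
    moreover have "(2::real) ^ n * 1 \<le> 2 ^ Suc n * x (Suc 0)" using main[of 0] by (intro mult_mono) auto
    ultimately have "2 ^ n \<le> X" by linarith
    then have X: "of_int B < X" "16 < X" using n by linarith+
    have "conv_den c (K + 2 * Suc n + 1) = X" unfolding X_def using den[of "Suc n"] by (rule conjunct2)
    then have XD: "X = of_int (Dn (K + 2 * Suc n + 1))" unfolding Dn by (rule sym)
    define Q where "Q = Dn (K + 2 * Suc n + 1)"
    have XQ: "X = of_int Q" unfolding Q_def by (rule XD)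
    have sX: "s (Suc n) = of_int (Nm (K + 2 * Suc n + 1)) / of_int Q"
      unfolding s_eq X_def[symmetric] XQ by (rule refl)
    have "\<bar>S - s (Suc n)\<bar> < X powr (- (2 + 1 / 4))"
    proof -
      define Y where "Y = y (Suc n)"
      have Y0: "0 < Y" using main[of "Suc n"] by (simp add: Y_def)
      \<comment> \<open>\<open>X\<close> is the product of \<open>Y\<close> and the previous
        \<open>x\<close>, which is smaller than \<open>Y\<close>; hence
        \<open>X \<le> Y\<^sup>2\<close>, and \<open>Y\<close> supplies the additional exponent
        1/2.\<close>
      have "X = x (Suc n) * Y" unfolding X_def Y_def by (rule xS[OF x_pos])
      also have "\<dots> \<le> Y * Y" using y_ge_x[of n] Y0 by (intro mult_right_mono) (auto simp: Y_def)
      finally have "sqrt X \<le> Y" using Y0 by (intro real_le_lsqrt) (auto simp: power2_eq_square)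
      then have XY: "X powr (1 / 2) \<le> Y" using X by (simp add: powr_half_sqrt)
      have "X * X \<le> X * (X * of_nat (z (Suc (Suc n))) + 1)"
      proof (intro mult_left_mono)
        have "X * 1 \<le> X * of_nat (z (Suc (Suc n)))"
          using X z_pos[of "Suc (Suc n)"] by (intro mult_left_mono) auto
        then show "X \<le> X * of_nat (z (Suc (Suc n))) + 1" by linarith
      qed (use X in simp)
      then have "X * X * Y \<le> X * (X * of_nat (z (Suc (Suc n))) + 1) * Y"
        using Y0 by (intro mult_right_mono) auto
      also have "\<dots> = x (n + 3)" using x_rec[of "Suc (Suc n)"]
        by (simp add: X_def Y_def numeral_3_eq_3 mult_ac)
      finally have x3: "X * X * Y \<le> x (n + 3)" .
      have "X powr 2 * X powr (1 / 2) \<le> X * X * Y"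
        using X XY by (intro mult_mono) (auto simp: powr_numeral power2_eq_square)
      also note x3
      finally have low: "X powr (5 / 2) \<le> x (n + 3)" by (simp flip: powr_add)
      have "2 = (16::real) powr (1 / 4)"
        using powr_powr[of "2::real" 4 "1 / 4"] by (simp add: powr_numeral)
      also have "\<dots> < X powr (1 / 4)" using X by (intro powr_less_mono2) auto
      finally have two: "2 < X powr (1 / 4)" .
      have "\<bar>S - s (Suc n)\<bar> \<le> 2 / x (n + 3)" using tail_bound[of "Suc n"] by (simp add: numeral_3_eq_3)
      also have "\<dots> \<le> 2 / X powr (5 / 2)" using low X x_pos[of "Suc (Suc n)"]
        by (intro divide_left_mono mult_pos_pos) (auto simp: numeral_3_eq_3)
      also have "\<dots> < X powr (1 / 4) / X powr (5 / 2)" using two X by (intro divide_strict_right_mono) auto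
      also have "\<dots> = X powr (- (2 + 1 / 4))" by (simp flip: powr_diff)
      finally show ?thesis .
    qed
    moreover have "coprime (Nm (K + 2 * Suc n + 1)) Q" using cop_ND[of "K + 2 * Suc n"] by (simp add: Q_def)
    moreover have "0 < Q" using X XQ by simp
    ultimately have "Q \<le> B" unfolding sX XQ by (intro B)
    then show False using X(1) XQ by simp
  qed
  then show ?thesis using summable expansion unfolding S_def Let_def by blast
qed

end
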